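(* Let $\{(N_k,B_k)\}_{k=1}^m$ be finitely many admissible pairs in $\mathbb{R}$, let $\mathbf n=\{n_k\}_{k=1}^\infty$ be a sequence of positive integers, let $\Omega=\{1,\dots,m\}^\infty$, and let $\mathbb{P}$ be the Bernoulli measure on $\Omega$ associated with a probability vector $(p_1,\dots,p_m)$ ($p_j\ge0$, $\sum_{j=1}^m p_j=1$). For $\omega=\omega_1\omega_2\cdots\in\Omega$ let $$\mu^{\mathbf n}(\omega)=\delta_{N_{\omega_1}^{-n_1}B_{\omega_1}}*\delta_{N_{\omega_1}^{-n_1}N_{\omega_2}^{-n_2}B_{\omega_2}}*\cdots,\qquad \mu(\omega)=\delta_{N_{\omega_1}^{-1}B_{\omega_1}}*\delta_{N_{\omega_1}^{-1}N_{\omega_2}^{-1}B_{\omega_2}}*\cdots,$$ and let $$\mathcal{E}_m=\{t\in\mathbb{N}_+:\gcd(t,N_k)=1\text{ for all }1\le k\le m\}.$$ If $\mu(\omega)$ is singular to Lebesgue measure for $\mathbb{P}$-a.e. $\omega\in\Omega$, then $\mu^{\mathbf n}$ is a spectral random measure $\mathbb{P}$-a.e., and $\mathcal{E}_m$ is an $\aleph_1$-spectral eigen set of $\mu^{\mathbf n}$ $\mathbb{P}$-a.e.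
   Context: For a nonempty finite $D\subset\mathbb{R}$, $\delta_D=\frac{1}{\#D}\sum_{a\in D}\delta_a$. Infinite convolutions are weak limits of the corresponding finite convolutions; those above exist for every $\omega\in\Omega$, and $(\omega,B)\mapsto\mu^{\mathbf n}(\omega)(B)$ is a random measure, denoted $\mu^{\mathbf n}$ (i.e. measurable in $\omega$ for each Borel $B$ and a measure in $B$ for each $\omega$). The Bernoulli measure is the Borel probability measure on $\Omega$ with $\mathbb{P}([\alpha_1\cdots\alpha_k])=p_{\alpha_1}\cdots p_{\alpha_k}$ for each cylinder $[\alpha_1\cdots\alpha_k]=\{\omega\in\Omega:\omega_i=\alpha_i,\ 1\le i\le k\}$. Admissible pair: an integer $N\ge2$ and a finite $B\subset\mathbb{Z}$ with $\#B\ge2$ form an admissible pair $(N,B)$ if there is $L\subset\mathbb{Z}$ such that the matrix $\left[\frac{1}{\sqrt{\#B}}e^{-2\pi i bl/N}\right]_{b\in B,\,l\in L}$ is unitary. A Borel probability measure $\eta$ on $\mathbb{R}$ is a spectral measure if there is a countable $\Lambda\subset\mathbb{R}$ (a spectrum of $\eta$) such that $\{e^{-2\pi i\lambda x}:\lambda\in\Lambda\}$ is an orthonormal basis of $L^2(\eta)$. A random measure $M$ on $\mathbb{R}$ is a spectral random measure $\mathbb{P}$-a.e. if $M(\omega)$ is a spectral measure for $\mathbb{P}$-a.e. $\omega$. A set $\mathcal{E}\subset\mathbb{R}$ containing $1$ is an $\aleph_1$-spectral eigen set of $M$ $\mathbb{P}$-a.e. if for $\mathbb{P}$-a.e. $\omega\in\Omega$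 there exist uncountably many subsets $\Lambda_\omega\subset\mathbb{R}$ such that $t\Lambda_\omega$ is a spectrum of $M(\omega)$ for all $t\in\mathcal{E}$. *)

theory Defs
  imports "HOL-Probability.Probability"
begin

text \<open>
  Infinite sequences are functions on \<^typ>\<open>nat\<close>, so position \<open>i\<close> here is position \<open>i + 1\<close>
  of the 1-based sequences \<open>\<omega> = \<omega>\<^sub>1\<omega>\<^sub>2\<dots>\<close> and \<open>n\<^sub>1, n\<^sub>2, \<dots>\<close>.  The alphabet
  remains \<open>{1..m}\<close>.
\<close>

definition unitary_matrix_on :: "'a set \<Rightarrow> 'b set \<Rightarrow> ('a \<Rightarrow> 'b \<Rightarrow> complex) \<Rightarrow> bool" where
  "unitary_matrix_on I J U \<longleftrightarrow> finite I \<and> finite J \<and>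
     (\<forall>i\<in>I. \<forall>i'\<in>I. (\<Sum>j\<in>J. U i j * cnj (U i' j)) = of_bool (i = i')) \<and>
     (\<forall>j\<in>J. \<forall>j'\<in>J. (\<Sum>i\<in>I. cnj (U i j) * U i j') = of_bool (j = j'))"

definition admissible_pair :: "nat \<Rightarrow> int set \<Rightarrow> bool" where
  "admissible_pair N B \<longleftrightarrow> 2 \<le> N \<and> finite B \<and> 2 \<le> card B \<and>
     (\<exists>L :: int set. unitary_matrix_on B L
        (\<lambda>b l. 1 / sqrt (card B) * exp (- 2 * pi * \<i> * of_int b * of_int l / of_nat N)))"

definition expfun :: "real \<Rightarrow> real \<Rightarrow> complex" where
  "expfun l x = exp (- 2 * pi * \<i> * l * x)"

definition L2_function :: "real measure \<Rightarrow> (real \<Rightarrow> complex) \<Rightarrow> bool" where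
  "L2_function M f \<longleftrightarrow> f \<in> borel_measurable M \<and> integrable M (\<lambda>x. (norm (f x))\<^sup>2)"

text \<open>
  Completeness in \<open>L\<^sup>2(M)\<close> is density of the linear span.  Functions that agree almost everywhere are
  not identified, and the basis is an indexed family, so distinct indices must give orthogonal functions.
\<close>

definition L2_orthonormal_basis :: "real measure \<Rightarrow> 'j set \<Rightarrow> ('j \<Rightarrow> real \<Rightarrow> complex) \<Rightarrow> bool" where
  "L2_orthonormal_basis M J e \<longleftrightarrow>
     (\<forall>j\<in>J. L2_function M (e j)) \<and>
     (\<forall>j\<in>J. \<forall>j'\<in>J. (\<integral>x. e j x * cnj (e j' x) \<partial>M) = of_bool (j = j')) \<and>
     (\<forall>f. L2_function M f \<longrightarrow>
        (\<forall>\<epsilon>>0. \<exists>F c. finite F \<and> F \<subseteq> J \<and>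
           (\<integral>x. (norm (f x - (\<Sum>j\<in>F. c j * e j x)))\<^sup>2 \<partial>M) < \<epsilon>))"

definition is_spectrum :: "real measure \<Rightarrow> real set \<Rightarrow> bool" where
  "is_spectrum M \<Lambda> \<longleftrightarrow> countable \<Lambda> \<and> L2_orthonormal_basis M \<Lambda> expfun"

definition spectral_measure :: "real measure \<Rightarrow> bool" where
  "spectral_measure M \<longleftrightarrow> real_distribution M \<and> (\<exists>\<Lambda>. is_spectrum M \<Lambda>)"

definition singular_to_lebesgue :: "real measure \<Rightarrow> bool" where
  "singular_to_lebesgue M \<longleftrightarrow>
     (\<exists>A\<in>sets borel. emeasure M A = 0 \<and> emeasure lborel (UNIV - A) = 0)"

definition random_measure :: "'w measure \<Rightarrow> ('w \<Rightarrow> real measure) \<Rightarrow> bool" where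
  "random_measure P M \<longleftrightarrow>
     (\<forall>\<omega>\<in>space P. sets (M \<omega>) = sets borel) \<and>
     (\<forall>B\<in>sets borel. (\<lambda>\<omega>. emeasure (M \<omega>) B) \<in> borel_measurable P)"

definition spectral_random_measure :: "'w measure \<Rightarrow> ('w \<Rightarrow> real measure) \<Rightarrow> bool" where
  "spectral_random_measure P M \<longleftrightarrow> random_measure P M \<and> (AE \<omega> in P. spectral_measure (M \<omega>))"

definition aleph1_spectral_eigen_set ::
    "'w measure \<Rightarrow> ('w \<Rightarrow> real measure) \<Rightarrow> real set \<Rightarrow> bool" where
  "aleph1_spectral_eigen_set P M E \<longleftrightarrow> 1 \<in> E \<and>
     (AE \<omega> in P. uncountable {\<Lambda> :: real set. \<forall>t\<in>E. is_spectrum (M \<omega>) ((\<lambda>x. t * x) ` \<Lambda>)})"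

definition bernoulli_measure :: "nat \<Rightarrow> (nat \<Rightarrow> real) \<Rightarrow> (nat \<Rightarrow> nat) measure" where
  "bernoulli_measure m p = (\<Pi>\<^sub>M i\<in>UNIV. point_measure {1..m} (\<lambda>j. ennreal (p j)))"

lemma space_bernoulli_measure: "space (bernoulli_measure m p) = {\<omega>. \<forall>i. \<omega> i \<in> {1..m}}"
  by (auto simp: bernoulli_measure_def space_PiM space_point_measure PiE_def Pi_def)

lemma emeasure_bernoulli_cylinder:
  assumes p: "\<And>j. j \<in> {1..m} \<Longrightarrow> 0 \<le> p j" "(\<Sum>j=1..m. p j) = 1"
    and a: "\<And>i. i < k \<Longrightarrow> \<alpha> i \<in> {1..m}"
  shows "prob_space (bernoulli_measure m p)"
    and "emeasure (bernoulli_measure m p)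
           {\<omega> \<in> space (bernoulli_measure m p). \<forall>i<k. \<omega> i = \<alpha> i} = ennreal (\<Prod>i<k. p (\<alpha> i))"
proof -
  let ?Q = "point_measure {1..m} (\<lambda>j. ennreal (p j))"
  have "emeasure ?Q (space ?Q) = 1"
    using p(2) sum_ennreal[of "{1..m}" p, OF p(1)]
    by (simp add: space_point_measure emeasure_point_measure_finite)
  then have Q: "prob_space ?Q" by (rule prob_spaceI)
  then show "prob_space (bernoulli_measure m p)"
    unfolding bernoulli_measure_def by (intro prob_space_PiM)
  interpret product_prob_space "\<lambda>_::nat. ?Q" UNIV
    by (intro product_prob_spaceI Q)
  have "emeasure (bernoulli_measure m p)
      {\<omega> \<in> space (bernoulli_measure m p). \<forall>i\<in>{..<k}. \<omega> i \<in> {\<alpha> i}} = (\<Prod>i<k. emeasure ?Q {\<alpha> i})"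
    unfolding bernoulli_measure_def
    by (rule emeasure_PiM_Collect) (use a in \<open>auto simp: sets_point_measure\<close>)
  also have "\<dots> = (\<Prod>i<k. ennreal (p (\<alpha> i)))"
    using a by (intro prod.cong) (auto simp: emeasure_point_measure_finite)
  also have "\<dots> = ennreal (\<Prod>i<k. p (\<alpha> i))"
    using p a by (intro prod_ennreal) auto
  finally show "emeasure (bernoulli_measure m p)
      {\<omega> \<in> space (bernoulli_measure m p). \<forall>i<k. \<omega> i = \<alpha> i} = ennreal (\<Prod>i<k. p (\<alpha> i))"
    by (simp add: Ball_def)
qed

text \<open>\<open>\<delta>\<^sub>D\<close> as a measure on all Borel sets (\<^const>\<open>uniform_count_measure\<close> lives on \<open>D\<close> only).\<close>

definition delta :: "real set \<Rightarrow> real measure" where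
  "delta D = distr (uniform_count_measure D) borel (\<lambda>x. x)"

lemma emeasure_delta:
  assumes "finite D" "D \<noteq> {}" "A \<in> sets borel"
  shows "emeasure (delta D) A = ennreal (1 / card D * (\<Sum>a\<in>D. indicator A a))"
proof -
  have "emeasure (delta D) A = emeasure (uniform_count_measure D) (A \<inter> D)"
    unfolding delta_def using assms
    by (subst emeasure_distr)
      (auto simp: space_uniform_count_measure uniform_count_measure_def space_point_measure)
  also have "\<dots> = ennreal (card (A \<inter> D) / card D)"
    using assms by (simp add: emeasure_uniform_count_measure)
  also have "real (card (A \<inter> D)) = (\<Sum>a\<in>D. indicator A a)"
    using assms by (simp add: indicator_def Int_commute flip: sum.inter_filter)
  finally show ?thesis by simp
qed

primrec finite_convolution :: "(nat \<Rightarrow> real measure) \<Rightarrow> nat \<Rightarrow> real measure" where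
  "finite_convolution \<nu> 0 = \<nu> 0"
| "finite_convolution \<nu> (Suc k) = (finite_convolution \<nu> k \<star> \<nu> (Suc k))"

text \<open>Weak limits of Borel probability measures on the line are unique when they exist.\<close>

definition infinite_convolution :: "(nat \<Rightarrow> real measure) \<Rightarrow> real measure" where
  "infinite_convolution \<nu> =
     (THE M. real_distribution M \<and> weak_conv_m (finite_convolution \<nu>) M)"

definition random_convolution ::
    "(nat \<Rightarrow> nat) \<Rightarrow> (nat \<Rightarrow> int set) \<Rightarrow> (nat \<Rightarrow> nat) \<Rightarrow> (nat \<Rightarrow> nat) \<Rightarrow> real measure" where
  "random_convolution N B n \<omega> = infinite_convolution
     (\<lambda>k. delta ((\<lambda>b. (\<Prod>i\<le>k. inverse (real (N (\<omega> i)) ^ n i)) * of_int b) ` B (\<omega> k)))"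

definition coprime_naturals :: "nat \<Rightarrow> (nat \<Rightarrow> nat) \<Rightarrow> nat set" where
  "coprime_naturals m N = {t. 0 < t \<and> (\<forall>k\<in>{1..m}. gcd t (N k) = 1)}"

end

theory Submission
  imports Defs "HOL-Computational_Algebra.Polynomial"
begin

text \<open>
  If every letter \<open>k\<close> of positive probability had \<open>card (B k) = N k\<close>, then the digits would be complete residue
  systems, the finite convolutions would consist of atoms of mass \<open>1 / M\<close> on the lattice of mesh \<open>1 / M\<close>,
  and \<open>\<mu>(\<omega>)\<close> would be dominated by Lebesgue measure. Hence singularity provides a letter \<open>a\<close> of positive
  probability with \<open>card (B a) < N a\<close>, and almost every \<open>\<omega>\<close> contains arbitrarily long blocks of \<open>a\<close>
  arbitrarily far out.

  Let \<open>\<nu>\<close> be a tail of the convolution that starts with such a block of length \<open>J\<close>, and let \<open>M = N a ^ q\<close> be the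
  scale of the block. The squared absolute values of the mask polynomial of the block at \<open>t (x + h)\<close>, for \<open>h\<close> modulo
  \<open>M\<close> and \<open>t\<close> coprime to \<open>N a\<close>, add up to \<open>M / card (B a) ^ J\<close>, which is large, while the Fourier transform of
  the rest can be small only near boundedly many points of an interval (Lagrange interpolation). So some integer \<open>h\<close>
  gives a lower bound for the Fourier transform of \<open>\<nu>\<close> at \<open>t (x + h)\<close> that depends only on \<open>t\<close>.

  A spectrum is the union of spectra of finite convolutions, whose elements are moved within their residue classes so
  that this lower bound applies; it makes the finite Parseval identities converge. Multiplication by \<open>t\<close>
  preserves the finite identities because \<open>\<zeta> \<mapsto> \<zeta> ^ t\<close> is a Galois automorphism of the roots of unity involved.
  Translates of a spectrum are spectra, which yields uncountably many.
\<close>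

section \<open>Vanishing sums of roots of unity\<close>

text \<open>The obstacle is the zero set: the Fourier transform of a tail may vanish exactly where
  Parseval needs it, and the tails vary with \<open>\<omega>\<close> and with the exponents. No
  limit measure of tails is used. The interpolation bound sees a tail only through the common bound
  \<open>R\<close> on the digits, so one block length and one \<open>\<epsilon>\<close> serve all
  tails that start with the block, whatever the exponents are. The strict inequality between
  \<open>card (B a)\<close> and \<open>N a\<close> is what makes the sum of squares grow with the
  length of the block. The lower bound for a given \<open>t\<close> is available at infinitely many
  levels only, not at all of them. This suffices: the sums of the squared values of the limit
  transform over the nested finite spectra increase and are bounded by 1, so their increments tend
  to 0, and a single good level far out controls the elements that were added after a fixed level.
  The same set has to work for infinitely many multipliers, so no choice may favour one of them for
  good. The identities at finite level hold for all multipliers at once, whichever of them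
  determined the representatives.\<close>

lemma prime_dvd_power_add_diff:
  fixes x y :: "'a::comm_ring_1"
  assumes "prime p"
  shows "of_nat p dvd (x + y) ^ p - x ^ p - y ^ p"
proof -
  have p: "0 < p" using assms by (simp add: prime_gt_0_nat)
  have "(x + y) ^ p = (\<Sum>k\<le>p. of_nat (p choose k) * x ^ k * y ^ (p - k))"
    by (rule binomial_ring)
  also have "{..p} = insert 0 (insert p {1..<p})" using p by auto
  also have "(\<Sum>k\<in>insert 0 (insert p {1..<p}). of_nat (p choose k) * x ^ k * y ^ (p - k)) =
      y ^ p + (\<Sum>k\<in>insert p {1..<p}. of_nat (p choose k) * x ^ k * y ^ (p - k))"
    using p by (subst sum.insert) auto
  also have "(\<Sum>k\<in>insert p {1..<p}. of_nat (p choose k) * x ^ k * y ^ (p - k)) =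
      x ^ p + (\<Sum>k\<in>{1..<p}. of_nat (p choose k) * x ^ k * y ^ (p - k))"
    by (subst sum.insert) auto
  finally have "(x + y) ^ p - x ^ p - y ^ p =
      (\<Sum>k\<in>{1..<p}. of_nat (p choose k) * x ^ k * y ^ (p - k))" by simp
  moreover have "of_nat p dvd (of_nat (p choose k) * x ^ k * y ^ (p - k) :: 'a)" if "k \<in> {1..<p}" for k
  proof -
    have "p dvd (p choose k)" using that assms p by (intro dvd_choose_prime) auto
    then have "(of_nat p :: 'a) dvd of_nat (p choose k)" by (auto elim!: dvdE)
    then show ?thesis by (intro dvd_mult2)
  qed
  ultimately show ?thesis by (metis (no_types, lifting) dvd_sum)
qed

lemma prime_dvd_int_power_diff:
  fixes a :: int
  assumes "prime p"
  shows "int p dvd a ^ p - a"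
proof -
  have p: "0 < p" using assms by (simp add: prime_gt_0_nat)
  have step: "int p dvd (b + 1) ^ p - (b + 1) \<longleftrightarrow> int p dvd b ^ p - b" for b :: int
  proof -
    have "int p dvd (b + 1) ^ p - b ^ p - 1"
      using prime_dvd_power_add_diff[OF assms, of b 1] by simp
    moreover have "(b + 1) ^ p - (b + 1) = ((b + 1) ^ p - b ^ p - 1) + (b ^ p - b)" by simp
    ultimately show ?thesis by (metis dvd_add_right_iff)
  qed
  show ?thesis
  proof (induction a rule: int_induct[of _ 0])
    case base show ?case using p by (simp add: zero_power)
  next
    case (step1 i) then show ?case using step[of i] by simp
  next
    case (step2 i) then show ?case using step[of "i - 1"] by simp
  qed
qed

text \<open>Frobenius on integer polynomials: modulo \<open>p\<close>, raising to the
  \<open>p\<close>-th power is additive and fixes constants (Fermat), so it acts by substituting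
  \<open>x^p\<close> for \<open>x\<close>.\<close>

lemma prime_dvd_pcompose_monom_diff:
  fixes P :: "int poly"
  assumes "prime p"
  shows "of_nat p dvd P ^ p - pcompose P (monom 1 p)"
proof (induction P)
  case 0
  have "0 < p" using assms by (simp add: prime_gt_0_nat)
  then show ?case by (simp add: zero_power)
next
  case (pCons a P)
  let ?X = "monom 1 1 :: int poly"
  have eq: "pCons a P = [:a:] + ?X * P" by (simp add: monom_altdef)
  have 1: "of_nat p dvd (pCons a P) ^ p - [:a:] ^ p - (?X * P) ^ p"
    unfolding eq by (rule prime_dvd_power_add_diff[OF assms])
  have "of_nat p dvd [:a ^ p - a:]"
    using prime_dvd_int_power_diff[OF assms, of a] by (auto simp: of_nat_poly elim!: dvdE)
  then have 2: "of_nat p dvd [:a:] ^ p - [:a:]" by (simp add: poly_const_pow)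
  have 3: "of_nat p dvd monom 1 p * (P ^ p - pcompose P (monom 1 p))"
    using pCons.IH by (rule dvd_mult)
  have "(?X * P) ^ p = monom 1 p * P ^ p"
    by (simp add: power_mult_distrib monom_power)
  moreover have "pcompose (pCons a P) (monom 1 p) = [:a:] + monom 1 p * pcompose P (monom 1 p)"
    by (simp add: pcompose_pCons)
  ultimately have "(pCons a P) ^ p - pcompose (pCons a P) (monom 1 p) =
      ((pCons a P) ^ p - [:a:] ^ p - (?X * P) ^ p) + ([:a:] ^ p - [:a:]) +
      monom 1 p * (P ^ p - pcompose P (monom 1 p))"
    by (simp only: right_diff_distrib)
  then show ?case using 1 2 3 by (metis dvd_add)
qed

text \<open>Coefficients stay integral, since both congruences modulo \<open>p\<close> and Gauss's
  lemma on primitive parts are needed below.\<close>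

definition ieval :: "complex \<Rightarrow> int poly \<Rightarrow> complex" where
  "ieval z P = poly (map_poly of_int P) z"

lemma map_poly_of_int_mult:
  "map_poly of_int (P * Q) = map_poly of_int P * (map_poly of_int Q :: 'a::comm_ring_1 poly)"
  by (rule poly_eqI) (simp add: coeff_map_poly coeff_mult)

lemma ieval_simps [simp]:
  "ieval z 0 = 0" "ieval z 1 = 1" "ieval z [:a:] = of_int a"
  "ieval z (pCons a P) = of_int a + z * ieval z P"
  "ieval z (P + Q) = ieval z P + ieval z Q"
  "ieval z (P - Q) = ieval z P - ieval z Q"
  "ieval z (P * Q) = ieval z P * ieval z Q"
  "ieval z (smult a P) = of_int a * ieval z P"
  "ieval z (monom a n) = of_int a * z ^ n"
proof -
  show mult: "ieval z (P * Q) = ieval z P * ieval z Q" for P Q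
    by (simp add: ieval_def map_poly_of_int_mult)
  show const: "ieval z [:a:] = of_int a" for a
    by (simp add: ieval_def map_poly_pCons)
  have "map_poly of_int (P + Q) = (map_poly of_int P + map_poly of_int Q :: complex poly)" for P Q
    by (rule poly_eqI) (simp add: coeff_map_poly)
  then show "ieval z (P + Q) = ieval z P + ieval z Q" by (simp add: ieval_def)
  have "map_poly of_int (P - Q) = (map_poly of_int P - map_poly of_int Q :: complex poly)" for P Q
    by (rule poly_eqI) (simp add: coeff_map_poly)
  then show "ieval z (P - Q) = ieval z P - ieval z Q" by (simp add: ieval_def)
  have "map_poly of_int (smult a P) = (smult (of_int a) (map_poly of_int P) :: complex poly)"
    by (rule poly_eqI) (simp add: coeff_map_poly)
  then show "ieval z (smult a P) = of_int a * ieval z P" by (simp add: ieval_def)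
  show "ieval z (pCons a P) = of_int a + z * ieval z P"
    by (simp add: ieval_def map_poly_pCons)
qed (simp_all add: ieval_def map_poly_monom poly_monom)

lemma ieval_of_nat [simp]: "ieval z (of_nat n) = of_nat n"
  by (simp add: of_nat_poly)

lemma ieval_power [simp]: "ieval z (P ^ n) = ieval z P ^ n"
  by (induction n) simp_all

lemma ieval_sum [simp]: "ieval z (sum f A) = (\<Sum>i\<in>A. ieval z (f i))"
  by (induction A rule: infinite_finite_induct) simp_all

lemma ieval_pcompose_monom [simp]: "ieval z (pcompose P (monom 1 p)) = ieval (z ^ p) P"
  by (induction P) (simp_all add: pcompose_pCons)

text \<open>The classical argument for the irreducibility of cyclotomic polynomials: if \<open>f\<close> is the minimal
  polynomial of an \<open>N\<close>-th root of unity \<open>z\<close> and \<open>f (z ^ p) \<noteq> 0\<close>, then the derivative of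
  \<open>x ^ N - 1\<close> at \<open>z ^ p\<close> shows that \<open>N / p\<close> is an algebraic integer.\<close>

lemma ieval_root_of_unity_prime_power:
  assumes p: "prime p" and pN: "\<not> p dvd N" and N: "0 < N" and z: "z ^ N = 1" and P: "ieval z P = 0"
  shows "ieval (z ^ p) P = 0"
proof -
  define W :: "int poly" where "W = monom 1 N - 1"
  have W0: "W \<noteq> 0"
  proof -
    have "coeff W N = 1" using N by (simp add: W_def)
    then show ?thesis by auto
  qed
  have zW: "ieval z W = 0" using z by (simp add: W_def)
  define good where "good g \<longleftrightarrow> g \<noteq> 0 \<and> ieval z g = 0" for g :: "int poly"
  obtain f0 where f0: "good f0" and f0min: "\<And>g. good g \<Longrightarrow> degree f0 \<le> degree g"
    using exists_least_iff[of "\<lambda>d. \<exists>g. good g \<and> degree g = d"] W0 zW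
    by (metis good_def linorder_not_le)
  \<comment> \<open>A nonzero annihilator of least degree is determined only up to a factor; its
    primitive part divides every annihilator over the integers, not just over the rationals.\<close>
  define f where "f = primitive_part f0"
  have cf: "smult (content f0) f = f0" by (simp add: f_def)
  have cf': "content f0 \<noteq> 0" using f0 by (simp add: good_def)
  have fz: "ieval z f = 0"
    using f0 cf cf' ieval_simps(8)[of z "content f0" f] by (auto simp: good_def)
  have f_nz: "f \<noteq> 0" using cf f0 by (auto simp: good_def)
  have fdeg: "degree f = degree f0" by (simp add: f_def)
  have primf: "primitive_part f = f"
    using f0 by (intro primitive_part_prim) (simp add: f_def good_def)
  have degf: "0 < degree f"
  proof (rule ccontr)
    assume "\<not> ?thesis"
    then obtain c where "f = [:c:]" by (auto elim: degree_eq_zeroE)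
    then show False using fz f_nz by simp
  qed
  have dvd: "f dvd G" if G: "ieval z G = 0" for G
  proof -
    obtain a q where aq: "a \<noteq> 0" "smult a G = f * q + pseudo_mod G f"
      and r: "pseudo_mod G f = 0 \<or> degree (pseudo_mod G f) < degree f"
      using pseudo_mod[OF f_nz, of G] by auto
    have "ieval z (pseudo_mod G f) = 0"
      using arg_cong[OF aq(2), of "ieval z"] G fz by simp
    then have "pseudo_mod G f = 0"
      using r f0min[of "pseudo_mod G f"] fdeg by (cases "pseudo_mod G f = 0") (simp_all add: good_def)
    then have eq: "smult a G = f * q" using aq by simp
    \<comment> \<open>Gauss's lemma: pseudo-division shows only that \<open>f\<close> divides a
      multiple of \<open>G\<close>; passing to primitive parts removes the factor \<open>a\<close>
      up to sign.\<close>
    have "smult (unit_factor a) (primitive_part G) = f * primitive_part q"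
      using arg_cong[OF eq, of primitive_part] primf
      by (simp add: primitive_part_smult primitive_part_mult)
    then have "f dvd smult (unit_factor a) (primitive_part G)" by simp
    moreover have "unit_factor a = 1 \<or> unit_factor a = -1"
      using aq(1) by (simp add: sgn_if)
    ultimately have "f dvd primitive_part G" by auto
    then show "f dvd G" by (metis content_times_primitive_part dvd_smult)
  qed
  obtain g where g: "W = f * g" using dvd[OF zW] by (auto elim: dvdE)
  show ?thesis
  proof (rule ccontr)
    assume "ieval (z ^ p) P \<noteq> 0"
    then have fzp: "ieval (z ^ p) f \<noteq> 0"
      using dvd[OF P] by (auto elim!: dvdE)
    have "ieval (z ^ p) W = 0"
      using z by (simp add: W_def power_mult[symmetric] mult.commute) (simp add: power_mult)
    then have gzp: "ieval (z ^ p) g = 0" using fzp g by simp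
    obtain h where h: "f ^ p - pcompose f (monom 1 p) = of_nat p * h"
      using prime_dvd_pcompose_monom_diff[OF p, of f] by (auto elim: dvdE)
    have fh: "ieval (z ^ p) f = - of_nat p * ieval z h"
      using arg_cong[OF h, of "ieval z"] fz prime_gt_0_nat[OF p]
      by (simp add: zero_power) (metis minus_minus)
    have "pderiv W = monom (of_nat N) (N - 1)"
      by (simp add: W_def pderiv_diff pderiv_monom)
    then have "ieval (z ^ p) (monom (of_nat N) (N - 1)) = ieval (z ^ p) (pderiv (f * g))"
      using g by simp
    \<comment> \<open>Product rule at \<open>z ^ p\<close>: the term with \<open>g\<close> itself
      drops out, and the value of \<open>f\<close> is a multiple of \<open>p\<close> by
      \<open>fh\<close>.\<close>
    then have d: "of_nat N * (z ^ p) ^ (N - 1) = - of_nat p * ieval z h * ieval (z ^ p) (pderiv g)"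
      using gzp fh by (simp add: pderiv_mult)
    have "(z ^ p) ^ (N - 1) * z ^ p = (z ^ N) ^ p"
      using N by (metis power_mult mult.commute power_Suc2 Suc_diff_1)
    then have zz: "(z ^ p) ^ (N - 1) * z ^ p = 1" using z by simp
    \<comment> \<open>\<open>S\<close> expresses the quotient as a polynomial in \<open>z\<close>
      itself; the factor \<open>monom 1 p\<close> serves to turn \<open>(z ^ p) ^ (N - 1)\<close>
      into 1.\<close>
    define S where "S = - (h * pcompose (pderiv g) (monom 1 p) * monom 1 p)"
    have Sz: "of_nat N = of_nat p * ieval z S"
    proof -
      have "of_nat N = (of_nat N * (z ^ p) ^ (N - 1)) * z ^ p" using zz by (simp add: mult.assoc)
      also have "\<dots> = of_nat p * ieval z S"
        unfolding d S_def using ieval_simps(6)[of z 0 "h * pcompose (pderiv g) (monom 1 p) * monom 1 p"]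
        by simp
      finally show ?thesis .
    qed
    have lead: "lead_coeff f * lead_coeff g = 1"
    proof -
      have "lead_coeff W = 1"
      proof -
        have c: "coeff W N = 1" using N by (simp add: W_def)
        have "degree W \<le> N" unfolding W_def
          by (intro degree_diff_le) (simp_all add: degree_monom_le)
        moreover have "N \<le> degree W" using c by (intro le_degree) simp
        ultimately show ?thesis using c by simp
      qed
      then show ?thesis using g by (simp add: lead_coeff_mult)
    qed
    obtain a q where aq: "a = lead_coeff f ^ (Suc (degree S) - degree f)"
        "smult a S = f * q + pseudo_mod S f"
      and r: "pseudo_mod S f = 0 \<or> degree (pseudo_mod S f) < degree f"
      using pseudo_divmod[OF f_nz, of S "fst (pseudo_divmod S f)" "pseudo_mod S f"]
      by (auto simp: pseudo_mod_def)
    \<comment> \<open>\<open>f\<close> divides the monic \<open>W\<close>, so its leading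
      coefficient is a unit and pseudo-division by \<open>f\<close> is true division up to the sign
      \<open>a\<close>.\<close>
    have "a dvd 1" unfolding aq using lead by (metis dvdI is_unit_power_iff)
    then have aa: "a * a = 1" by (metis abs_mult_self_eq mult_1 zdvd1_eq)
    define r where "r = smult a (pseudo_mod S f)"
    have "ieval z S = of_int (a * a) * ieval z S" using aa by simp
    also have "\<dots> = of_int a * ieval z (smult a S)" by simp
    also have "\<dots> = ieval z r" unfolding aq(2) r_def using fz by simp
    finally have "of_nat N = of_nat p * ieval z r" using Sz by simp
    \<comment> \<open>This polynomial has smaller degree than \<open>f\<close>, hence is 0; its
      constant coefficient then shows \<open>p dvd N\<close>.\<close>
    then have "ieval z (of_nat N - smult (int p) r) = 0" by simp
    moreover have "degree (of_nat N - smult (int p) r) < degree f"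
      using r degf degree_smult_le[of "int p" r] degree_smult_le[of a "pseudo_mod S f"]
      by (intro le_less_trans[OF degree_diff_le_max]) (auto simp: r_def)
    ultimately have "of_nat N - smult (int p) r = 0"
      using f0min[of "of_nat N - smult (int p) r"] fdeg by (auto simp: good_def)
    then have "coeff (of_nat N :: int poly) 0 = coeff (smult (int p) r) 0" by simp
    then have "int N = int p * coeff r 0" by (simp add: of_nat_poly)
    then have "int p dvd int N" by simp
    then show False using pN by simp
  qed
qed

text \<open>One prime factor of \<open>t\<close> is peeled off at a time; \<open>z ^ p\<close> is
  again an \<open>N\<close>-th root of unity and a zero of \<open>P\<close>, so the induction goes
  on with it.\<close>

lemma ieval_root_of_unity_power:
  assumes "coprime t N" "0 < N" "0 < t" "z ^ N = 1" "ieval z P = 0"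
  shows "ieval (z ^ t) P = 0"
  using assms
proof (induction t arbitrary: z rule: prime_divisors_induct)
  case zero then show ?case by simp
next
  case (unit x) then show ?case by simp
next
  case (factor p t)
  have "\<not> p dvd N"
    using factor.prems(1) factor.hyps by (meson coprime_absorb_left coprime_mult_left_iff not_prime_unit)
  then have "ieval (z ^ p) P = 0"
    using factor by (intro ieval_root_of_unity_prime_power[of p N]) auto
  moreover have "(z ^ p) ^ N = 1" using factor.prems by (metis power_mult mult.commute power_one)
  ultimately have "ieval ((z ^ p) ^ t) P = 0"
    using factor.prems by (intro factor.IH) auto
  then show ?case by (simp add: power_mult)
qed

lemma sum_roots_of_unity_galois:
  fixes a :: "'i \<Rightarrow> int" and N t :: nat
  assumes "finite I" "0 < N" "coprime t N" "0 < t"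
    and "(\<Sum>i\<in>I. cis (2 * pi * of_int (a i) / N)) = 0"
  shows "(\<Sum>i\<in>I. cis (2 * pi * of_nat t * of_int (a i) / N)) = 0"
proof -
  define z where "z = cis (2 * pi / N)"
  \<comment> \<open>Exponents are reduced modulo \<open>N\<close> to natural numbers, so that the
    sum becomes the value of an integer polynomial at \<open>z\<close>.\<close>
  define e where "e i = nat (a i mod int N)" for i
  have zN: "z ^ N = 1" unfolding z_def using assms(2) by (subst Complex.DeMoivre) simp
  have *: "z ^ (s * e i) = cis (2 * pi * of_nat s * of_int (a i) / N)" for s i
  proof -
    have "real (e i) = of_int (a i mod int N)" using assms(2) by (simp add: e_def)
    also have "\<dots> = of_int (a i) - N * of_int (a i div int N)"
      by (simp add: minus_mult_div_eq_mod[symmetric])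
    finally have ai: "of_int (a i) = real (e i) + N * of_int (a i div int N)" by simp
    have "2 * pi / N * (real s * e i) =
        2 * pi * of_nat s * of_int (a i) / N - 2 * pi * of_int (int s * (a i div int N))"
      using assms(2) by (subst ai) (simp add: field_simps)
    then have "z ^ (s * e i) = cis (2 * pi * of_nat s * of_int (a i) / N - 2 * pi * of_int (int s * (a i div int N)))"
      by (simp add: z_def Complex.DeMoivre mult.commute)
    also have "\<dots> = cis (2 * pi * of_nat s * of_int (a i) / N) / cis (2 * pi * of_int (int s * (a i div int N)))"
      by (simp only: cis_divide)
    also have "cis (2 * pi * of_int (int s * (a i div int N))) = 1"
      by (rule cis_multiple_2pi) simp
    finally show ?thesis by simp
  qed
  define P :: "int poly" where "P = (\<Sum>i\<in>I. monom 1 (e i))"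
  have "ieval z P = 0" using *[of 1] assms(5) by (simp add: P_def)
  then have "ieval (z ^ t) P = 0" using assms zN by (intro ieval_root_of_unity_power[of t N]) auto
  then show ?thesis using *[of t] by (simp add: P_def power_mult[symmetric])
qed

section \<open>Lagrange interpolation\<close>

lemma Rolle_iterated:
  fixes g :: "nat \<Rightarrow> real \<Rightarrow> real"
  assumes "\<And>k y. (g k has_real_derivative g (Suc k) y) (at y)"
    and "finite Z" "card Z = Suc n" "\<And>z. z \<in> Z \<Longrightarrow> g 0 z = 0"
  shows "\<exists>y. g n y = 0"
  using assms
proof (induction n arbitrary: g Z)
  case 0
  then obtain z where "Z = {z}" using card_1_singletonE by (metis One_nat_def)
  then show ?case using 0 by auto
next
  case (Suc n)
  define s where "s i = sorted_list_of_set Z ! i" for i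
  have len: "length (sorted_list_of_set Z) = Suc (Suc n)" using Suc.prems by simp
  have smono: "s i < s j" if "i < j" "j < Suc (Suc n)" for i j
    unfolding s_def using that len strict_sorted_iff sorted_wrt_nth_less[OF strict_sorted_list_of_set]
    by (metis Suc.prems(2))
  have sZ: "s i \<in> Z" if "i < Suc (Suc n)" for i
    unfolding s_def using that len Suc.prems(2) by (metis nth_mem set_sorted_list_of_set)
  have "\<exists>w. s i < w \<and> w < s (Suc i) \<and> g 1 w = 0" if "i < Suc n" for i
  proof -
    have "s i < s (Suc i)" using smono that by simp
    moreover have "g 0 (s i) = g 0 (s (Suc i))" using Suc.prems(4) sZ that by simp
    moreover have "continuous_on {s i..s (Suc i)} (g 0)"
      using Suc.prems(1) by (intro DERIV_continuous_on) (blast intro: DERIV_subset)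
    ultimately obtain w where "s i < w" "w < s (Suc i)" "DERIV (g 0) w :> 0"
      using Rolle[of "s i" "s (Suc i)" "g 0"] Suc.prems(1) real_differentiable_def by blast
    then show ?thesis using DERIV_unique[OF _ Suc.prems(1)[of 0 w]] by auto
  qed
  then obtain w where w: "\<And>i. i < Suc n \<Longrightarrow> s i < w i \<and> w i < s (Suc i) \<and> g 1 (w i) = 0" by metis
  have wmono: "w i < w j" if "i < j" "j < Suc n" for i j
  proof -
    have "w i < s (Suc i)" using w that by simp
    also have "s (Suc i) \<le> s j" using smono[of "Suc i" j] that by (cases "Suc i = j") auto
    also have "\<dots> < w j" using w that by simp
    finally show ?thesis .
  qed
  have "inj_on w {..<Suc n}" by (rule inj_onI) (metis lessThan_iff less_irrefl nat_neq_iff wmono)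
  then have "card (w ` {..<Suc n}) = Suc n" by (simp add: card_image)
  moreover have "\<exists>y. (\<lambda>k. g (Suc k)) n y = 0"
    by (rule Suc.IH[of "\<lambda>k. g (Suc k)" "w ` {..<Suc n}"])
      (use Suc.prems(1) w calculation in auto)
  ultimately show ?case by simp
qed

text \<open>The value at 0 of the Lagrange basis polynomial of the node \<open>z i\<close>.\<close>

definition lagrange_weight :: "nat set \<Rightarrow> (nat \<Rightarrow> real) \<Rightarrow> nat \<Rightarrow> real" where
  "lagrange_weight I z i = (\<Prod>j\<in>I - {i}. z j / (z j - z i))"

lemma higher_pderiv_monic:
  fixes q :: "real poly"
  assumes "degree q \<le> n" "coeff q n = c"
  shows "(pderiv ^^ n) q = [:fact n * c:]"
proof (rule poly_eqI)
  fix m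
  show "coeff ((pderiv ^^ n) q) m = coeff [:fact n * c:] m"
  proof (cases m)
    case 0 then show ?thesis using assms by (simp add: coeff_higher_pderiv pochhammer_fact)
  next
    case (Suc k)
    then have "coeff q (m + n) = 0" using assms by (intro coeff_eq_0) auto
    then show ?thesis using Suc by (simp add: coeff_higher_pderiv)
  qed
qed

text \<open>The remainder argument of interpolation, at the point 0: \<open>g 0\<close> minus the
  interpolant minus \<open>K\<close> times the node polynomial has one zero more than there are
  nodes. So its \<open>n\<close>-th derivative vanishes somewhere, which evaluates
  \<open>K\<close>.\<close>

lemma lagrange_error:
  fixes g :: "nat \<Rightarrow> real \<Rightarrow> real" and z :: "nat \<Rightarrow> real"
  assumes der: "\<And>k y. (g k has_real_derivative g (Suc k) y) (at y)"
    and I: "finite I" "card I = n" and inj: "inj_on z I"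
    and z01: "\<And>i. i \<in> I \<Longrightarrow> \<bar>z i\<bar> \<le> 1"
    and bound: "\<And>y. \<bar>g n y\<bar> \<le> A"
  shows "\<bar>g 0 0 - (\<Sum>i\<in>I. g 0 (z i) * lagrange_weight I z i)\<bar> \<le> A / fact n"
proof (cases "\<exists>i\<in>I. z i = 0")
  \<comment> \<open>With a node at 0 the node polynomial vanishes there and \<open>K\<close> would
    be undefined; but then the weights are 0 and 1 and the error is 0.\<close>
  case True
  then obtain i where i: "i \<in> I" "z i = 0" by auto
  have w: "lagrange_weight I z j = (if j = i then 1 else 0)" if "j \<in> I" for j
  proof (cases "j = i")
    case True
    have "z k \<noteq> 0" if "k \<in> I - {i}" for k
      using inj_onD[OF inj, of k i] that i by auto
    then have "(\<Prod>k\<in>I - {i}. z k / (z k - z i)) = (\<Prod>k\<in>I - {i}. 1)"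
      using i by (intro prod.cong) auto
    then show ?thesis using True by (simp add: lagrange_weight_def)
  next
    case False
    then have "i \<in> I - {j}" using i by auto
    then show ?thesis using False i I unfolding lagrange_weight_def
      by (simp only: if_False) (intro prod_zero, auto)
  qed
  have "(\<Sum>j\<in>I. g 0 (z j) * lagrange_weight I z j) = (\<Sum>j\<in>I. if j = i then g 0 (z i) else 0)"
    by (intro sum.cong) (auto simp: w)
  also have "\<dots> = g 0 0" using I i by simp
  \<comment> \<open>\<open>bound[of 0]\<close> supplies \<open>0 \<le> A\<close>.\<close>
  finally show ?thesis using bound[of 0] by simp
next
  case False
  define L where "L i = (\<Prod>j\<in>I - {i}. [:-z j, 1:])" for i
  define c where "c i = (\<Prod>j\<in>I - {i}. z i - z j)" for i
  define p where "p = (\<Sum>i\<in>I. smult (g 0 (z i) / c i) (L i))"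
  define q where "q = (\<Prod>j\<in>I. [:-z j, 1:])"
  define K where "K = (g 0 0 - poly p 0) / poly q 0"
  have c_nz: "c i \<noteq> 0" if "i \<in> I" for i
    using that I inj by (auto simp: c_def prod_zero_iff dest: inj_onD)
  have q0: "poly q 0 = (\<Prod>j\<in>I. - z j)" by (simp add: q_def poly_prod)
  have q0_nz: "poly q 0 \<noteq> 0" using False I by (simp add: q0 prod_zero_iff)
  have degL: "degree (L i) = n - 1" if "i \<in> I" for i
    using that I by (simp add: L_def degree_prod_eq_sum_degree)
  have degq: "degree q = n" using I by (simp add: q_def degree_prod_eq_sum_degree)
  have lq: "coeff q n = 1"
    using lead_coeff_prod[of "\<lambda>j. [:-z j, 1:]" I] degq by (simp add: q_def)
  have polyL: "poly (L i) (z k) = (if i = k then c i else 0)" if "i \<in> I" "k \<in> I" for i k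
    using that I by (auto simp: L_def c_def poly_prod prod_zero_iff)
  have pz: "poly p (z k) = g 0 (z k)" if k: "k \<in> I" for k
  proof -
    have "poly p (z k) = (\<Sum>i\<in>I. if i = k then g 0 (z k) else 0)"
      unfolding p_def poly_sum using k c_nz by (intro sum.cong) (auto simp: polyL)
    then show ?thesis using k I by simp
  qed
  have qz: "poly q (z k) = 0" if "k \<in> I" for k
    using that I by (auto simp: q_def poly_prod prod_zero_iff)
  define r where "r = p + smult K q"
  define h where "h k y = g k y - poly ((pderiv ^^ k) r) y" for k y
  have "\<exists>y. h n y = 0"
  proof (rule Rolle_iterated)
    show "(h k has_real_derivative h (Suc k) y) (at y)" for k y
      unfolding h_def by (auto intro!: derivative_eq_intros der poly_DERIV)
    show "finite (insert 0 (z ` I))" using I by simp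
    show "card (insert 0 (z ` I)) = Suc n"
      using I inj False by (subst card_insert_disjoint) (auto simp: card_image)
    show "h 0 w = 0" if "w \<in> insert 0 (z ` I)" for w
      using that pz qz q0_nz by (auto simp: h_def r_def K_def)
  qed
  then obtain y where y: "g n y = poly ((pderiv ^^ n) r) y" by (auto simp: h_def)
  have "n > 0 \<or> I = {}" using I by auto
  have degp: "degree p \<le> n" "coeff p n = 0"
  proof -
    have "degree p \<le> n - 1" unfolding p_def
      by (intro degree_sum_le I) (auto intro: order_trans[OF degree_smult_le] simp: degL)
    then show "degree p \<le> n" by simp
    show "coeff p n = 0"
    proof (cases "n = 0")
      case True then show ?thesis using I by (simp add: p_def)
    next
      case False then show ?thesis using \<open>degree p \<le> n - 1\<close> by (intro coeff_eq_0) auto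
    qed
  qed
  have "(pderiv ^^ n) r = [:fact n * K:]"
    by (rule higher_pderiv_monic)
      (use degp degq lq in \<open>auto simp: r_def intro!: degree_add_le order_trans[OF degree_smult_le]\<close>)
  then have "K = g n y / fact n" using y by simp
  then have K: "\<bar>K\<bar> \<le> A / fact n" using bound[of y] by (simp add: divide_right_mono)
  have "\<bar>poly q 0\<bar> = (\<Prod>j\<in>I. \<bar>z j\<bar>)" by (simp add: q0 abs_prod)
  also have "\<dots> \<le> 1" using z01 by (intro prod_le_1) auto
  finally have "\<bar>poly q 0\<bar> \<le> 1" .
  then have "\<bar>K * poly q 0\<bar> \<le> A / fact n"
    using mult_mono[OF K] K by (fastforce simp: abs_mult)
  moreover have "K * poly q 0 = g 0 0 - poly p 0" using q0_nz by (simp add: K_def)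
  moreover have "poly p 0 = (\<Sum>i\<in>I. g 0 (z i) * lagrange_weight I z i)"
  proof -
    have "poly (L i) 0 / c i = lagrange_weight I z i" for i
      unfolding L_def c_def lagrange_weight_def poly_prod prod_dividef[symmetric]
    proof (intro prod.cong refl)
      fix j
      have "- z j / (z i - z j) = - z j / - (z j - z i)" by simp
      also have "\<dots> = z j / (z j - z i)" by (rule minus_divide_divide)
      finally have "- z j / (z i - z j) = z j / (z j - z i)" .
      then show "poly [:- z j, 1:] 0 / (z i - z j) = z j / (z j - z i)" by simp
    qed
    from this[symmetric] have "poly (smult (g 0 (z i) / c i) (L i)) 0 = g 0 (z i) * lagrange_weight I z i" for i
      by simp
    then show ?thesis by (simp add: p_def poly_sum)
  qed
  ultimately show ?thesis by simp
qed

text \<open>Rolle's theorem is real, so the error is bounded for cosine and sine separately, which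
  costs the factor 2.\<close>

lemma lagrange_error_cis:
  fixes z :: "nat \<Rightarrow> real"
  assumes I: "finite I" "card I = n" and inj: "inj_on z I"
    and z01: "\<And>i. i \<in> I \<Longrightarrow> \<bar>z i\<bar> \<le> 1" and a: "\<bar>a\<bar> \<le> A"
  shows "norm (1 - (\<Sum>i\<in>I. cis (a * z i) * of_real (lagrange_weight I z i))) \<le> 2 * A ^ n / fact n"
proof -
  let ?w = "lagrange_weight I z"
  have A: "\<bar>a ^ n * u\<bar> \<le> A ^ n" if "\<bar>u\<bar> \<le> 1" for u
  proof -
    have "\<bar>a ^ n * u\<bar> = \<bar>a\<bar> ^ n * \<bar>u\<bar>" by (simp add: abs_mult power_abs)
    also have "\<dots> \<le> A ^ n * 1" using that a by (intro mult_mono power_mono) auto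
    finally show ?thesis by simp
  qed
  have c: "\<bar>1 - (\<Sum>i\<in>I. cos (a * z i) * ?w i)\<bar> \<le> A ^ n / fact n"
  proof -
    \<comment> \<open>Writing the derivatives as phase shifts by \<open>pi / 2\<close> gives one
      formula for all orders.\<close>
    have "\<bar>g 0 0 - (\<Sum>i\<in>I. g 0 (z i) * ?w i)\<bar> \<le> A ^ n / fact n"
      if "g = (\<lambda>k y. a ^ k * cos (a * y + k * pi / 2))" for g
    proof (rule lagrange_error[OF _ I inj z01])
      show "(g k has_real_derivative g (Suc k) y) (at y)" for k y
      proof -
        have "a * y + Suc k * pi / 2 = (a * y + k * pi / 2) + pi / 2"
          by (simp add: add_divide_distrib distrib_right)
        then have eq: "cos (a * y + Suc k * pi / 2) = - sin (a * y + k * pi / 2)"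
          by (simp only: cos_add sin_add cos_pi_half sin_pi_half) simp
        have "((\<lambda>y. a * y + k * pi / 2) has_real_derivative a) (at y)"
          by (rule derivative_eq_intros refl | simp)+
        then have "((\<lambda>y. cos (a * y + k * pi / 2)) has_real_derivative - sin (a * y + k * pi / 2) * a) (at y)"
          by (rule DERIV_fun_cos)
        from DERIV_cmult[OF this, of "a ^ k"] show ?thesis
          unfolding that eq by (simp add: mult_ac)
      qed
      show "\<bar>g n y\<bar> \<le> A ^ n" for y
        unfolding that by (rule A) simp
    qed
    from this[OF refl] show ?thesis by simp
  qed
  have s: "\<bar>0 - (\<Sum>i\<in>I. sin (a * z i) * ?w i)\<bar> \<le> A ^ n / fact n"
  proof -
    have "\<bar>g 0 0 - (\<Sum>i\<in>I. g 0 (z i) * ?w i)\<bar> \<le> A ^ n / fact n"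
      if "g = (\<lambda>k y. a ^ k * sin (a * y + k * pi / 2))" for g
    proof (rule lagrange_error[OF _ I inj z01])
      show "(g k has_real_derivative g (Suc k) y) (at y)" for k y
      proof -
        have "a * y + Suc k * pi / 2 = (a * y + k * pi / 2) + pi / 2"
          by (simp add: add_divide_distrib distrib_right)
        then have eq: "sin (a * y + Suc k * pi / 2) = cos (a * y + k * pi / 2)"
          by (simp only: cos_add sin_add cos_pi_half sin_pi_half) simp
        have "((\<lambda>y. a * y + k * pi / 2) has_real_derivative a) (at y)"
          by (rule derivative_eq_intros refl | simp)+
        then have "((\<lambda>y. sin (a * y + k * pi / 2)) has_real_derivative cos (a * y + k * pi / 2) * a) (at y)"
          by (rule DERIV_fun_sin)
        from DERIV_cmult[OF this, of "a ^ k"] show ?thesis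
          unfolding that eq by (simp add: mult_ac)
      qed
      show "\<bar>g n y\<bar> \<le> A ^ n" for y
        unfolding that by (rule A) simp
    qed
    from this[OF refl] show ?thesis by simp
  qed
  have "1 - (\<Sum>i\<in>I. cis (a * z i) * of_real (?w i)) =
      Complex (1 - (\<Sum>i\<in>I. cos (a * z i) * ?w i)) (0 - (\<Sum>i\<in>I. sin (a * z i) * ?w i))"
    by (simp add: complex_eq_iff)
  also have "norm \<dots> \<le> \<bar>1 - (\<Sum>i\<in>I. cos (a * z i) * ?w i)\<bar> + \<bar>0 - (\<Sum>i\<in>I. sin (a * z i) * ?w i)\<bar>"
    by (rule order_trans[OF cmod_le]) simp
  finally show ?thesis using c s by linarith
qed

section \<open>Admissible pairs\<close>

text \<open>The Fourier transform of the uniform measure on \<open>D\<close>; integrality of the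
  digits makes it 1-periodic.\<close>

definition digit_mask :: "int set \<Rightarrow> real \<Rightarrow> complex" where
  "digit_mask D y = (\<Sum>b\<in>D. cis (- (2 * pi * of_int b * y))) / of_nat (card D)"

lemma digit_mask_add_int: "digit_mask D (y + of_int k) = digit_mask D y"
proof -
  have "cis (- (2 * pi * of_int b * (y + of_int k))) = cis (- (2 * pi * of_int b * y))" for b
  proof -
    have "- (2 * pi * of_int b * (y + of_int k)) = - (2 * pi * of_int b * y) + 2 * pi * of_int (- b * k)"
      by (simp add: algebra_simps)
    also have "cis \<dots> = cis (- (2 * pi * of_int b * y)) * cis (2 * pi * of_int (- b * k))"
      by (simp only: cis_mult)
    also have "cis (2 * pi * of_int (- b * k)) = 1" by (rule cis_multiple_2pi) (rule Ints_of_int)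
    finally show ?thesis by simp
  qed
  then show ?thesis by (simp add: digit_mask_def)
qed

lemma norm_digit_mask_le_1: "norm (digit_mask D y) \<le> 1"
proof -
  have "norm (\<Sum>b\<in>D. cis (- (2 * pi * of_int b * y))) \<le> real (card D)"
    using norm_sum[of "\<lambda>b. cis (- (2 * pi * of_int b * y))" D] by simp
  then show ?thesis by (cases "card D = 0") (simp_all add: digit_mask_def norm_divide divide_le_eq_1)
qed

lemma norm_digit_mask_sq:
  "of_real ((norm (digit_mask D y))\<^sup>2) =
    (\<Sum>b\<in>D. \<Sum>b'\<in>D. cis (2 * pi * of_int (b' - b) * y)) / of_nat (card D) ^ 2"
proof -
  have "of_real ((norm (digit_mask D y))\<^sup>2) = digit_mask D y * cnj (digit_mask D y)"
    by (rule complex_norm_square)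
  also have "\<dots> = (\<Sum>b\<in>D. \<Sum>b'\<in>D. cis (- (2 * pi * of_int b * y)) * cis (2 * pi * of_int b' * y)) / of_nat (card D) ^ 2"
    by (simp add: digit_mask_def sum_product power2_eq_square cis_cnj)
  also have "\<dots> = (\<Sum>b\<in>D. \<Sum>b'\<in>D. cis (2 * pi * of_int (b' - b) * y)) / of_nat (card D) ^ 2"
    by (simp add: cis_mult algebra_simps)
  finally show ?thesis .
qed

text \<open>Expanding the squares leaves character sums over \<open>H\<close> at differences of
  digits, and only the diagonal survives. Both a Hadamard partner of \<open>B\<close> and a full set
  of residues will play the role of \<open>H\<close>.\<close>

lemma sum_norm_digit_mask_sq:
  assumes B: "finite B" and H: "finite H"
    and orth: "\<And>b b'. b \<in> B \<Longrightarrow> b' \<in> B \<Longrightarrow> b \<noteq> b' \<Longrightarrow> (\<Sum>h\<in>H. cis (2 * pi * of_int (b' - b) * a h)) = 0"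
  shows "(\<Sum>h\<in>H. (norm (digit_mask B (y + a h)))\<^sup>2) = card H / card B"
proof -
  have "of_real (\<Sum>h\<in>H. (norm (digit_mask B (y + a h)))\<^sup>2) =
      (\<Sum>h\<in>H. \<Sum>b\<in>B. \<Sum>b'\<in>B. cis (2 * pi * of_int (b' - b) * (y + a h))) / of_nat (card B) ^ 2"
    by (simp only: of_real_sum norm_digit_mask_sq sum_divide_distrib)
  also have "(\<Sum>h\<in>H. \<Sum>b\<in>B. \<Sum>b'\<in>B. cis (2 * pi * of_int (b' - b) * (y + a h))) =
      (\<Sum>b\<in>B. \<Sum>h\<in>H. \<Sum>b'\<in>B. cis (2 * pi * of_int (b' - b) * (y + a h)))"
    by (rule sum.swap)
  also have "\<dots> = (\<Sum>b\<in>B. \<Sum>b'\<in>B. \<Sum>h\<in>H. cis (2 * pi * of_int (b' - b) * (y + a h)))"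
    by (intro sum.cong refl sum.swap)
  also have "\<dots> = (\<Sum>b\<in>B. \<Sum>b'\<in>B. if b' = b then of_nat (card H) else 0)"
  proof (intro sum.cong refl)
    fix b b' assume b: "b \<in> B" "b' \<in> B"
    have "cis (2 * pi * of_int (b' - b) * (y + a h)) =
        cis (2 * pi * of_int (b' - b) * y) * cis (2 * pi * of_int (b' - b) * a h)" for h
      by (simp only: cis_mult distrib_left)
    then have "(\<Sum>h\<in>H. cis (2 * pi * of_int (b' - b) * (y + a h))) =
        cis (2 * pi * of_int (b' - b) * y) * (\<Sum>h\<in>H. cis (2 * pi * of_int (b' - b) * a h))"
      by (simp only: sum_distrib_left)
    then show "(\<Sum>h\<in>H. cis (2 * pi * of_int (b' - b) * (y + a h))) = (if b' = b then of_nat (card H) else 0)"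
      using orth[OF b] by (cases "b' = b") auto
  qed
  also have "\<dots> = of_nat (card B) * of_nat (card H)" using B by simp
  also have "\<dots> / of_nat (card B) ^ 2 = of_real (card H / card B)"
    by (cases "card B = 0") (simp_all add: power2_eq_square)
  finally show ?thesis by (simp only: of_real_eq_iff)
qed

text \<open>Unitarity without the normalisation, reduced to orthogonality of rows of a square
  matrix: a form that passes easily to powers of \<open>N\<close> and translates of
  \<open>L\<close>.\<close>

definition hadamard :: "nat \<Rightarrow> int set \<Rightarrow> int set \<Rightarrow> bool" where
  "hadamard N B L \<longleftrightarrow> 0 < N \<and> finite B \<and> finite L \<and> 0 < card B \<and> card L = card B \<and>
     (\<forall>b\<in>B. \<forall>b'\<in>B. b \<noteq> b' \<longrightarrow> (\<Sum>l\<in>L. cis (2 * pi * of_int ((b - b') * l) / N)) = 0)"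

text \<open>Replacing \<open>L\<close> by \<open>t * L\<close> applies
  \<open>\<zeta> \<mapsto> \<zeta> ^ t\<close> to vanishing sums of roots of unity, so one
  \<open>L\<close> serves all \<open>t\<close> coprime to \<open>N\<close>.\<close>

lemma hadamard_sum:
  assumes "hadamard N B L" "coprime t N" "0 < t"
  shows "(\<Sum>l\<in>L. (norm (digit_mask B (y - of_int (int t * l) / N)))\<^sup>2) = 1"
proof -
  have "(\<Sum>l\<in>L. (norm (digit_mask B (y + - (of_int (int t * l) / N))))\<^sup>2) = card L / card B"
  proof (rule sum_norm_digit_mask_sq)
    fix b b' assume b: "b \<in> B" "b' \<in> B" "b \<noteq> b'"
    then have "(\<Sum>l\<in>L. cis (2 * pi * of_nat t * of_int ((b - b') * l) / N)) = 0"
      using assms unfolding hadamard_def by (intro sum_roots_of_unity_galois) auto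
    then show "(\<Sum>l\<in>L. cis (2 * pi * of_int (b' - b) * - (of_int (int t * l) / N))) = 0"
      by (simp add: mult_ac left_diff_distrib right_diff_distrib diff_divide_distrib)
  qed (use assms in \<open>auto simp: hadamard_def\<close>)
  then show ?thesis using assms by (auto simp: hadamard_def)
qed

text \<open>Congruent digits would have equal rows, whose inner product is \<open>card L\<close>
  instead of 0.\<close>

lemma hadamard_digits_distinct:
  assumes "hadamard N B L" "b \<in> B" "b' \<in> B" "b \<noteq> b'"
  shows "\<not> int N dvd b - b'"
proof
  assume "int N dvd b - b'"
  then obtain k where k: "b - b' = int N * k" by (auto elim: dvdE)
  have N: "0 < N" using assms by (simp add: hadamard_def)
  have "cis (2 * pi * of_int ((b - b') * l) / N) = 1" for l
  proof -
    have "2 * pi * of_int ((b - b') * l) / N = 2 * pi * of_int (k * l)" using N by (simp add: k)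
    then show ?thesis by (metis cis_multiple_2pi Ints_of_int)
  qed
  then have "(\<Sum>l\<in>L. cis (2 * pi * of_int ((b - b') * l) / N)) = of_nat (card L)" by simp
  then show False using assms by (auto simp: hadamard_def)
qed

lemma card_digits_le:
  assumes "0 < N" "finite B"
    and "\<And>b b'. b \<in> B \<Longrightarrow> b' \<in> B \<Longrightarrow> b \<noteq> b' \<Longrightarrow> \<not> int N dvd b - b'"
  shows "card B \<le> N"
proof -
  have "inj_on (\<lambda>b. b mod int N) B"
    by (rule inj_onI) (use assms(3) mod_eq_dvd_iff in blast)
  moreover have "(\<lambda>b. b mod int N) ` B \<subseteq> {0..<int N}" using assms(1) by auto
  ultimately have "card B \<le> card {0..<int N}" by (intro card_inj_on_le) auto
  then show ?thesis by simp
qed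

lemma cis_eq_1_iff_dvd:
  assumes "0 < N"
  shows "cis (2 * pi * of_int a / of_nat N) = 1 \<longleftrightarrow> int N dvd a"
proof
  assume "cis (2 * pi * of_int a / of_nat N) = 1"
  then have "cos (2 * pi * of_int a / of_nat N) = 1" by (simp add: complex_eq_iff)
  then obtain k :: int where "2 * pi * of_int a / of_nat N = of_int k * (2 * pi)"
    by (auto simp: cos_one_2pi_int)
  then have "real_of_int a = of_int (k * int N)" using assms by (simp add: field_simps)
  then have "a = k * int N" by (simp only: of_int_eq_iff)
  then show "int N dvd a" by simp
next
  assume "int N dvd a"
  then obtain k where k: "a = int N * k" by (auto elim: dvdE)
  have "2 * pi * of_int a / of_nat N = 2 * pi * of_int k" using assms by (simp add: k)
  then show "cis (2 * pi * of_int a / of_nat N) = 1" by (metis cis_multiple_2pi Ints_of_int)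
qed

text \<open>Here all \<open>N\<close> frequencies are used instead of the \<open>card B\<close> many
  of a Hadamard partner. Incongruence of the digits makes the geometric sums vanish, and the total
  exceeds 1 as soon as \<open>card B < N\<close>.\<close>

lemma full_residue_sum:
  assumes "0 < N" "finite B" "coprime t N"
    and distinct: "\<And>b b'. b \<in> B \<Longrightarrow> b' \<in> B \<Longrightarrow> b \<noteq> b' \<Longrightarrow> \<not> int N dvd b - b'"
  shows "(\<Sum>h<N. (norm (digit_mask B (y + of_nat (t * h) / N)))\<^sup>2) = N / card B"
proof -
  have "(\<Sum>h<N. (norm (digit_mask B (y + of_nat (t * h) / N)))\<^sup>2) = card {..<N} / card B"
  proof (rule sum_norm_digit_mask_sq)
    fix b b' assume b: "b \<in> B" "b' \<in> B" "b \<noteq> b'"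
    define z where "z = cis (2 * pi * of_int ((b' - b) * int t) / N)"
    have "\<not> int N dvd (b' - b) * int t"
      using distinct[of b' b] b assms(3) by (metis coprime_commute coprime_dvd_mult_left_iff coprime_int_iff)
    then have z1: "z \<noteq> 1" using cis_eq_1_iff_dvd assms(1) unfolding z_def by blast
    have zN: "z ^ N = 1"
    proof -
      have "z ^ N = cis (2 * pi * of_int ((b' - b) * int t))"
        unfolding z_def using assms(1) by (subst Complex.DeMoivre) simp
      also have "\<dots> = 1" by (rule cis_multiple_2pi) (rule Ints_of_int)
      finally show ?thesis .
    qed
    have "cis (2 * pi * of_int (b' - b) * (of_nat (t * h) / N)) = z ^ h" for h
      unfolding z_def by (subst Complex.DeMoivre) (simp add: mult_ac)
    then have "(\<Sum>h<N. cis (2 * pi * of_int (b' - b) * (of_nat (t * h) / N))) = (\<Sum>h<N. z ^ h)"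
      by simp
    also have "\<dots> = (z ^ N - 1) / (z - 1)" using z1 by (rule geometric_sum)
    finally show "(\<Sum>h<N. cis (2 * pi * of_int (b' - b) * (of_nat (t * h) / N))) = 0" using zN by simp
  qed (use assms in auto)
  then show ?thesis by simp
qed

text \<open>The quotients \<open>l / N\<close> do not change when \<open>N\<close> and
  \<open>l\<close> are both multiplied by \<open>N ^ (n - 1)\<close>. This absorbs the exponents of
  the random convolution into the scales.\<close>

lemma hadamard_power:
  assumes "hadamard N B L" "0 < n"
  shows "hadamard (N ^ n) B ((\<lambda>l. int N ^ (n - 1) * l) ` L)"
proof -
  have N: "0 < N" using assms by (simp add: hadamard_def)
  have inj: "inj_on (\<lambda>l. int N ^ (n - 1) * l) L" using N by (auto intro: inj_onI)
  have "real N ^ n = real N ^ (n - 1) * real N" using assms(2) by (metis power_minus_mult)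
  then have *: "2 * pi * of_int ((b - b') * (int N ^ (n - 1) * l)) / real (N ^ n) =
      2 * pi * of_int ((b - b') * l) / N" for b b' l
    using N by simp
  have "(\<Sum>l\<in>(\<lambda>l. int N ^ (n - 1) * l) ` L. cis (2 * pi * of_int ((b - b') * l) / real (N ^ n))) =
      (\<Sum>l\<in>L. cis (2 * pi * of_int ((b - b') * l) / N))" for b b'
    unfolding sum.reindex[OF inj] o_def by (simp only: *)
  then show ?thesis using assms N inj unfolding hadamard_def by (simp add: card_image)
qed

text \<open>A translation multiplies each orthogonality sum by a unimodular number. It serves to
  bring 0 into \<open>L\<close>, which will make the finite spectra nested.\<close>

lemma hadamard_translate:
  assumes "hadamard N B L"
  shows "hadamard N B ((\<lambda>l. l - l0) ` L)"
proof -
  have inj: "inj_on (\<lambda>l. l - l0) L" by (auto intro: inj_onI)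
  have "(\<Sum>l\<in>(\<lambda>l. l - l0) ` L. cis (2 * pi * of_int ((b - b') * l) / N)) =
      (\<Sum>l\<in>L. cis (2 * pi * of_int ((b - b') * l) / N)) / cis (2 * pi * of_int ((b - b') * l0) / N)" for b b'
    unfolding sum.reindex[OF inj] o_def sum_divide_distrib cis_divide
    by (intro sum.cong refl arg_cong[of _ _ cis]) (simp add: right_diff_distrib diff_divide_distrib)
  then show ?thesis using assms inj unfolding hadamard_def by (simp add: card_image)
qed

lemma admissible_pair_hadamard:
  assumes "admissible_pair N B"
  obtains L where "hadamard N B L" "0 \<in> L"
proof -
  obtain L where N: "2 \<le> N" and B: "finite B" "2 \<le> card B" and
    U: "unitary_matrix_on B L (\<lambda>b l. 1 / sqrt (card B) * exp (- 2 * pi * \<i> * of_int b * of_int l / of_nat N))"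
    using assms by (auto simp: admissible_pair_def)
  have fin: "finite L" using U by (simp add: unitary_matrix_on_def)
  have e: "exp (- 2 * pi * \<i> * of_int b * of_int l / of_nat N) = cis (- (2 * pi * of_int b * of_int l / N))" for b l
    by (simp add: cis_conv_exp mult_ac)
  have sq: "complex_of_real (sqrt (card B)) * complex_of_real (sqrt (card B)) = of_nat (card B)"
    by (metis of_real_mult of_real_of_nat_eq real_sqrt_mult_self abs_of_nat)
  have rows: "(\<Sum>l\<in>L. cis (2 * pi * of_int ((b' - b) * l) / N)) = of_nat (card B) * of_bool (b = b')"
    if "b \<in> B" "b' \<in> B" for b b'
  proof -
    have "(\<Sum>l\<in>L. (1 / sqrt (card B) * cis (- (2 * pi * of_int b * of_int l / N))) *
        cnj (1 / sqrt (card B) * cis (- (2 * pi * of_int b' * of_int l / N)))) = of_bool (b = b')"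
      using U that unfolding unitary_matrix_on_def e by blast
    moreover have "(1 / sqrt (card B) * cis (- (2 * pi * of_int b * of_int l / N))) *
        cnj (1 / sqrt (card B) * cis (- (2 * pi * of_int b' * of_int l / N))) =
        cis (2 * pi * of_int ((b' - b) * l) / N) / of_nat (card B)" for l
      using sq by (simp add: cis_cnj cis_mult algebra_simps diff_divide_distrib)
    ultimately have "(\<Sum>l\<in>L. cis (2 * pi * of_int ((b' - b) * l) / N)) / of_nat (card B) = of_bool (b = b')"
      by (simp only: sum_divide_distrib)
    moreover have "(of_nat (card B) :: complex) \<noteq> 0" using B by auto
    ultimately show ?thesis by (metis nonzero_divide_eq_eq mult.commute)
  qed
  obtain b where "b \<in> B" using B by fastforce
  with rows[of b b] have "card L = card B" by simp
  then have h: "hadamard N B L" unfolding hadamard_def using rows N B fin by auto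
  then have "0 < card L" by (simp add: hadamard_def)
  then obtain l0 where "l0 \<in> L" by (auto simp: card_gt_0_iff)
  then show ?thesis using hadamard_translate[OF h, of l0] that by force
qed

section \<open>Infinite convolutions\<close>

lemma real_distribution_delta:
  assumes "finite A" "A \<noteq> {}"
  shows "real_distribution (delta A)"
proof -
  interpret prob_space "uniform_count_measure A" by (rule prob_space_uniform_count_measure[OF assms])
  show ?thesis unfolding delta_def
    by (rule real_distribution_distr) (simp add: uniform_count_measure_def point_measure_def)
qed

lemma char_delta:
  assumes "finite A" "A \<noteq> {}"
  shows "char (delta A) s = (\<Sum>a\<in>A. iexp (s * a)) / of_nat (card A)"
proof -
  have "char (delta A) s = (CLINT x|uniform_count_measure A. iexp (s * x))"
    unfolding char_def delta_def
    by (subst integral_distr) (auto simp: uniform_count_measure_def point_measure_def)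
  also have "\<dots> = (\<Sum>a\<in>A. (1 / card A) *\<^sub>R iexp (s * a))"
    unfolding uniform_count_measure_def using assms by (subst lebesgue_integral_point_measure_finite) auto
  also have "\<dots> = (\<Sum>a\<in>A. iexp (s * a)) / of_nat (card A)"
    by (simp add: scaleR_conv_of_real sum_divide_distrib)
  finally show ?thesis .
qed

lemma AE_delta:
  assumes "finite A" "A \<noteq> {}" "\<And>a. a \<in> A \<Longrightarrow> P a" "{x. P x} \<in> sets borel"
  shows "AE x in delta A. P x"
proof -
  have "(\<lambda>x. x) \<in> uniform_count_measure A \<rightarrow>\<^sub>M borel"
    by (simp add: uniform_count_measure_def point_measure_def)
  moreover have "AE x in uniform_count_measure A. P x"
    unfolding uniform_count_measure_def by (subst AE_point_measure) (use assms(3) in blast)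
  ultimately show ?thesis
    unfolding delta_def using assms(4) by (subst AE_distr_iff) auto
qed

lemma real_distribution_convolution:
  assumes "real_distribution M" "real_distribution N"
  shows "real_distribution (M \<star> N)"
proof -
  interpret M: real_distribution M by fact
  interpret N: real_distribution N by fact
  interpret pair_prob_space M N ..
  show ?thesis unfolding convolution_def by (rule real_distribution_distr) simp
qed

lemma char_convolution:
  assumes "real_distribution M" "real_distribution N"
  shows "char (M \<star> N) t = char M t * char N t"
proof -
  interpret M: real_distribution M by fact
  interpret N: real_distribution N by fact
  interpret pair_prob_space M N ..
  have int: "integrable (M \<Otimes>\<^sub>M N) (\<lambda>z. iexp (t * fst z) * iexp (t * snd z))"
    by (rule integrable_const_bound[of _ 1]) (auto simp: norm_mult)
  have "char (M \<star> N) t = (CLINT z|M \<Otimes>\<^sub>M N. iexp (t * (fst z + snd z)))"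
    unfolding char_def convolution_def by (subst integral_distr) (auto simp: split_beta')
  also have "\<dots> = (CLINT z|M \<Otimes>\<^sub>M N. iexp (t * fst z) * iexp (t * snd z))"
    by (simp add: distrib_left exp_add)
  also have "\<dots> = (CLINT x|M. CLINT y|N. iexp (t * x) * iexp (t * y))"
    using integral_fst'[OF int] by simp
  also have "\<dots> = char M t * char N t"
    unfolding char_def by simp
  finally show ?thesis .
qed

lemma AE_convolution:
  assumes "real_distribution M" "real_distribution N"
    and P: "AE x in M. P x" and Q: "AE x in N. Q x"
    and S: "\<And>x y. P x \<Longrightarrow> Q y \<Longrightarrow> S (x + y)" and [measurable]: "{x. S x} \<in> sets borel"
  shows "AE x in M \<star> N. S x"
proof -
  interpret M: real_distribution M by fact
  interpret N: real_distribution N by fact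
  interpret pair_prob_space M N ..
  have "AE z in M \<Otimes>\<^sub>M N. fst z + snd z \<in> {x. S x}"
  proof (rule AE_pair_measure)
    show "AE x in M. AE y in N. fst (x, y) + snd (x, y) \<in> {x. S x}"
      using P
    proof eventually_elim
      case (elim x)
      show ?case using Q by eventually_elim (use elim S in auto)
    qed
  qed measurable
  then show ?thesis unfolding convolution_def
    by (subst AE_distr_iff) (auto simp: split_beta')
qed

section \<open>Moran measures and their Fourier transforms\<close>

definition level :: "(nat \<Rightarrow> nat) \<Rightarrow> nat \<Rightarrow> nat" where
  "level Q k = (\<Prod>i<k. Q i)"

lemma level_0 [simp]: "level Q 0 = 1" and level_Suc [simp]: "level Q (Suc k) = level Q k * Q k"
  by (simp_all add: level_def)

lemma level_add: "level Q (k + j) = level Q k * level (\<lambda>i. Q (k + i)) j"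
  by (induction j) simp_all

definition moran_factor :: "(nat \<Rightarrow> nat) \<Rightarrow> (nat \<Rightarrow> int set) \<Rightarrow> nat \<Rightarrow> real measure" where
  "moran_factor Q D k = delta ((\<lambda>b. of_int b / real (level Q (Suc k))) ` D k)"

definition moran :: "(nat \<Rightarrow> nat) \<Rightarrow> (nat \<Rightarrow> int set) \<Rightarrow> real measure" where
  "moran Q D = infinite_convolution (moran_factor Q D)"

text \<open>Normalised to match \<open>expfun\<close>: the value at \<open>y\<close> is the integral
  of \<open>expfun y\<close>.\<close>

definition fourier :: "real measure \<Rightarrow> real \<Rightarrow> complex" where
  "fourier M y = char M (- (2 * pi * y))"

definition finite_mask :: "(nat \<Rightarrow> nat) \<Rightarrow> (nat \<Rightarrow> int set) \<Rightarrow> nat \<Rightarrow> real \<Rightarrow> complex" where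
  "finite_mask Q D k y = (\<Prod>i<k. digit_mask (D i) (y / real (level Q (Suc i))))"

lemma finite_mask_0 [simp]: "finite_mask Q D 0 y = 1"
  and finite_mask_Suc [simp]: "finite_mask Q D (Suc k) y =
    finite_mask Q D k y * digit_mask (D k) (y / real (level Q (Suc k)))"
  by (simp_all add: finite_mask_def)

declare level_Suc [simp del]

lemma finite_mask_add:
  "finite_mask Q D (k + j) y =
    finite_mask Q D k y * finite_mask (\<lambda>i. Q (k + i)) (\<lambda>i. D (k + i)) j (y / real (level Q k))"
proof (induction j)
  case (Suc j)
  have "real (level Q (Suc (k + j))) = real (level Q k) * real (level (\<lambda>i. Q (k + i)) (Suc j))"
    using level_add[of Q k "Suc j"] by simp
  then show ?case using Suc by simp
qed simp

lemma norm_cis_diff_le: "norm (cis a - cis b) \<le> \<bar>a - b\<bar>"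
proof -
  have "cis a - cis b = cis b * (cis (a - b) - 1)" by (simp add: algebra_simps cis_mult)
  then have "norm (cis a - cis b) = norm (iexp (a - b) - 1)" by (simp add: norm_mult cis_conv_exp)
  also have "\<dots> \<le> \<bar>a - b\<bar>" using iexp_approx1[of "a - b" 0] by simp
  finally show ?thesis .
qed

text \<open>One bound \<open>R\<close> for all digits is inherited by every tail and makes the
  Lipschitz and interpolation estimates uniform over tails.\<close>

locale digit_system =
  fixes Q :: "nat \<Rightarrow> nat" and D :: "nat \<Rightarrow> int set" and R :: real
  assumes Q_ge_2: "2 \<le> Q i" and finite_D: "finite (D i)" and D_ne: "D i \<noteq> {}"
    and D_bound: "b \<in> D i \<Longrightarrow> \<bar>of_int b\<bar> \<le> R"
begin

abbreviation partial_conv :: "nat \<Rightarrow> real measure" where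
  "partial_conv \<equiv> finite_convolution (moran_factor Q D)"

lemma R_nonneg: "0 \<le> R"
proof -
  obtain b where "b \<in> D 0" using D_ne by blast
  then show ?thesis using D_bound[of b 0] by linarith
qed

lemma shift: "digit_system (\<lambda>i. Q (k + i)) (\<lambda>i. D (k + i)) R"
  by unfold_locales (auto intro: Q_ge_2 finite_D D_ne D_bound simp: D_ne)

lemma level_ge: "2 ^ k \<le> level Q k"
  by (induction k) (use Q_ge_2 in \<open>auto simp: level_Suc mult.commute intro!: mult_mono\<close>)

lemma level_pos: "0 < level Q k"
  using level_ge[of k] by (meson less_le_trans zero_less_numeral zero_less_power)

lemma real_level_ge: "2 ^ k \<le> real (level Q k)"
  using level_ge[of k] by (metis of_nat_le_iff of_nat_numeral of_nat_power)

lemma finite_mask_at_0: "finite_mask Q D k 0 = 1"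
  using finite_D D_ne by (induction k) (auto simp: digit_mask_def)

lemma real_distribution_factor: "real_distribution (moran_factor Q D k)"
  unfolding moran_factor_def using finite_D D_ne by (intro real_distribution_delta) auto

lemma fourier_factor: "fourier (moran_factor Q D k) y = digit_mask (D k) (y / real (level Q (Suc k)))"
proof -
  let ?c = "real (level Q (Suc k))"
  have inj: "inj_on (\<lambda>b. of_int b / ?c) (D k)"
    using level_pos[of "Suc k"] by (auto intro!: inj_onI)
  have "fourier (moran_factor Q D k) y = (\<Sum>a\<in>(\<lambda>b. of_int b / ?c) ` D k. iexp (- (2 * pi * y) * a)) / of_nat (card (D k))"
    unfolding fourier_def moran_factor_def using finite_D D_ne
    by (subst char_delta) (auto simp: card_image[OF inj])
  also have "\<dots> = digit_mask (D k) (y / ?c)"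
    unfolding sum.reindex[OF inj] digit_mask_def o_def
    by (intro arg_cong2[of _ _ _ _ "(/)"] sum.cong refl) (simp add: cis_conv_exp mult_ac)
  finally show ?thesis .
qed

lemma real_distribution_finite: "real_distribution (partial_conv k)"
  by (induction k) (auto intro: real_distribution_factor real_distribution_convolution)

text \<open>The partial convolution of index \<open>k\<close> has \<open>k + 1\<close> factors,
  hence \<open>Suc k\<close>.\<close>

lemma fourier_finite: "fourier (partial_conv k) y = finite_mask Q D (Suc k) y"
proof (induction k)
  case 0 then show ?case using fourier_factor[of 0] by simp
next
  case (Suc k)
  have "fourier (partial_conv (Suc k)) y =
      fourier (partial_conv k) y * fourier (moran_factor Q D (Suc k)) y"
    by (simp add: fourier_def char_convolution real_distribution_finite real_distribution_factor)
  then show ?case using Suc fourier_factor[of "Suc k"] by simp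
qed

lemma AE_factor: "AE x in moran_factor Q D k. \<bar>x\<bar> \<le> R / 2 ^ Suc k"
  unfolding moran_factor_def
proof (rule AE_delta)
  fix a assume "a \<in> (\<lambda>b. of_int b / real (level Q (Suc k))) ` D k"
  then obtain b where b: "b \<in> D k" "a = of_int b / real (level Q (Suc k))" by auto
  have "\<bar>a\<bar> = \<bar>of_int b\<bar> / real (level Q (Suc k))" using b by simp
  also have "\<dots> \<le> R / 2 ^ Suc k"
    using D_bound[OF b(1)] real_level_ge[of "Suc k"] R_nonneg by (intro frac_le) auto
  finally show "\<bar>a\<bar> \<le> R / 2 ^ Suc k" .
qed (use finite_D D_ne in auto)

lemma AE_finite: "AE x in partial_conv k. \<bar>x\<bar> \<le> R"
proof -
  have "AE x in partial_conv k. \<bar>x\<bar> \<le> R * (1 - 1 / 2 ^ Suc k)"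
  proof (induction k)
    case 0
    have "R / 2 ^ Suc 0 = R * (1 - 1 / 2 ^ Suc 0)" by simp
    then show ?case using AE_factor[of 0] unfolding finite_convolution.simps by simp
  next
    case (Suc k)
    have "AE x in partial_conv (Suc k). \<bar>x\<bar> \<le> R * (1 - 1 / 2 ^ Suc k) + R / 2 ^ Suc (Suc k)"
      unfolding finite_convolution.simps
      by (rule AE_convolution[OF real_distribution_finite real_distribution_factor Suc AE_factor]) auto
    moreover have "R * (1 - 1 / 2 ^ Suc k) + R / 2 ^ Suc (Suc k) = R * (1 - 1 / 2 ^ Suc (Suc k))"
      by (simp add: field_simps)
    ultimately show ?case by simp
  qed
  moreover have "R * (1 - 1 / 2 ^ Suc k) \<le> R" using R_nonneg by (simp add: mult_left_le)
  ultimately show ?thesis by (auto elim!: eventually_mono)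
qed

text \<open>All quantitative information on the limit is obtained from this inequality, which passes to the limit.\<close>

lemma finite_mask_combination_bound:
  fixes c :: "'i \<Rightarrow> complex"
  assumes "finite I" and "\<And>x. \<bar>x\<bar> \<le> R \<Longrightarrow> norm (\<Sum>i\<in>I. c i * cis (- (2 * pi * y i) * x)) \<le> b"
  shows "norm (\<Sum>i\<in>I. c i * finite_mask Q D (Suc k) (y i)) \<le> b"
proof -
  let ?M = "partial_conv k"
  interpret real_distribution ?M by (rule real_distribution_finite)
  have int: "integrable ?M (\<lambda>x. cis (u * x))" for u
    by (rule integrable_const_bound[of _ 1]) (auto simp: cis_conv_exp)
  have int': "integrable ?M (\<lambda>x. cis (- (2 * pi * u * x)))" for u
    using int[of "- (2 * pi * u)"] by simp
  have "finite_mask Q D (Suc k) u = (CLINT x|?M. cis (- (2 * pi * u) * x))" for u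
    unfolding fourier_finite[symmetric] fourier_def char_def by (simp add: cis_conv_exp)
  then have "(\<Sum>i\<in>I. c i * finite_mask Q D (Suc k) (y i)) =
      (CLINT x|?M. \<Sum>i\<in>I. c i * cis (- (2 * pi * y i) * x))"
    by (simp only:) (subst Bochner_Integration.integral_sum, auto intro!: integrable_mult_right int')
  also have "norm \<dots> \<le> (\<integral>x. norm (\<Sum>i\<in>I. c i * cis (- (2 * pi * y i) * x)) \<partial>?M)"
    by (rule integral_norm_bound)
  also have "\<dots> \<le> (\<integral>x. b \<partial>?M)"
  proof (rule integral_mono_AE)
    show "integrable ?M (\<lambda>x. norm (\<Sum>i\<in>I. c i * cis (- (2 * pi * y i) * x)))"
      using int by (intro integrable_norm Bochner_Integration.integrable_sum integrable_mult_right)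
    show "AE x in ?M. norm (\<Sum>i\<in>I. c i * cis (- (2 * pi * y i) * x)) \<le> b"
      using AE_finite by eventually_elim (rule assms(2))
  qed simp
  also have "\<dots> = b" using prob_space by simp
  finally show ?thesis .
qed

lemma finite_mask_lipschitz:
  "norm (finite_mask Q D (Suc k) y - finite_mask Q D (Suc k) y') \<le> 2 * pi * R * \<bar>y - y'\<bar>"
proof -
  let ?c = "\<lambda>i. if i then 1 else -1 :: complex" and ?y = "\<lambda>i. if i then y else y'"
  have "norm (\<Sum>i\<in>{True, False}. ?c i * finite_mask Q D (Suc k) (?y i)) \<le> 2 * pi * R * \<bar>y - y'\<bar>"
  proof (rule finite_mask_combination_bound)
    fix x :: real assume x: "\<bar>x\<bar> \<le> R"
    have "norm (cis (- (2 * pi * y) * x) - cis (- (2 * pi * y') * x)) \<le> \<bar>(- (2 * pi * y) * x) - (- (2 * pi * y') * x)\<bar>"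
      by (rule norm_cis_diff_le)
    also have "\<dots> = \<bar>2 * pi * (y' - y)\<bar> * \<bar>x\<bar>" unfolding abs_mult[symmetric] by (simp add: algebra_simps)
    also have "\<dots> \<le> \<bar>2 * pi * (y' - y)\<bar> * R" using x by (rule mult_left_mono) simp
    also have "\<dots> = 2 * pi * R * \<bar>y - y'\<bar>" by (simp add: abs_mult abs_minus_commute)
    finally show "norm (\<Sum>i\<in>{True, False}. ?c i * cis (- (2 * pi * ?y i) * x)) \<le> 2 * pi * R * \<bar>y - y'\<bar>"
      by simp
  qed simp
  then show ?thesis by simp
qed

text \<open>For fixed \<open>y\<close> the factor at scale \<open>level Q (Suc k)\<close> differs
  from 1 by at most a constant times \<open>(1 / 2) ^ Suc k\<close>, and all partial products have
  norm at most 1, so the increments are summable.\<close>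

lemma convergent_finite_mask: "convergent (\<lambda>k. finite_mask Q D (Suc k) y)"
proof -
  have mask_diff: "norm (digit_mask (D k) u - 1) \<le> 2 * pi * R * \<bar>u\<bar>" for k u
  proof -
    have "digit_mask (D k) u - 1 = (\<Sum>b\<in>D k. cis (- (2 * pi * of_int b * u)) - cis 0) / of_nat (card (D k))"
      using finite_D D_ne by (simp add: digit_mask_def sum_subtractf diff_divide_distrib)
    also have "norm \<dots> \<le> (\<Sum>b\<in>D k. 2 * pi * R * \<bar>u\<bar>) / card (D k)"
      unfolding norm_divide norm_of_nat
    proof (intro divide_right_mono order_trans[OF norm_sum] sum_mono)
      fix b assume b: "b \<in> D k"
      have "norm (cis (- (2 * pi * of_int b * u)) - cis 0) \<le> 2 * pi * \<bar>of_int b\<bar> * \<bar>u\<bar>"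
        using norm_cis_diff_le[of "- (2 * pi * of_int b * u)" 0] by (simp add: abs_mult)
      also have "\<dots> \<le> 2 * pi * R * \<bar>u\<bar>" using D_bound[OF b] by (intro mult_mono) (auto simp: R_nonneg)
      finally show "norm (cis (- (2 * pi * of_int b * u)) - cis 0) \<le> 2 * pi * R * \<bar>u\<bar>" .
    qed simp
    also have "\<dots> = 2 * pi * R * \<bar>u\<bar>" using finite_D D_ne by simp
    finally show ?thesis .
  qed
  have norm1: "norm (finite_mask Q D k y) \<le> 1" for k
    by (induction k) (auto simp: norm_mult intro!: mult_le_one norm_digit_mask_le_1)
  have "summable (\<lambda>k. finite_mask Q D (Suc k) y - finite_mask Q D k y)"
  proof (rule summable_comparison_test')
    show "summable (\<lambda>k. 2 * pi * R * \<bar>y\<bar> * (1 / 2) ^ Suc k)"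
      by (intro summable_mult summable_Suc_iff[THEN iffD2] summable_geometric) simp
    fix k
    have "norm (finite_mask Q D (Suc k) y - finite_mask Q D k y) =
        norm (finite_mask Q D k y) * norm (digit_mask (D k) (y / real (level Q (Suc k))) - 1)"
      by (simp add: algebra_simps flip: norm_mult)
    also have "\<dots> \<le> 1 * (2 * pi * R * \<bar>y / real (level Q (Suc k))\<bar>)"
      by (rule mult_mono[OF norm1 mask_diff]) simp_all
    also have "\<dots> = 2 * pi * R * (\<bar>y\<bar> / real (level Q (Suc k)))" by simp
    also have "\<dots> \<le> 2 * pi * R * (\<bar>y\<bar> / 2 ^ Suc k)"
      by (rule mult_left_mono[OF frac_le[OF _ order_refl _ real_level_ge]]) (simp_all add: R_nonneg)
    finally show "norm (finite_mask Q D (Suc k) y - finite_mask Q D k y) \<le> 2 * pi * R * \<bar>y\<bar> * (1 / 2) ^ Suc k"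
      by (simp add: power_divide)
  qed
  then have "convergent (\<lambda>n. \<Sum>k<n. finite_mask Q D (Suc k) y - finite_mask Q D k y)"
    by (simp only: summable_iff_convergent)
  then have "convergent (\<lambda>n. finite_mask Q D n y - 1)"
    unfolding sum_lessThan_telescope[of "\<lambda>n. finite_mask Q D n y"] by simp
  then have "convergent (\<lambda>n. finite_mask Q D n y - 1 + 1)" by (intro convergent_add convergent_const)
  then show ?thesis by (simp add: convergent_Suc_iff[of "\<lambda>n. finite_mask Q D n y"] del: finite_mask_Suc)
qed

text \<open>Tightness gives a weak limit along a subsequence only. As the characteristic functions
  converge along the whole sequence, Levy's continuity theorem upgrades this to the whole
  sequence.\<close>

lemma moran_exists:
  "\<exists>M. real_distribution M \<and> weak_conv_m (partial_conv) M"
proof -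
  let ?F = partial_conv
  have "tight ?F"
    unfolding tight_def
  proof (intro conjI allI impI)
    fix \<epsilon> :: real assume \<epsilon>: "0 < \<epsilon>"
    \<comment> \<open>The left end \<open>- R - 1\<close> keeps a possible atom at
      \<open>- R\<close> inside the half-open interval.\<close>
    have "measure (?F k) {- R - 1<..R} = 1" for k
    proof -
      interpret real_distribution "?F k" by (rule real_distribution_finite)
      have "AE x in ?F k. x \<in> {- R - 1<..R}"
        using AE_finite by eventually_elim auto
      then show ?thesis by (subst prob_eq_1) auto
    qed
    then show "\<exists>a b. a < b \<and> (\<forall>k. 1 - \<epsilon> < measure (?F k) {a<..b})"
      using \<epsilon> R_nonneg by (intro exI[of _ "- R - 1"] exI[of _ R]) auto
  qed (rule real_distribution_finite)
  from tight_imp_convergent_subsubsequence[OF this strict_mono_id]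
  obtain r M where r: "strict_mono r" and M: "real_distribution M" and wc: "weak_conv_m (?F \<circ> r) M"
    by auto
  have "(\<lambda>k. char (?F k) t) \<longlonglongrightarrow> char M t" for t
  proof -
    have eq: "char (?F k) t = finite_mask Q D (Suc k) (- t / (2 * pi))" for k
      using fourier_finite[of k "- t / (2 * pi)"] by (simp add: fourier_def)
    then obtain l where l: "(\<lambda>k. char (?F k) t) \<longlonglongrightarrow> l"
      using convergent_finite_mask[of "- t / (2 * pi)"] by (auto simp: convergent_def)
    have "(\<lambda>k. char ((?F \<circ> r) k) t) \<longlonglongrightarrow> char M t"
      by (rule levy_continuity1[OF _ M wc]) (simp add: real_distribution_finite)
    moreover have "(\<lambda>k. char ((?F \<circ> r) k) t) \<longlonglongrightarrow> l"
      using LIMSEQ_subseq_LIMSEQ[OF l r] by (simp add: o_def)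
    ultimately show ?thesis using l LIMSEQ_unique by blast
  qed
  then have "weak_conv_m ?F M" using M real_distribution_finite by (intro levy_continuity) auto
  then show ?thesis using M by blast
qed

lemma real_distribution_moran: "real_distribution (moran Q D)"
  and weak_conv_moran: "weak_conv_m (partial_conv) (moran Q D)"
proof -
  let ?F = partial_conv
  have "\<exists>!M. real_distribution M \<and> weak_conv_m ?F M"
  proof (rule ex_ex1I[OF moran_exists])
    fix M M' assume *: "real_distribution M \<and> weak_conv_m ?F M" "real_distribution M' \<and> weak_conv_m ?F M'"
    have "char M = char M'"
    proof
      fix t
      have "(\<lambda>k. char (?F k) t) \<longlonglongrightarrow> char M t" "(\<lambda>k. char (?F k) t) \<longlonglongrightarrow> char M' t"
        using * real_distribution_finite by (auto intro: levy_continuity1)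
      then show "char M t = char M' t" by (rule LIMSEQ_unique)
    qed
    then show "M = M'" using * Levy_uniqueness by blast
  qed
  from theI'[OF this] show "real_distribution (moran Q D)" "weak_conv_m ?F (moran Q D)"
    by (auto simp: moran_def infinite_convolution_def)
qed

lemma finite_mask_tendsto: "(\<lambda>k. finite_mask Q D k y) \<longlonglongrightarrow> fourier (moran Q D) y"
proof -
  have "(\<lambda>k. char (partial_conv k) (- (2 * pi * y))) \<longlonglongrightarrow> char (moran Q D) (- (2 * pi * y))"
    by (intro levy_continuity1 real_distribution_finite real_distribution_moran weak_conv_moran)
  then have "(\<lambda>k. finite_mask Q D (Suc k) y) \<longlonglongrightarrow> fourier (moran Q D) y"
    using fourier_finite by (simp add: fourier_def)
  then show ?thesis by (rule LIMSEQ_imp_Suc)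
qed

lemma fourier_0: "fourier (moran Q D) 0 = 1"
  using real_distribution.char_zero[OF real_distribution_moran] by (simp add: fourier_def)

lemma norm_fourier_le_1: "norm (fourier (moran Q D) y) \<le> 1"
  using real_distribution.cmod_char_le_1[OF real_distribution_moran] by (simp add: fourier_def)

lemma fourier_moran_split:
  "fourier (moran Q D) y =
    finite_mask Q D k y * fourier (moran (\<lambda>i. Q (k + i)) (\<lambda>i. D (k + i))) (y / real (level Q k))"
proof -
  interpret S: digit_system "\<lambda>i. Q (k + i)" "\<lambda>i. D (k + i)" R by (rule shift)
  have "(\<lambda>j. finite_mask Q D (j + k) y) \<longlonglongrightarrow> fourier (moran Q D) y"
    by (rule LIMSEQ_ignore_initial_segment[OF finite_mask_tendsto])
  moreover have "(\<lambda>j. finite_mask Q D (j + k) y) \<longlonglongrightarrow>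
      finite_mask Q D k y * fourier (moran (\<lambda>i. Q (k + i)) (\<lambda>i. D (k + i))) (y / real (level Q k))"
    by (simp only: add.commute[of _ k] finite_mask_add) (intro tendsto_mult tendsto_const S.finite_mask_tendsto)
  ultimately show ?thesis by (rule LIMSEQ_unique)
qed

lemma fourier_lipschitz:
  "norm (fourier (moran Q D) y - fourier (moran Q D) y') \<le> 2 * pi * R * \<bar>y - y'\<bar>"
proof (rule LIMSEQ_le_const2)
  show "(\<lambda>k. norm (finite_mask Q D (Suc k) y - finite_mask Q D (Suc k) y')) \<longlonglongrightarrow>
      norm (fourier (moran Q D) y - fourier (moran Q D) y')"
    by (intro tendsto_norm tendsto_diff LIMSEQ_Suc finite_mask_tendsto)
  show "\<exists>N. \<forall>n\<ge>N. norm (finite_mask Q D (Suc n) y - finite_mask Q D (Suc n) y') \<le> 2 * pi * R * \<bar>y - y'\<bar>"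
    using finite_mask_lipschitz by blast
qed

lemma fourier_lagrange:
  fixes z :: "nat \<Rightarrow> real"
  assumes I: "finite I" "card I = n" and inj: "inj_on z I" and z01: "\<And>i. i \<in> I \<Longrightarrow> \<bar>z i\<bar> \<le> 1"
  shows "norm (1 - (\<Sum>i\<in>I. fourier (moran Q D) (s * z i) * of_real (lagrange_weight I z i)))
    \<le> 2 * (2 * pi * \<bar>s\<bar> * R) ^ n / fact n" (is "_ \<le> ?b")
proof (rule LIMSEQ_le_const2)
  let ?w = "\<lambda>i. complex_of_real (lagrange_weight I z i)"
  show "(\<lambda>k. norm (1 - (\<Sum>i\<in>I. finite_mask Q D (Suc k) (s * z i) * ?w i))) \<longlonglongrightarrow>
      norm (1 - (\<Sum>i\<in>I. fourier (moran Q D) (s * z i) * ?w i))"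
    by (intro tendsto_norm tendsto_diff tendsto_sum tendsto_mult tendsto_const LIMSEQ_Suc finite_mask_tendsto)
  have "norm (1 - (\<Sum>i\<in>I. finite_mask Q D (Suc k) (s * z i) * ?w i)) \<le> ?b" for k
  proof -
    \<comment> \<open>\<open>None\<close> stands for the point 0 with coefficient 1, where every
      mask equals 1; so the interpolation error is a single linear combination of masks.\<close>
    let ?J = "insert None (Some ` I)"
    let ?c = "case_option 1 (\<lambda>i. - ?w i)" and ?y = "case_option 0 (\<lambda>i. s * z i)"
    have sumJ: "(\<Sum>j\<in>?J. f j) = f None + (\<Sum>i\<in>I. f (Some i))" for f :: "nat option \<Rightarrow> complex"
      using I by (subst sum.insert) (auto simp: sum.reindex)
    have "norm (\<Sum>j\<in>?J. ?c j * finite_mask Q D (Suc k) (?y j)) \<le> ?b"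
    proof (rule finite_mask_combination_bound)
      fix x :: real assume x: "\<bar>x\<bar> \<le> R"
      have "norm (1 - (\<Sum>i\<in>I. cis (- (2 * pi * s * x) * z i) * ?w i)) \<le> ?b"
      proof (rule lagrange_error_cis[OF I inj z01])
        show "\<bar>- (2 * pi * s * x)\<bar> \<le> 2 * pi * \<bar>s\<bar> * R"
          using x by (auto simp: abs_mult intro!: mult_left_mono)
      qed
      then show "norm (\<Sum>j\<in>?J. ?c j * cis (- (2 * pi * ?y j) * x)) \<le> ?b"
        unfolding sumJ by (simp add: sum_negf mult_ac)
    qed (use I in simp)
    then show ?thesis unfolding sumJ by (simp add: sum_negf finite_mask_at_0 mult.commute del: finite_mask_Suc)
  qed
  then show "\<exists>N. \<forall>k\<ge>N. norm (1 - (\<Sum>i\<in>I. finite_mask Q D (Suc k) (s * z i) * ?w i)) \<le> ?b"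
    by blast
qed

end

section \<open>Lower bounds for the Fourier transform\<close>

lemma level_dvd: "i \<le> k \<Longrightarrow> level Q i dvd level Q k"
  by (induction k) (auto simp: level_Suc le_Suc_eq)

lemma digit_mask_cong_int: "x - y = of_int j \<Longrightarrow> digit_mask D x = digit_mask D y"
  using digit_mask_add_int[of D y j] by (metis add.commute diff_add_cancel)

lemma (in digit_system) finite_mask_periodic:
  "finite_mask Q D k (y + real (level Q k) * of_int j) = finite_mask Q D k y"
  unfolding finite_mask_def
proof (intro prod.cong refl)
  fix i assume "i \<in> {..<k}"
  then obtain c where c: "level Q k = level Q (Suc i) * c" using level_dvd[of "Suc i" k Q] by (auto elim: dvdE)
  show "digit_mask (D i) ((y + real (level Q k) * of_int j) / real (level Q (Suc i))) =
      digit_mask (D i) (y / real (level Q (Suc i)))"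
    using level_pos[of "Suc i"]
    by (intro digit_mask_cong_int[of _ _ "int c * j"]) (simp add: c add_divide_distrib)
qed

lemma sum_lessThan_mult:
  fixes f :: "nat \<Rightarrow> 'a::comm_monoid_add"
  shows "(\<Sum>h<M * n. f h) = (\<Sum>h1<M. \<Sum>h2<n. f (h1 + M * h2))"
proof -
  have "(\<Sum>h<M * n. f h) = (\<Sum>h2<n. sum f {h2 * M..<h2 * M + M})"
    by (simp add: sum.nat_group mult.commute)
  also have "\<dots> = (\<Sum>h2<n. \<Sum>h1<M. f (h1 + M * h2))"
  proof (rule sum.cong[OF refl])
    fix h2 assume "h2 \<in> {..<n}"
    show "sum f {h2 * M..<h2 * M + M} = (\<Sum>h1<M. f (h1 + M * h2))"
      by (rule sum.reindex_bij_witness[of _ "\<lambda>h. h + M * h2" "\<lambda>h. h - M * h2"])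
        (auto simp: mult.commute)
  qed
  also have "\<dots> = (\<Sum>h1<M. \<Sum>h2<n. f (h1 + M * h2))" by (rule sum.swap)
  finally show ?thesis .
qed

text \<open>Write \<open>h = h1 + level Q k * h2\<close>. The first \<open>k\<close> factors depend
  only on \<open>h1\<close>, while \<open>t * h2\<close> runs through all residues modulo
  \<open>Q k\<close>, so the new factor multiplies the sum by \<open>Q k / card B\<close>.\<close>

lemma (in digit_system) sum_norm_finite_mask_sq:
  assumes block: "\<And>i. i < J \<Longrightarrow> \<exists>e>0. Q i = N ^ e \<and> D i = B"
    and N: "0 < N" and cop: "coprime t N"
    and distinct: "\<And>b b'. b \<in> B \<Longrightarrow> b' \<in> B \<Longrightarrow> b \<noteq> b' \<Longrightarrow> \<not> int N dvd b - b'"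
    and k: "k \<le> J"
  shows "(\<Sum>h<level Q k. (norm (finite_mask Q D k (s + of_nat (t * h))))\<^sup>2) = real (level Q k) / real (card B) ^ k"
  using k
proof (induction k)
  case (Suc k)
  let ?M = "level Q k"
  obtain e where e: "0 < e" "Q k = N ^ e" and B: "D k = B"
    using block[of k] Suc.prems Suc_le_lessD by blast
  have distinct': "\<not> int (N ^ e) dvd b - b'" if "b \<in> B" "b' \<in> B" "b \<noteq> b'" for b b'
    using distinct[OF that] e(1) by (metis dvd_power dvd_trans of_nat_power)
  have M0: "real ?M \<noteq> 0" and Q0: "real (Q k) \<noteq> 0" using level_pos[of k] Q_ge_2[of k] by auto
  have "(\<Sum>h<level Q (Suc k). (norm (finite_mask Q D (Suc k) (s + of_nat (t * h))))\<^sup>2) =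
      (\<Sum>h1<?M. \<Sum>h2<Q k. (norm (finite_mask Q D (Suc k) (s + of_nat (t * (h1 + ?M * h2)))))\<^sup>2)"
    unfolding level_Suc by (rule sum_lessThan_mult)
  also have "\<dots> = (\<Sum>h1<?M. (norm (finite_mask Q D k (s + of_nat (t * h1))))\<^sup>2 *
      (\<Sum>h2<Q k. (norm (digit_mask B ((s + of_nat (t * h1)) / real (level Q (Suc k)) + of_nat (t * h2) / Q k)))\<^sup>2))"
    unfolding sum_distrib_left
  proof (intro sum.cong refl)
    fix h1 h2
    have "finite_mask Q D k (s + of_nat (t * (h1 + ?M * h2))) = finite_mask Q D k (s + of_nat (t * h1))"
      using finite_mask_periodic[of k "s + of_nat (t * h1)" "int (t * h2)"] by (simp add: algebra_simps)
    moreover have "(s + of_nat (t * (h1 + ?M * h2))) / real (level Q (Suc k)) =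
        (s + of_nat (t * h1)) / real (level Q (Suc k)) + of_nat (t * h2) / Q k"
      using M0 Q0 by (simp add: level_Suc field_simps)
    ultimately show "(norm (finite_mask Q D (Suc k) (s + of_nat (t * (h1 + ?M * h2)))))\<^sup>2 =
        (norm (finite_mask Q D k (s + of_nat (t * h1))))\<^sup>2 *
        (norm (digit_mask B ((s + of_nat (t * h1)) / real (level Q (Suc k)) + of_nat (t * h2) / Q k)))\<^sup>2"
      by (simp add: B norm_mult power_mult_distrib)
  qed
  also have "\<dots> = (\<Sum>h1<?M. (norm (finite_mask Q D k (s + of_nat (t * h1))))\<^sup>2 * (real (Q k) / card B))"
    using finite_D[of k] B N cop e distinct'
    by (intro sum.cong refl arg_cong2[of _ _ _ _ "(*)"])
      (unfold e(2), intro full_residue_sum, auto)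
  also have "\<dots> = (real ?M / real (card B) ^ k) * (real (Q k) / card B)"
    using Suc by (simp only: flip: sum_distrib_right)
  also have "\<dots> = real (level Q (Suc k)) / real (card B) ^ Suc k" by (simp add: level_Suc)
  finally show ?case .
qed simp

lemma abs_lagrange_weight_le:
  assumes I: "finite I" "card I = n" "i \<in> I" and r: "0 < r" "r \<le> 1"
    and z01: "\<And>j. j \<in> I \<Longrightarrow> \<bar>z j\<bar> \<le> 1"
    and sep: "\<And>j. j \<in> I \<Longrightarrow> j \<noteq> i \<Longrightarrow> r \<le> \<bar>z j - z i\<bar>"
  shows "\<bar>lagrange_weight I z i\<bar> \<le> (1 / r) ^ n"
proof -
  have "\<bar>lagrange_weight I z i\<bar> = (\<Prod>j\<in>I - {i}. \<bar>z j\<bar> / \<bar>z j - z i\<bar>)"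
    by (simp add: lagrange_weight_def abs_prod)
  also have "\<dots> \<le> (\<Prod>j\<in>I - {i}. 1 / r)"
    using z01 sep r by (intro prod_mono conjI frac_le) auto
  also have "\<dots> = (1 / r) ^ (n - 1)" using I by simp
  also have "\<dots> \<le> (1 / r) ^ n" using r by (intro power_increasing) auto
  finally show ?thesis .
qed

text \<open>Pigeonhole. Members of one class modulo \<open>w\<close> are at least \<open>w\<close>
  apart, so a large set of bad points contains \<open>n\<close> well separated ones.\<close>

lemma ex_residue_class:
  fixes H :: "nat set"
  assumes "finite H" "n * w \<le> card H" "0 < w" "0 < n"
  obtains c where "n \<le> card {h \<in> H. h mod w = c}"
proof (rule ccontr)
  assume "\<not> thesis"
  then have small: "card {h \<in> H. h mod w = c} < n" for c using that by (meson not_le)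
  have "H = (\<Union>c<w. {h \<in> H. h mod w = c})" using assms(3) by auto
  then have "card H \<le> (\<Sum>c<w. card {h \<in> H. h mod w = c})"
    using card_UN_le[of "{..<w}" "\<lambda>c. {h \<in> H. h mod w = c}"] by auto
  also have "\<dots> < (\<Sum>c<w. n)" using small assms(3) by (intro sum_strict_mono) auto
  finally show False using assms(2) by (simp add: mult.commute)
qed

text \<open>The integer is added before the multiplication by \<open>t\<close>: it will be realised
  by moving an element of the spectrum, which is multiplied by \<open>t\<close> only
  afterwards.\<close>

abbreviation equi_positive :: "real measure \<Rightarrow> nat \<Rightarrow> real \<Rightarrow> bool" where
  "equi_positive M t \<epsilon> \<equiv> \<forall>x. \<exists>h::int. \<epsilon> \<le> norm (fourier M (real t * (x + of_int h)))"

text \<open>A function of exponential type that is 1 at the origin is small only near few points of the unit interval,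
  by Lagrange interpolation. As the squares of the values of the mask polynomial of a long block sum up to more
  than the number of these points, some translate avoids them.\<close>

lemma block_lower_bound:
  fixes N t :: nat and B :: "int set" and R :: real
  assumes N: "2 \<le> N" and B: "finite B" "B \<noteq> {}" "card B < N" and t: "0 < t" "coprime t N" and R: "0 \<le> R"
    and distinct: "\<And>b b'. b \<in> B \<Longrightarrow> b' \<in> B \<Longrightarrow> b \<noteq> b' \<Longrightarrow> \<not> int N dvd b - b'"
  shows "\<exists>J \<epsilon>. 0 < \<epsilon> \<and> (\<forall>Q D. digit_system Q D R \<longrightarrow> (\<forall>i<J. \<exists>e>0. Q i = N ^ e \<and> D i = B) \<longrightarrow>
    (equi_positive (moran Q D) t \<epsilon>))"
proof -
  let ?A = "2 * pi * \<bar>real t\<bar> * R"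
  \<comment> \<open>The number \<open>n\<close> of nodes is chosen so that the interpolation error
    is at most 1/2.\<close>
  have "(\<lambda>n. inverse (fact n) * ?A ^ n) \<longlonglongrightarrow> 0"
    using summable_exp[of ?A] by (rule summable_LIMSEQ_zero)
  then have "eventually (\<lambda>n. inverse (fact n) * ?A ^ n < 1 / 4) sequentially"
    by (rule order_tendstoD) simp
  moreover have "eventually (\<lambda>n::nat. 0 < n) sequentially" by (rule eventually_gt_at_top)
  ultimately have "eventually (\<lambda>n. inverse (fact n) * ?A ^ n < 1 / 4 \<and> 0 < n) sequentially"
    by (rule eventually_conj)
  then obtain n where n: "inverse (fact n) * ?A ^ n < 1 / 4" "0 < n"
    using eventually_happens'[OF sequentially_bot] by blast
  have fact_bound: "2 * ?A ^ n / fact n \<le> 1 / 2" using n(1) by (simp add: field_simps)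
  have cB: "0 < card B" using B by (simp add: card_gt_0_iff)
  \<comment> \<open>Here \<open>card B < N\<close> enters: a long block has a sum of squares
    \<open>M / c\<close> of at least \<open>4 * n\<close>.\<close>
  have "1 < real N / card B" using B(3) cB by simp
  then obtain J where J: "4 * real n \<le> (real N / card B) ^ J"
    using real_arch_pow[of "real N / card B" "4 * real n"] by (auto intro: less_imp_le)
  define c where "c = real (card B) ^ J"
  have c1: "1 \<le> c" unfolding c_def using cB by (intro one_le_power) simp
  \<comment> \<open>Chosen so that \<open>n * (r * M + 1) \<le> M / (2 * c)\<close>: the bad points
    then account for less than half of the sum of squares.\<close>
  define r where "r = 1 / (4 * n * c)"
  have r: "0 < r" "r \<le> 1"
  proof -
    have "1 * 1 \<le> (4 * real n) * c" using n(2) c1 by (intro mult_mono) auto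
    then show "0 < r" "r \<le> 1" using n(2) c1 by (auto simp: r_def divide_le_eq_1)
  qed
  \<comment> \<open>Nodes at mutual distance \<open>r\<close> have weights of at most
    \<open>(1 / r) ^ n\<close>, so \<open>n\<close> values below \<open>\<eta>\<close> contribute at
    most 1/4 to the interpolation sum.\<close>
  define \<eta> where "\<eta> = r ^ n / (4 * n)"
  have \<eta>: "0 < \<eta>" using r n by (simp add: \<eta>_def)
  \<comment> \<open>If the product is below \<open>\<epsilon>\<close> while the tail is at least
    \<open>\<eta>\<close>, the mask is below \<open>1 / (2 * c)\<close>.\<close>
  define \<epsilon> where "\<epsilon> = \<eta> / (2 * c)"
  have \<epsilon>: "0 < \<epsilon>" using \<eta> c1 by (simp add: \<epsilon>_def)
  have main: "\<exists>h::int. \<epsilon> \<le> norm (fourier (moran Q D) (real t * (x + of_int h)))"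
    if ds: "digit_system Q D R" and block: "\<forall>i<J. \<exists>e>0. Q i = N ^ e \<and> D i = B"
      and x: "0 \<le> x" "x < 1" for Q D x
  proof (rule ccontr)
    interpret digit_system Q D R by fact
    interpret S: digit_system "\<lambda>i. Q (J + i)" "\<lambda>i. D (J + i)" R by (rule shift)
    assume neg: "\<not> ?thesis"
    define M where "M = level Q J"
    define \<phi> where "\<phi> = fourier (moran (\<lambda>i. Q (J + i)) (\<lambda>i. D (J + i)))"
    define G where "G h = norm (finite_mask Q D J (t * x + of_nat (t * h)))" for h
    define z where "z h = (x + real h) / M" for h
    define H where "H = {h \<in> {..<M}. norm (\<phi> (t * z h)) < \<eta>}"
    have M0: "0 < real M" using level_pos by (simp add: M_def)
    have G1: "G h \<le> 1" for h
      unfolding G_def finite_mask_def prod_norm[symmetric]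
      by (intro prod_le_1 conjI norm_ge_zero norm_digit_mask_le_1)
    have prod: "norm (fourier (moran Q D) (t * (x + of_int (int h)))) = G h * norm (\<phi> (t * z h))" for h
      unfolding G_def \<phi>_def z_def M_def
      by (subst fourier_moran_split[of _ J]) (simp add: norm_mult distrib_left)
    have sumG: "(\<Sum>h<M. (G h)\<^sup>2) = M / c"
      unfolding G_def M_def c_def
      by (rule sum_norm_finite_mask_sq[of J N B]) (use block N t distinct in auto)
    have MN: "4 * real n \<le> M / c"
    proof -
      have "N ^ J \<le> M"
      proof -
        have "(\<Prod>i<J. N) \<le> M" unfolding M_def level_def
        proof (rule prod_mono)
          fix i assume "i \<in> {..<J}"
          then obtain e where "0 < e" "Q i = N ^ e" using block by auto
          then show "0 \<le> N \<and> N \<le> Q i" using N by (simp add: self_le_power)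
        qed
        then show ?thesis by simp
      qed
      then have "real N ^ J \<le> M" by (metis of_nat_le_iff of_nat_power)
      then have "(real N / card B) ^ J \<le> M / c"
        using c1 by (simp add: power_divide c_def divide_right_mono)
      then show ?thesis using J by linarith
    qed
    define w where "w = nat \<lceil>r * M\<rceil>"
    have w: "0 < w" "r * M \<le> w" "w \<le> r * M + 1"
    proof -
      have "0 < r * M" using r M0 by simp
      then show "0 < w" "r * M \<le> w" "w \<le> r * M + 1" by (auto simp: w_def)
    qed
    \<comment> \<open>Otherwise some class modulo \<open>w\<close> contains \<open>n\<close> bad
      points at mutual distance \<open>r\<close>. Interpolating the value 1 at the origin from them
      would give \<open>1 \<le> 1/2 + 1/4\<close>.\<close>
    have cardH: "card H < n * w"
    proof (rule ccontr)
      assume "\<not> ?thesis"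
      then have "n * w \<le> card H" by simp
      moreover have "finite H" by (simp add: H_def)
      ultimately obtain a where "n \<le> card {h \<in> H. h mod w = a}"
        using ex_residue_class[of H n w, OF _ _ w(1) n(2)] by blast
      then obtain I where I: "I \<subseteq> {h \<in> H. h mod w = a}" "card I = n" "finite I"
        by (meson obtain_subset_with_card_n)
      have sep: "r \<le> \<bar>z j - z i\<bar>" if "i \<in> I" "j \<in> I" "j \<noteq> i" for i j
      proof -
        have "i mod w = j mod w" using that I(1) by auto
        then have "int j mod int w = int i mod int w" by (simp flip: zmod_int)
        then have "int w dvd int j - int i" by (simp only: mod_eq_dvd_iff)
        then have "int w \<le> \<bar>int j - int i\<bar>" using that(3) by (intro zdvd_imp_le) auto
        then have "real w \<le> \<bar>real j - real i\<bar>" by linarith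
        then have "r * M \<le> \<bar>real j - real i\<bar>" using w by linarith
        then have "r \<le> \<bar>real j - real i\<bar> / M" using M0 by (simp add: field_simps)
        also have "\<bar>real j - real i\<bar> / M = \<bar>z j - z i\<bar>"
          using M0 by (simp add: z_def diff_divide_distrib[symmetric])
        finally show ?thesis .
      qed
      have inj: "inj_on z I"
      proof (rule inj_onI, rule ccontr)
        fix i j assume "i \<in> I" "j \<in> I" "z i = z j" "i \<noteq> j"
        then show False using sep[of i j] r by simp
      qed
      have z01: "\<bar>z i\<bar> \<le> 1" if "i \<in> I" for i
      proof -
        have "i < M" using that I(1) by (auto simp: H_def)
        then have "real i + 1 \<le> M" by linarith
        then show ?thesis using x M0 by (simp add: z_def divide_le_eq_1)
      qed
      let ?s = "\<Sum>i\<in>I. \<phi> (t * z i) * of_real (lagrange_weight I z i)"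
      have "norm (1 - ?s) \<le> 1 / 2"
        using S.fourier_lagrange[OF I(3,2) inj z01, of "real t"] fact_bound unfolding \<phi>_def by linarith
      moreover have "norm ?s \<le> (\<Sum>i\<in>I. \<eta> * (1 / r) ^ n)"
      proof (rule order_trans[OF norm_sum], rule sum_mono)
        fix i assume i: "i \<in> I"
        have "norm (\<phi> (t * z i)) \<le> \<eta>" using i I(1) by (auto simp: H_def)
        moreover have "\<bar>lagrange_weight I z i\<bar> \<le> (1 / r) ^ n"
          using i sep by (intro abs_lagrange_weight_le[OF I(3,2)] r z01) auto
        ultimately show "norm (\<phi> (t * z i) * of_real (lagrange_weight I z i)) \<le> \<eta> * (1 / r) ^ n"
          using \<eta> by (auto simp: norm_mult intro!: mult_mono)
      qed
      moreover have "(\<Sum>i\<in>I. \<eta> * (1 / r) ^ n) = 1 / 4"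
        using I(2) r n by (simp add: \<eta>_def power_one_over)
      moreover have "(1::real) \<le> norm (1 - ?s) + norm ?s"
        using norm_triangle_ineq[of "1 - ?s" ?s] by simp
      ultimately show False by linarith
    qed
    have "real (card H) < n * (r * M + 1)"
    proof -
      have "real (card H) < real n * real w" using cardH by (metis of_nat_less_iff of_nat_mult)
      also have "\<dots> \<le> n * (r * M + 1)" using w by (intro mult_left_mono) auto
      finally show ?thesis .
    qed
    also have "n * (r * M + 1) = M / (4 * c) + n" using n c1 by (simp add: r_def field_simps)
    also have "\<dots> \<le> M / (2 * c)" using MN by (simp add: field_simps)
    finally have cH: "real (card H) < M / (2 * c)" .
    \<comment> \<open>Bad points contribute at most 1 each, all others at most
      \<open>1 / (2 * c)\<close>; the total stays below the required \<open>M / c\<close>.\<close>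
    have "(\<Sum>h<M. (G h)\<^sup>2) \<le> (\<Sum>h<M. (if h \<in> H then 1 else 0) + 1 / (2 * c))"
    proof (rule sum_mono)
      fix h assume h: "h \<in> {..<M}"
      have G2: "(G h)\<^sup>2 \<le> G h" using G1[of h] by (simp add: power2_eq_square G_def mult_left_le)
      show "(G h)\<^sup>2 \<le> (if h \<in> H then 1 else 0) + 1 / (2 * c)"
      proof (cases "h \<in> H")
        case True
        then show ?thesis using G2 G1[of h] c1 by (simp add: add_increasing2)
      next
        case False
        then have "\<eta> \<le> norm (\<phi> (t * z h))" using h by (auto simp: H_def)
        then have "G h * \<eta> \<le> G h * norm (\<phi> (t * z h))" by (intro mult_left_mono) (auto simp: G_def)
        also have "\<dots> < \<epsilon>" using neg prod[of h] by (metis not_le)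
        finally have "G h < 1 / (2 * c)" using \<eta> c1 by (simp add: \<epsilon>_def field_simps)
        then show ?thesis using False G2 by simp
      qed
    qed
    also have "\<dots> = card H + M / (2 * c)"
    proof -
      have "(\<Sum>h<M. if h \<in> H then 1 else 0 :: real) = card H"
        by (subst sum.If_cases) (auto simp: H_def intro!: arg_cong[of _ _ card])
      then show ?thesis by (simp add: sum.distrib)
    qed
    finally show False using cH sumG c1 by (simp add: field_simps)
  qed
  show ?thesis
  proof (intro exI[of _ J] exI[of _ \<epsilon>] conjI \<epsilon> allI impI)
    fix Q D x assume ds: "digit_system Q D R" and block: "\<forall>i<J. \<exists>e>0. Q i = N ^ e \<and> D i = B"
    obtain h :: int where h: "\<epsilon> \<le> norm (fourier (moran Q D) (real t * (frac x + of_int h)))"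
      using main[OF ds block, of "frac x"] frac_ge_0 frac_lt_1 by blast
    have "frac x + of_int h = x + of_int (h - \<lfloor>x\<rfloor>)" by (simp add: frac_def)
    then show "\<exists>h::int. \<epsilon> \<le> norm (fourier (moran Q D) (real t * (x + of_int h)))" using h by metis
  qed
qed

section \<open>Construction of spectra\<close>

text \<open>By Bessel's inequality the sums never exceed 1, so the lower bounds amount to Parseval's
  identity for every exponential.\<close>

abbreviation (in digit_system) parseval_set :: "nat \<Rightarrow> int set \<Rightarrow> bool" where
  "parseval_set t \<Lambda> \<equiv>
    (\<forall>v\<in>\<Lambda>. \<forall>v'\<in>\<Lambda>. v \<noteq> v' \<longrightarrow> fourier (moran Q D) (of_int (int t * (v - v'))) = 0) \<and>
    (\<forall>\<xi>. \<forall>\<eta>>0. \<exists>F. finite F \<and> F \<subseteq> \<Lambda> \<and>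
      1 - \<eta> < (\<Sum>v\<in>F. (norm (fourier (moran Q D) (\<xi> - of_int (int t * v))))\<^sup>2))"

locale spectral_digit_system = digit_system Q D R for Q D R +
  fixes L :: "nat \<Rightarrow> int set" and T :: "nat set"
  assumes hadamard: "hadamard (Q i) (D i) (L i)" and zero_L: "0 \<in> L i"
    and T_pos: "t \<in> T \<Longrightarrow> 0 < t" and T_coprime: "t \<in> T \<Longrightarrow> coprime t (Q i)" and T_ne: "T \<noteq> {}"
begin

abbreviation tail :: "nat \<Rightarrow> real measure" where
  "tail k \<equiv> moran (\<lambda>i. Q (k + i)) (\<lambda>i. D (k + i))"

text \<open>Required for all \<open>\<xi>\<close>, the identity says that
  \<open>t * \<Lambda>\<close> is a spectrum of the convolution of the first \<open>k\<close>
  factors. All of \<open>T\<close> is kept in the definition because one \<open>\<Lambda>\<close>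
  must serve every \<open>t\<close>.\<close>

definition finite_spectrum :: "nat \<Rightarrow> int set \<Rightarrow> bool" where
  "finite_spectrum k \<Lambda> \<longleftrightarrow> finite \<Lambda> \<and>
    (\<forall>t\<in>T. \<forall>\<xi>. (\<Sum>v\<in>\<Lambda>. (norm (finite_mask Q D k (\<xi> - of_int (int t * v))))\<^sup>2) = 1)"

lemma finite_spectrum_0: "finite_spectrum 0 {0}"
  by (simp add: finite_spectrum_def)

text \<open>At \<open>\<xi> = t * v\<close> the term of \<open>v\<close> is already 1, which leaves
  0 for the others.\<close>

lemma finite_spectrum_orth:
  assumes P: "finite_spectrum k \<Lambda>" and "t \<in> T" "v \<in> \<Lambda>" "v' \<in> \<Lambda>" "v \<noteq> v'"
  shows "finite_mask Q D k (of_int (int t * (v - v'))) = 0"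
proof -
  let ?f = "\<lambda>v'. (norm (finite_mask Q D k (of_int (int t * v) - of_int (int t * v'))))\<^sup>2"
  have fin: "finite \<Lambda>" using P by (simp add: finite_spectrum_def)
  have "(\<Sum>v'\<in>\<Lambda>. ?f v') = 1" using P assms(2) by (simp add: finite_spectrum_def)
  moreover have "(\<Sum>v'\<in>\<Lambda>. ?f v') = ?f v + (\<Sum>v'\<in>\<Lambda> - {v}. ?f v')"
    by (rule sum.remove[OF fin assms(3)])
  moreover have "?f v = 1" by (simp add: finite_mask_at_0)
  ultimately have "(\<Sum>v'\<in>\<Lambda> - {v}. ?f v') = 0" by linarith
  then have "?f v' = 0" using assms fin by (subst (asm) sum_nonneg_eq_0_iff) auto
  then show ?thesis by (simp add: right_diff_distrib)
qed

lemma finite_spectrum_incongruent: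
  assumes P: "finite_spectrum k \<Lambda>" and "v \<in> \<Lambda>" "v' \<in> \<Lambda>" "int (level Q k) dvd v - v'"
  shows "v = v'"
proof (rule ccontr)
  assume "v \<noteq> v'"
  obtain t where t: "t \<in> T" using T_ne by blast
  obtain c where "v - v' = int (level Q k) * c" using assms(4) by (auto elim: dvdE)
  then have *: "of_int (int t * (v - v')) = 0 + real (level Q k) * of_int (int t * c)" by simp
  have "finite_mask Q D k (of_int (int t * (v - v'))) = 1"
    unfolding * finite_mask_periodic by (rule finite_mask_at_0)
  then show False using finite_spectrum_orth[OF P t assms(2,3) \<open>v \<noteq> v'\<close>] by simp
qed

text \<open>Adjoin \<open>level Q k * L k\<close>. By periodicity the first \<open>k\<close> factors
  see only \<open>v\<close>, so the sum over \<open>l\<close> is that of the new factor alone, which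
  is 1. As \<open>0 \<in> L k\<close>, the old elements stay.\<close>

lemma finite_spectrum_Suc:
  assumes P: "finite_spectrum k \<Lambda>"
  shows "\<exists>\<Lambda>'. \<Lambda> \<subseteq> \<Lambda>' \<and> finite_spectrum (Suc k) \<Lambda>'"
proof -
  let ?M = "level Q k"
  define \<Lambda>' where "\<Lambda>' = (\<lambda>(v, l). v + int ?M * l) ` (\<Lambda> \<times> L k)"
  have fin: "finite \<Lambda>" "finite (L k)" using P hadamard[of k] by (auto simp: finite_spectrum_def hadamard_def)
  have M0: "0 < ?M" and Q0: "0 < Q k" using level_pos Q_ge_2[of k] by auto
  have inj: "inj_on (\<lambda>(v, l). v + int ?M * l) (\<Lambda> \<times> L k)"
  proof (rule inj_onI, clarify)
    fix v l v' l' assume *: "v \<in> \<Lambda>" "v' \<in> \<Lambda>" "v + int ?M * l = v' + int ?M * l'"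
    then have "v - v' = int ?M * (l' - l)" by (simp add: algebra_simps)
    then have "v = v'" using finite_spectrum_incongruent[OF P *(1,2)] by simp
    then show "v = v' \<and> l = l'" using * M0 by simp
  qed
  have "(\<Sum>v\<in>\<Lambda>'. (norm (finite_mask Q D (Suc k) (\<xi> - of_int (int t * v))))\<^sup>2) = 1" if t: "t \<in> T" for t \<xi>
  proof -
    let ?x = "\<lambda>v. \<xi> - of_int (int t * v)"
    have "(\<Sum>v\<in>\<Lambda>'. (norm (finite_mask Q D (Suc k) (?x v)))\<^sup>2) =
        (\<Sum>v\<in>\<Lambda>. \<Sum>l\<in>L k. (norm (finite_mask Q D (Suc k) (?x (v + int ?M * l))))\<^sup>2)"
      unfolding \<Lambda>'_def sum.reindex[OF inj] by (simp add: sum.cartesian_product split_beta')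
    also have "\<dots> = (\<Sum>v\<in>\<Lambda>. (norm (finite_mask Q D k (?x v)))\<^sup>2 *
        (\<Sum>l\<in>L k. (norm (digit_mask (D k) (?x v / real (level Q (Suc k)) - of_int (int t * l) / Q k)))\<^sup>2))"
      unfolding sum_distrib_left
    proof (intro sum.cong refl)
      fix v l
      have "?x (v + int ?M * l) = ?x v + real ?M * of_int (- (int t * l))"
        by (simp add: algebra_simps)
      then have "finite_mask Q D k (?x (v + int ?M * l)) = finite_mask Q D k (?x v)"
        using finite_mask_periodic by metis
      moreover have "?x (v + int ?M * l) / real (level Q (Suc k)) =
          ?x v / real (level Q (Suc k)) - of_int (int t * l) / Q k"
        using M0 Q0 by (simp add: level_Suc field_simps)
      ultimately show "(norm (finite_mask Q D (Suc k) (?x (v + int ?M * l))))\<^sup>2 =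
          (norm (finite_mask Q D k (?x v)))\<^sup>2 *
          (norm (digit_mask (D k) (?x v / real (level Q (Suc k)) - of_int (int t * l) / Q k)))\<^sup>2"
        by (simp only: finite_mask_Suc norm_mult power_mult_distrib)
    qed
    also have "\<dots> = 1"
      using P t hadamard_sum[OF hadamard T_coprime[OF t] T_pos[OF t]]
      by (simp only: finite_spectrum_def mult_1_right)
    finally show ?thesis .
  qed
  then have "finite_spectrum (Suc k) \<Lambda>'" using fin by (simp add: finite_spectrum_def \<Lambda>'_def)
  moreover have "\<Lambda> \<subseteq> \<Lambda>'" using zero_L[of k] by (force simp: \<Lambda>'_def)
  ultimately show ?thesis by blast
qed

lemma finite_spectrum_extend:
  assumes "finite_spectrum k \<Lambda>" "k \<le> k'"
  shows "\<exists>\<Lambda>'. \<Lambda> \<subseteq> \<Lambda>' \<and> finite_spectrum k' \<Lambda>'"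
  using assms(2)
proof (induction k' rule: dec_induct)
  case base then show ?case using assms(1) by blast
next
  case (step n) then show ?case using finite_spectrum_Suc by (meson order_trans)
qed

text \<open>Periodicity of the mask leaves each element free to move by multiples of
  \<open>level Q k\<close>; \<open>finite_spectrum_stage\<close> spends this freedom.\<close>

lemma finite_spectrum_shift:
  assumes P: "finite_spectrum k \<Lambda>"
  shows "finite_spectrum k ((\<lambda>v. v - int (level Q k) * h v) ` \<Lambda>)"
proof -
  have inj: "inj_on (\<lambda>v. v - int (level Q k) * h v) \<Lambda>"
  proof (rule inj_onI)
    fix v v' assume *: "v \<in> \<Lambda>" "v' \<in> \<Lambda>" "v - int (level Q k) * h v = v' - int (level Q k) * h v'"
    then have "v - v' = int (level Q k) * (h v - h v')" by (simp add: algebra_simps)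
    then show "v = v'" using finite_spectrum_incongruent[OF P *(1,2)] by simp
  qed
  have "finite_mask Q D k (\<xi> - of_int (int t * (v - int (level Q k) * h v))) =
      finite_mask Q D k (\<xi> - of_int (int t * v))" for t v \<xi>
    using finite_mask_periodic[of k "\<xi> - of_int (int t * v)" "int t * h v"] by (simp add: algebra_simps)
  then show ?thesis using P unfolding finite_spectrum_def sum.reindex[OF inj] o_def by simp
qed

text \<open>The old elements must not move, as the spectra have to be nested. At a deep level their
  quotients by the scale are so small that the transform of the tail is still at least 1/2 there,
  whence \<open>\<epsilon> \<le> 1 / 2\<close>. Only new elements are moved.\<close>

lemma finite_spectrum_stage:
  assumes P: "finite_spectrum k \<Lambda>" and t: "t \<in> T" and \<epsilon>: "\<epsilon> \<le> 1 / 2"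
    and equi: "\<And>K. \<exists>k\<ge>K. equi_positive (tail k) t \<epsilon>"
  shows "\<exists>k'>k. \<exists>\<Lambda>'. \<Lambda> \<subseteq> \<Lambda>' \<and> finite_spectrum k' \<Lambda>' \<and>
    (\<forall>v\<in>\<Lambda>'. \<epsilon> \<le> norm (fourier (tail k') (- (of_int (int t * v) / real (level Q k')))))"
proof -
  have fin: "finite \<Lambda>" using P by (simp add: finite_spectrum_def)
  define C where "C = (\<Sum>v\<in>\<Lambda>. \<bar>real_of_int (int t * v)\<bar>)"
  have C: "\<bar>real_of_int (int t * v)\<bar> \<le> C" if "v \<in> \<Lambda>" for v
    unfolding C_def by (rule member_le_sum[OF that]) (use fin in auto)
  \<comment> \<open>From this level on, the Lipschitz bound keeps the tail within 1/2 of its value 1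
    at the origin, for all old elements at once.\<close>
  obtain K where K: "2 * (2 * pi * R * C) < 2 ^ K" using real_arch_pow[of 2] by auto
  obtain k' where k': "k' \<ge> max K (Suc k)"
    and h: "equi_positive (tail k') t \<epsilon>" using equi by blast
  then have "k \<le> k'" "k < k'" by auto
  define M where "M = real (level Q k')"
  have M0: "0 < M" using level_pos by (simp add: M_def)
  have "(2::real) ^ K \<le> 2 ^ k'" using k' by (intro power_increasing) auto
  also have "\<dots> \<le> M" unfolding M_def by (rule real_level_ge)
  finally have MC: "2 * pi * R * C / M \<le> 1 / 2" using K M0 by (simp add: field_simps)
  obtain \<Lambda>1 where \<Lambda>1: "\<Lambda> \<subseteq> \<Lambda>1" "finite_spectrum k' \<Lambda>1"
    using finite_spectrum_extend[OF P \<open>k \<le> k'\<close>] by blast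
  \<comment> \<open>For a new element the lower bound is taken at \<open>x = - v / M\<close>; the
    integer translate \<open>h v\<close> then amounts to moving \<open>v\<close> by
    \<open>level Q k' * h v\<close>.\<close>
  define h where "h v = (if v \<in> \<Lambda> then 0 else
    SOME h::int. \<epsilon> \<le> norm (fourier (tail k') (real t * (- (of_int v / M) + of_int h))))" for v
  let ?\<Lambda>' = "(\<lambda>v. v - int (level Q k') * h v) ` \<Lambda>1"
  interpret S: digit_system "\<lambda>i. Q (k' + i)" "\<lambda>i. D (k' + i)" R by (rule shift)
  have "\<epsilon> \<le> norm (fourier (tail k') (- (of_int (int t * (v - int (level Q k') * h v)) / M)))"
    if "v \<in> \<Lambda>1" for v
  proof (cases "v \<in> \<Lambda>")
    case True
    then have h0: "h v = 0" by (simp add: h_def)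
    let ?y = "- (of_int (int t * v) / M)"
    have "norm (fourier (tail k') 0 - fourier (tail k') ?y) \<le> 2 * pi * R * \<bar>0 - ?y\<bar>"
      by (rule S.fourier_lipschitz)
    also have "\<dots> = 2 * pi * R * (\<bar>of_int (int t * v)\<bar> / M)" using M0 by simp
    also have "\<dots> \<le> 2 * pi * R * (C / M)"
      using C[OF True] M0 R_nonneg by (intro mult_left_mono divide_right_mono) auto
    also have "\<dots> \<le> 1 / 2" using MC by simp
    finally have "norm (1 - fourier (tail k') ?y) \<le> 1 / 2" by (simp add: S.fourier_0)
    then have "1 / 2 \<le> norm (fourier (tail k') ?y)"
      using norm_triangle_ineq2[of 1 "1 - fourier (tail k') ?y"] by simp
    then show ?thesis using \<epsilon> h0 by simp
  next
    case False
    have "\<epsilon> \<le> norm (fourier (tail k') (real t * (- (of_int v / M) + of_int (h v))))"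
      using someI_ex[OF h[rule_format, of "- (of_int v / M)"]] False by (simp add: h_def)
    moreover have "real t * (- (of_int v / M) + of_int (h v)) =
        - (of_int (int t * (v - int (level Q k') * h v)) / M)"
      using M0 by (simp add: M_def[symmetric] field_simps)
    ultimately show ?thesis by simp
  qed
  then have "\<forall>v\<in>?\<Lambda>'. \<epsilon> \<le> norm (fourier (tail k') (- (of_int (int t * v) / real (level Q k'))))"
    by (auto simp: M_def)
  moreover have "\<Lambda> \<subseteq> ?\<Lambda>'"
  proof
    fix v assume "v \<in> \<Lambda>"
    then show "v \<in> ?\<Lambda>'" using \<Lambda>1(1) by (intro image_eqI[of _ _ v]) (auto simp: h_def)
  qed
  ultimately show ?thesis using \<open>k < k'\<close> finite_spectrum_shift[OF \<Lambda>1(2)] by blast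
qed

lemma norm_fourier_le_finite_mask: "norm (fourier (moran Q D) y) \<le> norm (finite_mask Q D k y)"
proof -
  interpret S: digit_system "\<lambda>i. Q (k + i)" "\<lambda>i. D (k + i)" R by (rule shift)
  show ?thesis
    unfolding fourier_moran_split[of y k] norm_mult by (intro mult_left_le S.norm_fourier_le_1) simp
qed

text \<open>The multipliers \<open>t\<close> are treated one at a time: each of them is responsible for the choice of the
  representatives at infinitely many stages, which suffices because the finite-level identity holds
  for all of them at every stage.\<close>

lemma ex_spectrum:
  assumes equi: "\<And>t. t \<in> T \<Longrightarrow> \<exists>\<epsilon>>0. \<forall>K. \<exists>k\<ge>K. equi_positive (tail k) t \<epsilon>"
  shows "\<exists>\<Lambda>. \<forall>t\<in>T. parseval_set t \<Lambda>"
proof -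
  define E where "E t e \<longleftrightarrow> (\<forall>K. \<exists>k\<ge>K. equi_positive (tail k) t e)"
    for t e
  have E_mono: "E t e'" if "E t e" "e' \<le> e" for t e e'
    using that unfolding E_def by (meson order_trans)
  have "\<exists>e. 0 < e \<and> e \<le> 1 / 2 \<and> E t e" if t: "t \<in> T" for t
  proof -
    obtain e where "0 < e" "E t e" using equi[OF t] by (auto simp: E_def)
    then show ?thesis using E_mono[of t e "min e (1 / 2)"] by (intro exI[of _ "min e (1 / 2)"]) auto
  qed
  then have "\<forall>t\<in>T. \<exists>e. 0 < e \<and> e \<le> 1 / 2 \<and> E t e" by blast
  then obtain \<epsilon> where \<epsilon>E: "\<forall>t\<in>T. 0 < \<epsilon> t \<and> \<epsilon> t \<le> 1 / 2 \<and> E t (\<epsilon> t)" using bchoice by metis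
  have \<epsilon>: "0 < \<epsilon> t" "\<epsilon> t \<le> 1 / 2" if "t \<in> T" for t using \<epsilon>E that by auto
  have \<epsilon>equi: "\<exists>k\<ge>K. equi_positive (tail k) t (\<epsilon> t)"
    if "t \<in> T" for t K using \<epsilon>E that unfolding E_def by blast
  \<comment> \<open>Each element of the countable set \<open>T\<close> is listed infinitely often,
    as the first component of \<open>prod_decode n\<close> takes each value for arbitrarily large
    \<open>n\<close>.\<close>
  define \<tau> where "\<tau> n = from_nat_into T (fst (prod_decode n))" for n
  have \<tau>T: "\<tau> n \<in> T" for n using T_ne by (simp add: \<tau>_def from_nat_into)
  have \<tau>inf: "\<exists>n\<ge>K. \<tau> n = t" if t: "t \<in> T" for t K
  proof -
    obtain i where i: "from_nat_into T i = t" using from_nat_into_surj[OF _ t] by auto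
    have "K \<le> prod_encode (i, K)" by (rule le_prod_encode_2)
    then show ?thesis using i by (intro exI[of _ "prod_encode (i, K)"]) (simp add: \<tau>_def)
  qed
  define step where "step n x y \<longleftrightarrow> fst x < fst y \<and> snd x \<subseteq> snd y \<and>
    (\<forall>v\<in>snd y. \<epsilon> (\<tau> n) \<le> norm (fourier (tail (fst y)) (- (of_int (int (\<tau> n) * v) / real (level Q (fst y))))))"
    for n :: nat and x y :: "nat \<times> int set"
  have "\<exists>f. \<forall>n. finite_spectrum (fst (f n)) (snd (f n)) \<and> step n (f n) (f (Suc n))"
  proof (rule dependent_nat_choice)
    show "\<exists>x. finite_spectrum (fst x) (snd x)" using finite_spectrum_0 by (metis fst_conv snd_conv)
  next
    fix x n assume "finite_spectrum (fst x) (snd x)"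
    from finite_spectrum_stage[OF this \<tau>T \<epsilon>(2)[OF \<tau>T] \<epsilon>equi[OF \<tau>T]]
    obtain k' \<Lambda>' where "fst x < k'" "snd x \<subseteq> \<Lambda>'" "finite_spectrum k' \<Lambda>'"
      "\<forall>v\<in>\<Lambda>'. \<epsilon> (\<tau> n) \<le> norm (fourier (tail k') (- (of_int (int (\<tau> n) * v) / real (level Q k'))))" by blast
    then show "\<exists>y. finite_spectrum (fst y) (snd y) \<and> step n x y"
      by (intro exI[of _ "(k', \<Lambda>')"]) (simp add: step_def)
  qed
  then obtain f where f: "\<And>n. finite_spectrum (fst (f n)) (snd (f n))" "\<And>n. step n (f n) (f (Suc n))" by blast
  define k where "k n = fst (f n)" for n
  define \<Lambda> where "\<Lambda> n = snd (f n)" for n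
  have spec: "finite_spectrum (k n) (\<Lambda> n)" for n using f(1) by (simp add: k_def \<Lambda>_def)
  have fin: "finite (\<Lambda> n)" for n using spec by (simp add: finite_spectrum_def)
  have "strict_mono k" unfolding strict_mono_Suc_iff using f(2) by (simp add: step_def k_def)
  have \<Lambda>mono: "\<Lambda> i \<subseteq> \<Lambda> j" if "i \<le> j" for i j
    by (rule lift_Suc_mono_le[OF _ that]) (use f(2) in \<open>simp add: step_def \<Lambda>_def\<close>)
  have lower: "\<epsilon> (\<tau> n) \<le> norm (fourier (tail (k (Suc n))) (- (of_int (int (\<tau> n) * v) / real (level Q (k (Suc n))))))"
    if "v \<in> \<Lambda> (Suc n)" for n v
    using f(2)[of n] that by (simp add: step_def k_def \<Lambda>_def)
  let ?\<mu> = "fourier (moran Q D)"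
  show ?thesis
  proof (rule exI[of _ "\<Union>n. \<Lambda> n"], intro ballI conjI allI impI)
    fix t v v' assume t: "t \<in> T" and "v \<in> (\<Union>n. \<Lambda> n)" "v' \<in> (\<Union>n. \<Lambda> n)" and ne: "v \<noteq> v'"
    then obtain i j where "v \<in> \<Lambda> i" "v' \<in> \<Lambda> j" by blast
    then have "v \<in> \<Lambda> (max i j)" "v' \<in> \<Lambda> (max i j)" using \<Lambda>mono[of i "max i j"] \<Lambda>mono[of j "max i j"] by auto
    then have "finite_mask Q D (k (max i j)) (of_int (int t * (v - v'))) = 0"
      using finite_spectrum_orth[OF spec t] ne by blast
    then show "?\<mu> (of_int (int t * (v - v'))) = 0"
      using norm_fourier_le_finite_mask[of "of_int (int t * (v - v'))" "k (max i j)"] by simp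
  next
    fix t and \<xi> \<eta> :: real assume t: "t \<in> T" and \<eta>: "0 < \<eta>"
    let ?x = "\<lambda>v. \<xi> - of_int (int t * v)"
    let ?m = "\<lambda>n v. (norm (finite_mask Q D (k n) (?x v)))\<^sup>2"
    have m1: "(\<Sum>v\<in>\<Lambda> n. ?m n v) = 1" for n using spec t by (simp add: finite_spectrum_def)
    define a where "a n = (\<Sum>v\<in>\<Lambda> n. (norm (?\<mu> (?x v)))\<^sup>2)" for n
    define e where "e = \<epsilon> t"
    have e: "0 < e" using \<epsilon>(1)[OF t] by (simp add: e_def)
    \<comment> \<open>The loss will be \<open>\<eta>'\<close> on the fixed part and
      \<open>(4 / e\<^sup>2) * \<eta>'\<close> on the added part; the factor 2 makes the total
      strictly smaller than \<open>\<eta>\<close>.\<close>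
    define \<eta>' where "\<eta>' = \<eta> / (2 * (1 + 4 / e\<^sup>2))"
    have \<eta>': "0 < \<eta>'" "(1 + 4 / e\<^sup>2) * \<eta>' < \<eta>"
    proof -
      have p: "0 < 1 + 4 / e\<^sup>2" by (simp add: add_pos_nonneg)
      then show "0 < \<eta>'" using \<eta> by (simp add: \<eta>'_def)
      have "(1 + 4 / e\<^sup>2) * \<eta>' = \<eta> / 2" using p unfolding \<eta>'_def by (metis less_irrefl mult.commute
        nonzero_mult_divide_mult_cancel_right times_divide_eq_right)
      then show "(1 + 4 / e\<^sup>2) * \<eta>' < \<eta>" using \<eta> by simp
    qed
    have a1: "a n \<le> 1" for n
      unfolding a_def m1[of n, symmetric]
      by (intro sum_mono power_mono norm_fourier_le_finite_mask norm_ge_zero)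
    have "incseq a" unfolding a_def
      by (intro incseq_SucI sum_mono2 fin \<Lambda>mono) auto
    then have "convergent a" using a1 incseq_convergent[of a 1] by (metis convergent_def)
    then have "Cauchy a" by (rule convergent_Cauchy)
    from CauchyD[OF this \<eta>'(1)] obtain j0 where "\<forall>m\<ge>j0. \<forall>n\<ge>j0. norm (a m - a n) < \<eta>'" by blast
    then have j0: "\<bar>a j - a j0\<bar> < \<eta>'" if "j \<ge> j0" for j using that by simp
    let ?F = "\<Lambda> j0"
    have "(\<lambda>n. \<Sum>v\<in>?F. ?m n v) \<longlonglongrightarrow> a j0"
      unfolding a_def
      by (intro tendsto_sum tendsto_power tendsto_norm
          LIMSEQ_subseq_LIMSEQ[OF finite_mask_tendsto \<open>strict_mono k\<close>, unfolded o_def])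
    then have "eventually (\<lambda>n. (\<Sum>v\<in>?F. ?m n v) < a j0 + \<eta>') sequentially"
      using \<eta>'(1) by (intro order_tendstoD(2)) auto
    then obtain n1 where n1: "\<And>n. n \<ge> n1 \<Longrightarrow> (\<Sum>v\<in>?F. ?m n v) < a j0 + \<eta>'"
      by (auto simp: eventually_sequentially)
    \<comment> \<open>Beyond this level the frequency \<open>\<xi>\<close> shifts the argument of
      the tail so little that half of the lower bound \<open>e\<close> remains.\<close>
    obtain n2 where n2: "2 * (2 * pi * R * \<bar>\<xi>\<bar>) / e < 2 ^ n2" using real_arch_pow[of 2] by auto
    obtain n where n: "n \<ge> max j0 (max n1 n2)" "\<tau> n = t" using \<tau>inf[OF t] by blast
    define M where "M = real (level Q (k (Suc n)))"
    have M0: "0 < M" using level_pos by (simp add: M_def)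
    have "n2 \<le> k (Suc n)" using n strict_mono_imp_increasing[OF \<open>strict_mono k\<close>, of "Suc n"] by linarith
    then have "(2::real) ^ n2 \<le> 2 ^ k (Suc n)" by (intro power_increasing) auto
    also have "\<dots> \<le> M" unfolding M_def by (rule real_level_ge)
    finally have "2 * (2 * pi * R * \<bar>\<xi>\<bar>) / e < M" using n2 by linarith
    then have Me: "2 * pi * R * \<bar>\<xi>\<bar> / M \<le> e / 2" using M0 e by (simp add: field_simps)
    \<comment> \<open>The limit transform is mask times tail, and the tail is at least
      \<open>e / 2\<close> here. Summed over the elements added after \<open>j0\<close>, the masks
      are thus controlled by an increment of \<open>a\<close>.\<close>
    have compare: "?m (Suc n) v \<le> (4 / e\<^sup>2) * (norm (?\<mu> (?x v)))\<^sup>2" if v: "v \<in> \<Lambda> (Suc n)" for v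
    proof -
      interpret S: digit_system "\<lambda>i. Q (k (Suc n) + i)" "\<lambda>i. D (k (Suc n) + i)" R by (rule shift)
      let ?\<nu> = "fourier (tail (k (Suc n)))" and ?y = "- (of_int (int t * v) / M)"
      have "norm (?\<nu> ?y - ?\<nu> (?x v / M)) \<le> 2 * pi * R * \<bar>?y - ?x v / M\<bar>"
        by (rule S.fourier_lipschitz)
      also have "?y - ?x v / M = - (\<xi> / M)" by (simp add: diff_divide_distrib)
      also have "2 * pi * R * \<bar>- (\<xi> / M)\<bar> \<le> e / 2" using Me M0 by simp
      finally have "norm (?\<nu> ?y - ?\<nu> (?x v / M)) \<le> e / 2" .
      moreover have "e \<le> norm (?\<nu> ?y)" using lower[OF v] n(2) by (simp add: e_def M_def)
      ultimately have "e / 2 \<le> norm (?\<nu> (?x v / M))"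
        using norm_triangle_ineq2[of "?\<nu> ?y" "?\<nu> (?x v / M)"] by linarith
      then have "norm (finite_mask Q D (k (Suc n)) (?x v)) * (e / 2) \<le> norm (?\<mu> (?x v))"
        unfolding fourier_moran_split[of "?x v" "k (Suc n)"] norm_mult M_def by (rule mult_left_mono) simp
      then have "(norm (finite_mask Q D (k (Suc n)) (?x v)) * (e / 2))\<^sup>2 \<le> (norm (?\<mu> (?x v)))\<^sup>2"
        using e by (intro power_mono) auto
      then show ?thesis using e by (simp add: power_mult_distrib power_divide field_simps)
    qed
    have sub: "?F \<subseteq> \<Lambda> (Suc n)" using n by (intro \<Lambda>mono) auto
    have split: "sum g (\<Lambda> (Suc n)) = sum g (\<Lambda> (Suc n) - ?F) + sum g ?F" for g :: "int \<Rightarrow> real"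
      by (rule sum.subset_diff[OF sub fin])
    have "(\<Sum>v\<in>\<Lambda> (Suc n) - ?F. ?m (Suc n) v) \<le> (\<Sum>v\<in>\<Lambda> (Suc n) - ?F. (4 / e\<^sup>2) * (norm (?\<mu> (?x v)))\<^sup>2)"
      using compare by (intro sum_mono) auto
    also have "\<dots> = (4 / e\<^sup>2) * (a (Suc n) - a j0)"
      unfolding sum_distrib_left[symmetric] a_def split[of "\<lambda>v. (norm (?\<mu> (?x v)))\<^sup>2"] by simp
    also have "\<dots> \<le> (4 / e\<^sup>2) * \<eta>'" using j0[of "Suc n"] n by (intro mult_left_mono) auto
    finally have "(\<Sum>v\<in>\<Lambda> (Suc n) - ?F. ?m (Suc n) v) \<le> (4 / e\<^sup>2) * \<eta>'" .
    then have "1 \<le> (4 / e\<^sup>2) * \<eta>' + (\<Sum>v\<in>?F. ?m (Suc n) v)"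
      using split[of "?m (Suc n)"] m1[of "Suc n"] by linarith
    moreover have "(\<Sum>v\<in>?F. ?m (Suc n) v) < a j0 + \<eta>'" using n by (intro n1) auto
    ultimately have "1 < (1 + 4 / e\<^sup>2) * \<eta>' + a j0" by (simp only: distrib_right mult_1)
    then have "1 - \<eta> < a j0" using \<eta>'(2) by linarith
    then show "\<exists>F. finite F \<and> F \<subseteq> (\<Union>n. \<Lambda> n) \<and> 1 - \<eta> < (\<Sum>v\<in>F. (norm (?\<mu> (?x v)))\<^sup>2)"
      using fin by (intro exI[of _ ?F]) (auto simp: a_def)
  qed
qed

end

section \<open>Completeness of exponentials\<close>

text \<open>Membership in the closed span, detached from orthogonality so that it can be propagated
  through sums and limits.\<close>

definition L2_approx :: "real measure \<Rightarrow> real set \<Rightarrow> (real \<Rightarrow> complex) \<Rightarrow> bool" where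
  "L2_approx M \<Lambda> f \<longleftrightarrow> L2_function M f \<and>
     (\<forall>\<epsilon>>0. \<exists>F c. finite F \<and> F \<subseteq> \<Lambda> \<and>
       (\<integral>x. (norm (f x - (\<Sum>l\<in>F. c l * expfun l x)))\<^sup>2 \<partial>M) < \<epsilon>)"

lemma norm_add_sq_le: "(norm (a + b :: complex))\<^sup>2 \<le> 2 * (norm a)\<^sup>2 + 2 * (norm b)\<^sup>2"
proof -
  have "(norm (a + b))\<^sup>2 \<le> (norm a + norm b)\<^sup>2"
    by (intro power_mono norm_triangle_ineq) auto
  also have "\<dots> \<le> 2 * (norm a)\<^sup>2 + 2 * (norm b)\<^sup>2"
    using zero_le_power2[of "norm a - norm b"] by (simp add: power2_eq_square algebra_simps)
  finally show ?thesis .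
qed

lemma expfun_eq_cis: "expfun l x = cis (- (2 * pi * l * x))"
  by (simp add: expfun_def cis_conv_exp mult_ac)

lemma norm_expfun [simp]: "norm (expfun l x) = 1"
  by (simp add: expfun_eq_cis)

lemma measurable_expfun [measurable]: "expfun l \<in> borel_measurable borel"
  unfolding expfun_def by measurable

context real_distribution
begin

lemma L2_add:
  assumes "L2_function M f" "L2_function M g"
  shows "L2_function M (\<lambda>x. f x + g x)"
proof -
  have m [measurable]: "f \<in> borel_measurable M" "g \<in> borel_measurable M"
    using assms by (auto simp: L2_function_def)
  have "integrable M (\<lambda>x. (norm (f x + g x))\<^sup>2)"
  proof (rule Bochner_Integration.integrable_bound)
    show "integrable M (\<lambda>x. 2 * (norm (f x))\<^sup>2 + 2 * (norm (g x))\<^sup>2)"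
      using assms by (auto simp: L2_function_def)
  qed (auto simp: norm_add_sq_le)
  then show ?thesis by (simp add: L2_function_def)
qed

lemma L2_mult: "L2_function M f \<Longrightarrow> L2_function M (\<lambda>x. c * f x)"
  by (auto simp: L2_function_def norm_mult power_mult_distrib)

lemma L2_diff: "L2_function M f \<Longrightarrow> L2_function M g \<Longrightarrow> L2_function M (\<lambda>x. f x - g x)"
  using L2_add[of f "\<lambda>x. - 1 * g x"] L2_mult[of g "- 1"] by simp

lemma L2_bounded:
  assumes "f \<in> borel_measurable M" "\<And>x. norm (f x) \<le> b"
  shows "L2_function M f"
  unfolding L2_function_def
proof
  show "integrable M (\<lambda>x. (norm (f x))\<^sup>2)"
  proof (rule integrable_const_bound[of _ "b\<^sup>2"])
    show "AE x in M. norm ((norm (f x))\<^sup>2) \<le> b\<^sup>2"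
      using assms(2) by (auto intro!: power_mono)
  qed (use assms(1) in measurable)
qed (fact assms(1))

lemma L2_expfun: "L2_function M (expfun l)"
  by (rule L2_bounded[of _ 1]) auto

lemma L2_trig: "L2_function M (\<lambda>x. \<Sum>l\<in>F. c l * expfun l x)"
proof (rule L2_bounded)
  show "norm (\<Sum>l\<in>F. c l * expfun l x) \<le> (\<Sum>l\<in>F. norm (c l))" for x
    by (rule order_trans[OF norm_sum]) (simp add: norm_mult)
qed measurable

lemma L2_dist_triangle:
  assumes "L2_function M f" "L2_function M g" "L2_function M h"
  shows "(\<integral>x. (norm (f x - h x))\<^sup>2 \<partial>M) \<le> 2 * (\<integral>x. (norm (f x - g x))\<^sup>2 \<partial>M) + 2 * (\<integral>x. (norm (g x - h x))\<^sup>2 \<partial>M)"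
proof -
  have int: "integrable M (\<lambda>x. (norm (u x - v x))\<^sup>2)" if "L2_function M u" "L2_function M v" for u v
    using L2_diff[OF that] by (simp add: L2_function_def)
  have "(\<integral>x. (norm (f x - h x))\<^sup>2 \<partial>M) \<le> (\<integral>x. 2 * (norm (f x - g x))\<^sup>2 + 2 * (norm (g x - h x))\<^sup>2 \<partial>M)"
  proof (rule integral_mono)
    show "(norm (f x - h x))\<^sup>2 \<le> 2 * (norm (f x - g x))\<^sup>2 + 2 * (norm (g x - h x))\<^sup>2" for x
      using norm_add_sq_le[of "f x - g x" "g x - h x"] by simp
  qed (use int assms in auto)
  also have "\<dots> = 2 * (\<integral>x. (norm (f x - g x))\<^sup>2 \<partial>M) + 2 * (\<integral>x. (norm (g x - h x))\<^sup>2 \<partial>M)"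
    using int assms by simp
  finally show ?thesis .
qed

lemma L2_approx_closed:
  assumes f: "L2_function M f"
    and appr: "\<And>\<epsilon>. 0 < \<epsilon> \<Longrightarrow> \<exists>g. L2_approx M \<Lambda> g \<and> (\<integral>x. (norm (f x - g x))\<^sup>2 \<partial>M) < \<epsilon>"
  shows "L2_approx M \<Lambda> f"
  unfolding L2_approx_def
proof (intro conjI f allI impI)
  fix \<epsilon> :: real assume \<epsilon>: "0 < \<epsilon>"
  then have \<epsilon>4: "0 < \<epsilon> / 4" by simp
  obtain g where g: "L2_approx M \<Lambda> g" "(\<integral>x. (norm (f x - g x))\<^sup>2 \<partial>M) < \<epsilon> / 4"
    using appr[of "\<epsilon> / 4"] \<epsilon> by auto
  obtain F c where F: "finite F" "F \<subseteq> \<Lambda>" "(\<integral>x. (norm (g x - (\<Sum>l\<in>F. c l * expfun l x)))\<^sup>2 \<partial>M) < \<epsilon> / 4"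
    using g(1) \<epsilon>4 unfolding L2_approx_def by meson
  have "(\<integral>x. (norm (f x - (\<Sum>l\<in>F. c l * expfun l x)))\<^sup>2 \<partial>M) < \<epsilon>"
    using L2_dist_triangle[OF f _ L2_trig, of g c F] g F(3) unfolding L2_approx_def by linarith
  then show "\<exists>F c. finite F \<and> F \<subseteq> \<Lambda> \<and> (\<integral>x. (norm (f x - (\<Sum>l\<in>F. c l * expfun l x)))\<^sup>2 \<partial>M) < \<epsilon>"
    using F by blast
qed

text \<open>Dominated convergence for the squared distances, with majorant
  \<open>4 * (w x)\<^sup>2\<close>. Later \<open>w\<close> is 1 for indicators and
  \<open>2 * norm (f x)\<close> for general \<open>f\<close>.\<close>

lemma L2_approx_lim:
  assumes [measurable]: "f \<in> borel_measurable M"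
    and appr: "\<And>n. L2_approx M \<Lambda> (g n)" and lim: "\<And>x. (\<lambda>n. g n x) \<longlonglongrightarrow> f x"
    and dom: "\<And>n x. norm (g n x) \<le> w x" and w: "integrable M (\<lambda>x. (w x)\<^sup>2)"
  shows "L2_approx M \<Lambda> f"
proof -
  have g [measurable]: "g n \<in> borel_measurable M" for n using appr by (simp add: L2_approx_def L2_function_def)
  have fw: "norm (f x) \<le> w x" for x
    by (rule LIMSEQ_le_const2[OF tendsto_norm[OF lim]]) (use dom in blast)
  have w0: "0 \<le> w x" for x using fw norm_ge_zero order_trans by blast
  have f2: "L2_function M f"
    unfolding L2_function_def
  proof
    show "integrable M (\<lambda>x. (norm (f x))\<^sup>2)"
      by (rule Bochner_Integration.integrable_bound[OF w]) (auto intro!: power_mono fw)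
  qed simp
  have "(\<lambda>n. \<integral>x. (norm (f x - g n x))\<^sup>2 \<partial>M) \<longlonglongrightarrow> (\<integral>x. 0 \<partial>M)"
  proof (rule integral_dominated_convergence)
    show "integrable M (\<lambda>x. 4 * (w x)\<^sup>2)" using w by simp
    have "(\<lambda>n. (norm (f x - g n x))\<^sup>2) \<longlonglongrightarrow> (norm (f x - f x))\<^sup>2" for x
      by (intro tendsto_intros lim)
    then show "AE x in M. (\<lambda>n. (norm (f x - g n x))\<^sup>2) \<longlonglongrightarrow> 0" by simp
    have "(norm (f x - g n x))\<^sup>2 \<le> 4 * (w x)\<^sup>2" for n x
    proof -
      have "norm (f x - g n x) \<le> 2 * w x"
        using norm_triangle_ineq4[of "f x" "g n x"] fw[of x] dom[of n x] by linarith
      then have "(norm (f x - g n x))\<^sup>2 \<le> (2 * w x)\<^sup>2" by (intro power_mono) auto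
      then show ?thesis by (simp add: power_mult_distrib)
    qed
    then show "AE x in M. norm ((norm (f x - g n x))\<^sup>2) \<le> 4 * (w x)\<^sup>2" for n by simp
  qed measurable
  then have lim0: "(\<lambda>n. \<integral>x. (norm (f x - g n x))\<^sup>2 \<partial>M) \<longlonglongrightarrow> 0" by simp
  show ?thesis
  proof (rule L2_approx_closed[OF f2])
    fix \<epsilon> :: real assume "0 < \<epsilon>"
    then have "eventually (\<lambda>n. (\<integral>x. (norm (f x - g n x))\<^sup>2 \<partial>M) < \<epsilon>) sequentially"
      by (rule order_tendstoD(2)[OF lim0])
    then obtain n where "(\<integral>x. (norm (f x - g n x))\<^sup>2 \<partial>M) < \<epsilon>"
      using eventually_happens'[OF sequentially_bot] by blast
    then show "\<exists>g. L2_approx M \<Lambda> g \<and> (\<integral>x. (norm (f x - g x))\<^sup>2 \<partial>M) < \<epsilon>" using appr by blast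
  qed
qed

lemma L2_approx_0: "L2_approx M \<Lambda> (\<lambda>x. 0)"
  unfolding L2_approx_def
proof (intro conjI allI impI)
  show "L2_function M (\<lambda>x. 0)" by (rule L2_bounded[of _ 0]) auto
  show "\<exists>F c. finite F \<and> F \<subseteq> \<Lambda> \<and> (\<integral>x. (norm (0 - (\<Sum>l\<in>F. c l * expfun l x)))\<^sup>2 \<partial>M) < \<epsilon>"
    if "0 < \<epsilon>" for \<epsilon> using that by (intro exI[of _ "{}"]) simp
qed

lemma L2_approx_mult:
  assumes "L2_approx M \<Lambda> f"
  shows "L2_approx M \<Lambda> (\<lambda>x. a * f x)"
proof (cases "a = 0")
  case True
  then show ?thesis by (simp add: L2_approx_0)
next
  case False
  show ?thesis unfolding L2_approx_def
  proof (intro conjI allI impI)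
    show "L2_function M (\<lambda>x. a * f x)" using assms by (auto simp: L2_approx_def L2_mult)
    fix \<epsilon> :: real assume "0 < \<epsilon>"
    then have "0 < \<epsilon> / (norm a)\<^sup>2" using False by simp
    then obtain F c where F: "finite F" "F \<subseteq> \<Lambda>"
      "(\<integral>x. (norm (f x - (\<Sum>l\<in>F. c l * expfun l x)))\<^sup>2 \<partial>M) < \<epsilon> / (norm a)\<^sup>2"
      using assms unfolding L2_approx_def by meson
    have "a * f x - (\<Sum>l\<in>F. (a * c l) * expfun l x) = a * (f x - (\<Sum>l\<in>F. c l * expfun l x))" for x
      by (simp add: right_diff_distrib sum_distrib_left mult.assoc)
    then have "(\<integral>x. (norm (a * f x - (\<Sum>l\<in>F. (a * c l) * expfun l x)))\<^sup>2 \<partial>M) =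
        (norm a)\<^sup>2 * (\<integral>x. (norm (f x - (\<Sum>l\<in>F. c l * expfun l x)))\<^sup>2 \<partial>M)"
      by (simp add: norm_mult power_mult_distrib)
    also have "\<dots> < \<epsilon>" using F(3) False by (simp add: field_simps)
    finally show "\<exists>F c. finite F \<and> F \<subseteq> \<Lambda> \<and> (\<integral>x. (norm (a * f x - (\<Sum>l\<in>F. c l * expfun l x)))\<^sup>2 \<partial>M) < \<epsilon>"
      using F by (intro exI[of _ F] exI[of _ "\<lambda>l. a * c l"]) simp
  qed
qed

lemma L2_approx_add:
  assumes f: "L2_approx M \<Lambda> f" and g: "L2_approx M \<Lambda> g"
  shows "L2_approx M \<Lambda> (\<lambda>x. f x + g x)"
  unfolding L2_approx_def
proof (intro conjI allI impI)
  have fg: "L2_function M f" "L2_function M g" using assms by (auto simp: L2_approx_def)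
  then show "L2_function M (\<lambda>x. f x + g x)" by (rule L2_add)
  fix \<epsilon> :: real assume \<epsilon>: "0 < \<epsilon>"
  then have \<epsilon>4: "0 < \<epsilon> / 4" by simp
  obtain F c where F: "finite F" "F \<subseteq> \<Lambda>" "(\<integral>x. (norm (f x - (\<Sum>l\<in>F. c l * expfun l x)))\<^sup>2 \<partial>M) < \<epsilon> / 4"
    using f \<epsilon>4 unfolding L2_approx_def by meson
  obtain G d where G: "finite G" "G \<subseteq> \<Lambda>" "(\<integral>x. (norm (g x - (\<Sum>l\<in>G. d l * expfun l x)))\<^sup>2 \<partial>M) < \<epsilon> / 4"
    using g \<epsilon>4 unfolding L2_approx_def by meson
  let ?c = "\<lambda>l. of_bool (l \<in> F) * c l + of_bool (l \<in> G) * d l"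
  let ?P = "\<lambda>x. \<Sum>l\<in>F. c l * expfun l x" and ?R = "\<lambda>x. \<Sum>l\<in>G. d l * expfun l x"
  have eq: "(\<Sum>l\<in>F \<union> G. ?c l * expfun l x) = ?P x + ?R x" for x
  proof -
    have 1: "(\<Sum>l\<in>F \<union> G. of_bool (l \<in> F) * c l * expfun l x) = ?P x"
      by (rule sum.mono_neutral_cong_right) (use F(1) G(1) in auto)
    have 2: "(\<Sum>l\<in>F \<union> G. of_bool (l \<in> G) * d l * expfun l x) = ?R x"
      by (rule sum.mono_neutral_cong_right) (use F(1) G(1) in auto)
    show ?thesis using 1 2 by (simp add: distrib_right sum.distrib)
  qed
  have i: "L2_function M (\<lambda>x. f x - ?P x)" "L2_function M (\<lambda>x. g x - ?R x)"
    by (intro L2_diff fg L2_trig)+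
  have "(\<integral>x. (norm (f x + g x - (\<Sum>l\<in>F \<union> G. ?c l * expfun l x)))\<^sup>2 \<partial>M) =
      (\<integral>x. (norm ((f x - ?P x) + (g x - ?R x)))\<^sup>2 \<partial>M)"
    unfolding eq by (simp add: algebra_simps)
  also have "\<dots> \<le> (\<integral>x. 2 * (norm (f x - ?P x))\<^sup>2 + 2 * (norm (g x - ?R x))\<^sup>2 \<partial>M)"
    using L2_add[OF i] i by (intro integral_mono norm_add_sq_le) (auto simp: L2_function_def)
  also have "\<dots> = 2 * (\<integral>x. (norm (f x - ?P x))\<^sup>2 \<partial>M) + 2 * (\<integral>x. (norm (g x - ?R x))\<^sup>2 \<partial>M)"
    using i by (simp add: L2_function_def)
  also have "\<dots> < \<epsilon>" using F(3) G(3) by linarith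
  finally show "\<exists>F c. finite F \<and> F \<subseteq> \<Lambda> \<and> (\<integral>x. (norm (f x + g x - (\<Sum>l\<in>F. c l * expfun l x)))\<^sup>2 \<partial>M) < \<epsilon>"
    using F(1,2) G(1,2) by (intro exI[of _ "F \<union> G"] exI[of _ ?c]) auto
qed

lemma L2_approx_sum:
  assumes "\<And>i. i \<in> I \<Longrightarrow> L2_approx M \<Lambda> (f i)"
  shows "L2_approx M \<Lambda> (\<lambda>x. \<Sum>i\<in>I. f i x)"
  using assms by (induction I rule: infinite_finite_induct) (auto simp: L2_approx_0 intro!: L2_approx_add)

text \<open>If all exponentials can be approximated, then so can be all polynomials in \<open>sin (\<theta> x)\<close>, hence
  (by Weierstrass and dominated convergence) the indicators of the sets \<open>sin (x / n) > sin (a / n)\<close>,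
  and these converge to the indicator of \<open>x > a\<close>.\<close>

lemma L2_approx_sin_power:
  assumes exps: "\<And>\<xi>. L2_approx M \<Lambda> (expfun \<xi>)"
  shows "L2_approx M \<Lambda> (\<lambda>x. expfun \<xi> x * of_real (sin (\<theta> * x)) ^ n)"
proof (induction n arbitrary: \<xi>)
  case 0 then show ?case using exps by simp
next
  case (Suc n)
  \<comment> \<open>Multiplication by \<open>sin (\<theta> * x)\<close> shifts the frequency by
    \<open>?s\<close> in both directions; hence the induction with arbitrary
    \<open>\<xi>\<close>.\<close>
  let ?s = "\<theta> / (2 * pi)"
  have sin_eq: "of_real (sin y) = (\<i> / 2) * cis (- y) - (\<i> / 2) * cis y" for y
    by (simp add: complex_eq_iff)
  have "expfun \<xi> x * of_real (sin (\<theta> * x)) ^ Suc n =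
      (\<i> / 2) * (expfun (\<xi> + ?s) x * of_real (sin (\<theta> * x)) ^ n) +
      (- (\<i> / 2)) * (expfun (\<xi> - ?s) x * of_real (sin (\<theta> * x)) ^ n)" for x
  proof -
    have 1: "expfun (\<xi> + ?s) x = expfun \<xi> x * cis (- (\<theta> * x))"
      unfolding expfun_eq_cis cis_mult by (intro arg_cong[of _ _ cis]) (simp add: field_simps)
    have 2: "expfun (\<xi> - ?s) x = expfun \<xi> x * cis (\<theta> * x)"
      unfolding expfun_eq_cis cis_mult by (intro arg_cong[of _ _ cis]) (simp add: field_simps)
    show ?thesis unfolding 1 2 power_Suc by (subst sin_eq) (simp add: algebra_simps)
  qed
  moreover have "L2_approx M \<Lambda> (\<lambda>x. (\<i> / 2) * (expfun (\<xi> + ?s) x * of_real (sin (\<theta> * x)) ^ n) +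
      (- (\<i> / 2)) * (expfun (\<xi> - ?s) x * of_real (sin (\<theta> * x)) ^ n))"
    by (intro L2_approx_add L2_approx_mult Suc)
  ultimately show ?case by presburger
qed

lemma L2_approx_sin_continuous:
  fixes h :: "real \<Rightarrow> real"
  assumes exps: "\<And>\<xi>. L2_approx M \<Lambda> (expfun \<xi>)" and h: "continuous_on UNIV h" "\<And>y. \<bar>h y\<bar> \<le> 1"
  shows "L2_approx M \<Lambda> (\<lambda>x. of_real (h (sin (\<theta> * x))))"
proof -
  have sinpow: "L2_approx M \<Lambda> (\<lambda>x. of_real (sin (\<theta> * x)) ^ n)" for n
    using L2_approx_sin_power[OF exps, of 0 \<theta> n] by (simp add: expfun_def)
  have [measurable]: "h \<in> borel_measurable borel" using h(1) by (rule borel_measurable_continuous_onI)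
  have hL2: "L2_function M (\<lambda>x. complex_of_real (h (sin (\<theta> * x))))"
    by (rule L2_bounded[of _ 1]) (use h(2) in auto)
  show ?thesis
  proof (rule L2_approx_closed[OF hL2])
    fix \<epsilon> :: real assume \<epsilon>: "0 < \<epsilon>"
    define e where "e = min 1 (\<epsilon> / 2)"
    have e: "0 < e" "e\<^sup>2 < \<epsilon>"
    proof -
      show e0: "0 < e" using \<epsilon> by (simp add: e_def)
      have "e \<le> 1" by (simp add: e_def)
      then have "e\<^sup>2 \<le> e" using e0 by (simp add: power2_eq_square mult_left_le)
      also have "e < \<epsilon>" using \<epsilon> by (simp add: e_def min_def)
      finally show "e\<^sup>2 < \<epsilon>" .
    qed
    obtain p where p: "real_polynomial_function p" "\<And>y. y \<in> {-1..1} \<Longrightarrow> \<bar>h y - p y\<bar> < e"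
      by (rule Stone_Weierstrass_real_polynomial_function[OF compact_Icc continuous_on_subset[OF h(1) subset_UNIV] e(1)])
        blast
    obtain a n where pa: "p = (\<lambda>y. \<Sum>i\<le>n. a i * y ^ i)"
      using real_polynomial_function_imp_sum[OF p(1)] by blast
    let ?g = "\<lambda>x. complex_of_real (p (sin (\<theta> * x)))"
    have "?g = (\<lambda>x. \<Sum>i\<le>n. of_real (a i) * of_real (sin (\<theta> * x)) ^ i)"
      by (simp add: pa fun_eq_iff)
    then have g: "L2_approx M \<Lambda> ?g" by (simp only:) (intro L2_approx_sum L2_approx_mult sinpow)
    have "(\<integral>x. (norm (complex_of_real (h (sin (\<theta> * x))) - ?g x))\<^sup>2 \<partial>M) \<le> (\<integral>x. e\<^sup>2 \<partial>M)"
    proof (rule integral_mono)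
      have "L2_function M (\<lambda>x. complex_of_real (h (sin (\<theta> * x))) - ?g x)"
        using g by (intro L2_diff hL2) (simp add: L2_approx_def)
      then show "integrable M (\<lambda>x. (norm (complex_of_real (h (sin (\<theta> * x))) - ?g x))\<^sup>2)"
        by (simp add: L2_function_def)
      show "(norm (complex_of_real (h (sin (\<theta> * x))) - ?g x))\<^sup>2 \<le> e\<^sup>2" for x
        using p(2)[of "sin (\<theta> * x)"] by (intro power_mono) (auto simp: norm_of_real simp flip: of_real_diff)
    qed simp
    also have "\<dots> < \<epsilon>" using e prob_space by simp
    finally show "\<exists>g. L2_approx M \<Lambda> g \<and> (\<integral>x. (norm (complex_of_real (h (sin (\<theta> * x))) - g x))\<^sup>2 \<partial>M) < \<epsilon>"
      using g by blast
  qed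
qed

lemma L2_approx_sin_indicator:
  assumes exps: "\<And>\<xi>. L2_approx M \<Lambda> (expfun \<xi>)"
  shows "L2_approx M \<Lambda> (\<lambda>x. of_bool (c < sin (\<theta> * x)))"
proof (rule L2_approx_lim)
  \<comment> \<open>For \<open>n > 0\<close> these are ramps from 0 at \<open>c\<close> up to 1 at
    \<open>c + 1 / n\<close>, so the limit at \<open>c\<close> is 0, in accordance with the strict
    inequality.\<close>
  let ?h = "\<lambda>n y. max 0 (min 1 (real n * (y - c)))"
  show "L2_approx M \<Lambda> (\<lambda>x. of_real (?h n (sin (\<theta> * x))))" for n
    by (rule L2_approx_sin_continuous[OF exps]) (auto intro!: continuous_intros)
  show "(\<lambda>n. complex_of_real (?h n (sin (\<theta> * x)))) \<longlonglongrightarrow> of_bool (c < sin (\<theta> * x))" for x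
  proof (cases "c < sin (\<theta> * x)")
    case True
    obtain n0 :: nat where n0: "1 / (sin (\<theta> * x) - c) < n0" using reals_Archimedean2 by blast
    have "?h n (sin (\<theta> * x)) = 1" if "n \<ge> n0" for n
    proof -
      have "1 < n0 * (sin (\<theta> * x) - c)" using n0 True by (simp add: field_simps)
      also have "\<dots> \<le> n * (sin (\<theta> * x) - c)" using that True by (intro mult_right_mono) auto
      finally show ?thesis by simp
    qed
    then have "eventually (\<lambda>n. complex_of_real (?h n (sin (\<theta> * x))) = 1) sequentially"
      unfolding eventually_sequentially by (metis of_real_1)
    then show ?thesis using True by (auto intro: tendsto_eventually)
  next
    case False
    then have "real n * (sin (\<theta> * x) - c) \<le> 0" for n by (intro mult_nonneg_nonpos) auto
    then have "?h n (sin (\<theta> * x)) = 0" for n by (metis max.absorb1 min.coboundedI2)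
    then show ?thesis using False by simp
  qed
  show "norm (complex_of_real (?h n (sin (\<theta> * x)))) \<le> 1" for n x by simp
qed auto

lemma L2_approx_greaterThan:
  assumes exps: "\<And>\<xi>. L2_approx M \<Lambda> (expfun \<xi>)"
  shows "L2_approx M \<Lambda> (\<lambda>x. of_bool (a < x))"
proof (rule L2_approx_lim)
  show "L2_approx M \<Lambda> (\<lambda>x. of_bool (sin (a / Suc n) < sin (1 / Suc n * x)))" for n
    by (rule L2_approx_sin_indicator[OF exps])
  show "(\<lambda>n. of_bool (sin (a / Suc n) < sin (1 / Suc n * x)) :: complex) \<longlonglongrightarrow> of_bool (a < x)" for x
  proof -
    obtain n0 :: nat where n0: "max \<bar>a\<bar> \<bar>x\<bar> < n0" using reals_Archimedean2 by blast
    have "sin (a / Suc n) < sin (1 / Suc n * x) \<longleftrightarrow> a < x" if "n \<ge> n0" for n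
    proof -
      have small: "- (pi / 2) \<le> y / Suc n \<and> y / Suc n \<le> pi / 2" if "\<bar>y\<bar> < n0" for y :: real
      proof -
        have "\<bar>y / Suc n\<bar> \<le> 1" using that \<open>n \<ge> n0\<close> by (simp add: divide_le_eq_1)
        then show ?thesis using pi_gt3 by linarith
      qed
      have "sin (a / Suc n) < sin (x / Suc n) \<longleftrightarrow> a / Suc n < x / Suc n"
        using small[of a] small[of x] n0 by (intro sin_mono_less_eq) auto
      also have "\<dots> \<longleftrightarrow> a < x" by (simp add: divide_less_cancel)
      finally show ?thesis by simp
    qed
    then have "eventually (\<lambda>n. (of_bool (sin (a / Suc n) < sin (1 / Suc n * x)) :: complex) = of_bool (a < x)) sequentially"
      unfolding eventually_sequentially by (intro exI[of _ n0]) simp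
    then show ?thesis by (rule tendsto_eventually)
  qed
  show "norm (of_bool (sin (a / Suc n) < sin (1 / Suc n * x)) :: complex) \<le> 1" for n x by simp
qed auto

text \<open>Dynkin's argument: half-lines are stable under intersection and generate the Borel sets,
  and approximability passes to complements and countable disjoint unions.\<close>

lemma L2_approx_indicator:
  assumes exps: "\<And>\<xi>. L2_approx M \<Lambda> (expfun \<xi>)" and A: "A \<in> sets borel"
  shows "L2_approx M \<Lambda> (\<lambda>x. of_bool (x \<in> A))"
proof -
  have one: "L2_approx M \<Lambda> (\<lambda>x. 1)" using exps[of 0] by (simp add: expfun_def[abs_def])
  have A': "A \<in> sigma_sets UNIV (range (\<lambda>a. {a<..}))"
    using A by (simp add: borel_Ioi)
  have "Int_stable (range (\<lambda>a::real. {a<..}))"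
  proof (rule Int_stableI)
    fix X Y assume "X \<in> range (\<lambda>a::real. {a<..})" "Y \<in> range (\<lambda>a::real. {a<..})"
    then obtain a b where "X = {a<..}" "Y = {b<..}" by auto
    then have "X \<inter> Y = {max a b<..}" by auto
    then show "X \<inter> Y \<in> range (\<lambda>a. {a<..})" by auto
  qed
  moreover have "range (\<lambda>a::real. {a<..}) \<subseteq> Pow UNIV" by simp
  ultimately show ?thesis using A'
  proof (induction rule: sigma_sets_induct_disjoint)
    case (basic A) then show ?case using L2_approx_greaterThan[OF exps] by auto
  next
    case empty then show ?case by (simp add: L2_approx_0)
  next
    case (compl A)
    have "L2_approx M \<Lambda> (\<lambda>x. 1 + - 1 * of_bool (x \<in> A))"
      by (intro L2_approx_add one L2_approx_mult compl)
    moreover have "(\<lambda>x. 1 + - 1 * of_bool (x \<in> A) :: complex) = (\<lambda>x. of_bool (x \<in> UNIV - A))" by auto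
    ultimately show ?case by simp
  next
    case (union A)
    have disj: "(\<Sum>i<n. of_bool (x \<in> A i)) = (of_bool (x \<in> (\<Union>i<n. A i)) :: complex)" for n x
    proof (induction n)
      case (Suc n)
      have notin: "x \<notin> (\<Union>i<n. A i)" if "x \<in> A n"
        using union(1) that unfolding disjoint_family_on_def by (metis IntI UN_E UNIV_I empty_iff lessThan_iff nat_neq_iff)
      show ?case unfolding sum.lessThan_Suc Suc.IH
        using notin by (cases "x \<in> A n") (auto simp: lessThan_Suc)
    qed simp
    show ?case
    proof (rule L2_approx_lim)
      show "L2_approx M \<Lambda> (\<lambda>x. \<Sum>i<n. of_bool (x \<in> A i))" for n
        by (intro L2_approx_sum union)
      show "(\<lambda>n. \<Sum>i<n. of_bool (x \<in> A i) :: complex) \<longlonglongrightarrow> of_bool (x \<in> (\<Union>i. A i))" for x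
      proof (cases "x \<in> (\<Union>i. A i)")
        case True
        then obtain i where i: "x \<in> A i" by blast
        have "eventually (\<lambda>n. (\<Sum>i<n. of_bool (x \<in> A i) :: complex) = 1) sequentially"
          unfolding eventually_sequentially disj
          using i by (intro exI[of _ "Suc i"] allI impI) (auto intro!: bexI[of _ i])
        then show ?thesis using True by (auto intro: tendsto_eventually)
      qed (auto simp: disj)
      show "norm (\<Sum>i<n. of_bool (x \<in> A i) :: complex) \<le> 1" for n x by (simp add: disj)
      have "A i \<in> sets borel" for i using union(2) by (auto simp: borel_Ioi)
      then show "(\<lambda>x. of_bool (x \<in> (\<Union>i. A i)) :: complex) \<in> borel_measurable M" by measurable
    qed auto
  qed
qed

lemma L2_approx_all:
  assumes exps: "\<And>\<xi>. L2_approx M \<Lambda> (expfun \<xi>)" and f: "L2_function M f"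
  shows "L2_approx M \<Lambda> f"
proof -
  have fm: "f \<in> borel_measurable M" using f by (simp add: L2_function_def)
  obtain s where s: "\<And>i. simple_function M (s i)" "\<And>x. x \<in> space M \<Longrightarrow> (\<lambda>i. s i x) \<longlonglongrightarrow> f x"
    "\<And>i x. x \<in> space M \<Longrightarrow> dist (s i x) 0 \<le> 2 * dist (f x) 0"
    using borel_measurable_implies_sequence_metric[OF fm, of 0] by blast
  show ?thesis
  proof (rule L2_approx_lim[OF fm])
    show "L2_approx M \<Lambda> (s i)" for i
    proof -
      have fin: "finite (s i ` UNIV)" using simple_functionD(1)[OF s(1)[of i]] by simp
      have eq: "s i = (\<lambda>x. \<Sum>y\<in>s i ` UNIV. y * of_bool (x \<in> s i -` {y}))"
      proof
        fix x
        have "(\<Sum>y\<in>s i ` UNIV. y * of_bool (x \<in> s i -` {y})) = (\<Sum>y\<in>s i ` UNIV. if y = s i x then y else 0)"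
          by (intro sum.cong) auto
        then show "s i x = (\<Sum>y\<in>s i ` UNIV. y * of_bool (x \<in> s i -` {y}))" using fin by simp
      qed
      have "L2_approx M \<Lambda> (\<lambda>x. \<Sum>y\<in>s i ` UNIV. y * of_bool (x \<in> s i -` {y}))"
        using simple_functionD(2)[OF s(1)[of i]]
        by (intro L2_approx_sum L2_approx_mult L2_approx_indicator exps) auto
      then show ?thesis by (subst eq)
    qed
    show "(\<lambda>i. s i x) \<longlonglongrightarrow> f x" for x using s(2)[of x] by simp
    show "norm (s i x) \<le> 2 * norm (f x)" for i x using s(3)[of x i] by simp
    show "integrable M (\<lambda>x. (2 * norm (f x))\<^sup>2)" using f by (simp add: L2_function_def power_mult_distrib)
  qed
qed

lemma expfun_mult_cnj: "expfun a x * cnj (expfun b x) = expfun (a - b) x"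
  by (simp add: expfun_eq_cis cis_cnj cis_mult algebra_simps)

lemma integral_expfun: "(CLINT x|M. expfun l x) = fourier M l"
  unfolding fourier_def char_def expfun_def by (simp add: mult_ac)

lemma integrable_expfun: "integrable M (expfun l)"
  by (rule integrable_const_bound[of _ 1]) auto

text \<open>For an orthonormal family of exponentials, the squared distance of \<open>expfun \<xi>\<close> from the partial
  Fourier sum is \<open>1\<close> minus the sum of the squared coefficients.\<close>

lemma L2_approx_expfun:
  assumes orth: "\<And>l l'. l \<in> \<Lambda> \<Longrightarrow> l' \<in> \<Lambda> \<Longrightarrow> l \<noteq> l' \<Longrightarrow> fourier M (l - l') = 0"
    and parseval: "\<And>\<eta>. 0 < \<eta> \<Longrightarrow> \<exists>F. finite F \<and> F \<subseteq> \<Lambda> \<and> 1 - \<eta> < (\<Sum>l\<in>F. (norm (fourier M (\<xi> - l)))\<^sup>2)"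
  shows "L2_approx M \<Lambda> (expfun \<xi>)"
  unfolding L2_approx_def
proof (intro conjI L2_expfun allI impI)
  fix \<epsilon> :: real assume "0 < \<epsilon>"
  then obtain F where F: "finite F" "F \<subseteq> \<Lambda>" "1 - \<epsilon> < (\<Sum>l\<in>F. (norm (fourier M (\<xi> - l)))\<^sup>2)"
    using parseval by blast
  let ?c = "\<lambda>l. fourier M (\<xi> - l)"
  let ?P = "\<lambda>x. \<Sum>l\<in>F. ?c l * expfun l x"
  have fourier_cnj: "fourier M (- y) = cnj (fourier M y)" for y
  proof -
    have "fourier M (- y) = (CLINT x|M. cnj (expfun y x))"
      unfolding integral_expfun[symmetric]
      by (rule Bochner_Integration.integral_cong) (simp_all add: expfun_eq_cis cis_cnj)
    also have "\<dots> = cnj (CLINT x|M. expfun y x)" by simp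
    finally show ?thesis by (simp only: integral_expfun)
  qed
  have f0: "fourier M 0 = 1" by (simp add: fourier_def char_zero)
  have "complex_of_real ((norm (expfun \<xi> x - ?P x))\<^sup>2) =
      1 - (\<Sum>l\<in>F. cnj (?c l) * expfun (\<xi> - l) x) - (\<Sum>l\<in>F. ?c l * expfun (l - \<xi>) x) +
      (\<Sum>l\<in>F. \<Sum>l'\<in>F. ?c l * cnj (?c l') * expfun (l - l') x)" for x
  proof -
    have "complex_of_real ((norm (expfun \<xi> x - ?P x))\<^sup>2) = (expfun \<xi> x - ?P x) * cnj (expfun \<xi> x - ?P x)"
      by (rule complex_norm_square)
    also have "\<dots> = expfun \<xi> x * cnj (expfun \<xi> x) - expfun \<xi> x * cnj (?P x) - ?P x * cnj (expfun \<xi> x) + ?P x * cnj (?P x)"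
      by (simp only: complex_cnj_diff) (simp add: algebra_simps)
    also have "expfun \<xi> x * cnj (expfun \<xi> x) = 1"
      unfolding expfun_mult_cnj by (simp add: expfun_def)
    also have "expfun \<xi> x * cnj (?P x) = (\<Sum>l\<in>F. cnj (?c l) * expfun (\<xi> - l) x)"
      unfolding cnj_sum sum_distrib_left by (intro sum.cong) (auto simp: mult_ac simp flip: expfun_mult_cnj)
    also have "?P x * cnj (expfun \<xi> x) = (\<Sum>l\<in>F. ?c l * expfun (l - \<xi>) x)"
      unfolding sum_distrib_right by (intro sum.cong) (auto simp: mult_ac simp flip: expfun_mult_cnj)
    also have "?P x * cnj (?P x) = (\<Sum>l\<in>F. \<Sum>l'\<in>F. ?c l * cnj (?c l') * expfun (l - l') x)"
      unfolding cnj_sum sum_product by (intro sum.cong) (auto simp: mult_ac simp flip: expfun_mult_cnj)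
    finally show ?thesis .
  qed
  then have "complex_of_real (\<integral>x. (norm (expfun \<xi> x - ?P x))\<^sup>2 \<partial>M) =
      (CLINT x|M. 1 - (\<Sum>l\<in>F. cnj (?c l) * expfun (\<xi> - l) x) - (\<Sum>l\<in>F. ?c l * expfun (l - \<xi>) x) +
      (\<Sum>l\<in>F. \<Sum>l'\<in>F. ?c l * cnj (?c l') * expfun (l - l') x))"
    by (simp only: integral_complex_of_real[symmetric])
  also have "\<dots> = 1 - (\<Sum>l\<in>F. cnj (?c l) * ?c l) - (\<Sum>l\<in>F. ?c l * fourier M (l - \<xi>)) +
      (\<Sum>l\<in>F. \<Sum>l'\<in>F. ?c l * cnj (?c l') * fourier M (l - l'))"
    using prob_space by (simp add: integrable_expfun integral_expfun)
  also have "(\<Sum>l\<in>F. ?c l * fourier M (l - \<xi>)) = (\<Sum>l\<in>F. cnj (?c l) * ?c l)"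
    using fourier_cnj[of "\<xi> - _"] by (intro sum.cong) (auto simp: mult.commute)
  also have "(\<Sum>l\<in>F. \<Sum>l'\<in>F. ?c l * cnj (?c l') * fourier M (l - l')) = (\<Sum>l\<in>F. cnj (?c l) * ?c l)"
  proof (rule sum.cong[OF refl])
    fix l assume l: "l \<in> F"
    have "(\<Sum>l'\<in>F. ?c l * cnj (?c l') * fourier M (l - l')) = (\<Sum>l'\<in>F. if l' = l then ?c l * cnj (?c l) else 0)"
      using l F(2) orth by (intro sum.cong) (auto simp: f0)
    then show "(\<Sum>l'\<in>F. ?c l * cnj (?c l') * fourier M (l - l')) = cnj (?c l) * ?c l"
      using l F(1) by (simp add: mult.commute)
  qed
  also have "1 - (\<Sum>l\<in>F. cnj (?c l) * ?c l) - (\<Sum>l\<in>F. cnj (?c l) * ?c l) + (\<Sum>l\<in>F. cnj (?c l) * ?c l) =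
      complex_of_real (1 - (\<Sum>l\<in>F. (norm (?c l))\<^sup>2))"
    by (simp add: complex_norm_square mult.commute del: of_real_power)
  finally have "(\<integral>x. (norm (expfun \<xi> x - ?P x))\<^sup>2 \<partial>M) = 1 - (\<Sum>l\<in>F. (norm (?c l))\<^sup>2)"
    by (simp only: of_real_eq_iff)
  then have "(\<integral>x. (norm (expfun \<xi> x - ?P x))\<^sup>2 \<partial>M) < \<epsilon>" using F(3) by linarith
  then show "\<exists>F c. finite F \<and> F \<subseteq> \<Lambda> \<and> (\<integral>x. (norm (expfun \<xi> x - (\<Sum>l\<in>F. c l * expfun l x)))\<^sup>2 \<partial>M) < \<epsilon>"
    using F(1,2) by (intro exI[of _ F] exI[of _ ?c]) simp
qed

text \<open>Parseval for single exponentials suffices: it puts every \<open>expfun \<xi>\<close>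
  into the closed span, and these exponentials together approximate all square integrable
  functions.\<close>

lemma is_spectrumI:
  assumes "countable \<Lambda>"
    and orth: "\<And>l l'. l \<in> \<Lambda> \<Longrightarrow> l' \<in> \<Lambda> \<Longrightarrow> l \<noteq> l' \<Longrightarrow> fourier M (l - l') = 0"
    and parseval: "\<And>\<xi> \<eta>. 0 < \<eta> \<Longrightarrow> \<exists>F. finite F \<and> F \<subseteq> \<Lambda> \<and> 1 - \<eta> < (\<Sum>l\<in>F. (norm (fourier M (\<xi> - l)))\<^sup>2)"
  shows "is_spectrum M \<Lambda>"
  unfolding is_spectrum_def L2_orthonormal_basis_def
proof (intro conjI ballI allI impI)
  fix l l' assume "l \<in> \<Lambda>" "l' \<in> \<Lambda>"
  then show "(CLINT x|M. expfun l x * cnj (expfun l' x)) = of_bool (l = l')"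
    unfolding expfun_mult_cnj integral_expfun using orth[of l l'] by (auto simp: fourier_def char_zero)
next
  fix f and \<epsilon> :: real assume "L2_function M f" "0 < \<epsilon>"
  then show "\<exists>F c. finite F \<and> F \<subseteq> \<Lambda> \<and> (\<integral>x. (norm (f x - (\<Sum>j\<in>F. c j * expfun j x)))\<^sup>2 \<partial>M) < \<epsilon>"
    using L2_approx_all[of \<Lambda> f, OF L2_approx_expfun[OF orth parseval]] unfolding L2_approx_def by blast
qed (use assms L2_expfun in auto)

end

section \<open>Complete residue systems\<close>

lemma isCont_cts_step: "x < y \<Longrightarrow> isCont (cts_step x y) z"
  using uniformly_continuous_imp_continuous[OF cts_step_uniformly_continuous, of x y]
  by (simp add: continuous_on_eq_continuous_at)

text \<open>\<open>cts_step x y\<close> descends from 1 at \<open>x\<close> to 0 at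
  \<open>y\<close>. Such functions transfer weak convergence to masses of intervals and, later, to
  measurability in \<open>\<omega>\<close>.\<close>

lemma (in digit_system) cts_step_tendsto:
  assumes "x < y"
  shows "(\<lambda>k. integral\<^sup>L (partial_conv k) (cts_step x y)) \<longlonglongrightarrow>
    integral\<^sup>L (moran Q D) (cts_step x y)"
proof (rule weak_conv_imp_integral_bdd_continuous_conv)
  show "norm (cts_step x y z) \<le> 1" for z using assms by (auto simp: cts_step_def divide_le_eq_1)
qed (use assms real_distribution_finite real_distribution_moran weak_conv_moran isCont_cts_step in auto)

lemma measure_convolution_delta:
  assumes M: "real_distribution M" and A: "finite A" "A \<noteq> {}"
  shows "measure (M \<star> delta A) {x} = (\<Sum>a\<in>A. measure M {x - a}) / card A"
proof -
  interpret M: real_distribution M by fact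
  interpret N: real_distribution "delta A" by (rule real_distribution_delta[OF A])
  have meas: "(\<lambda>a. measure M {x - a}) \<in> borel_measurable borel"
  proof -
    \<comment> \<open>Measurability of the mass of a moving atom: it is a difference of two monotone
      functions of \<open>x - a\<close>.\<close>
    have eq: "(\<lambda>a. measure M {x - a}) = (\<lambda>a. cdf M (x - a) - measure M {..<x - a})"
    proof
      fix a
      have "{..x - a} = {..<x - a} \<union> {x - a}" by auto
      then show "measure M {x - a} = cdf M (x - a) - measure M {..<x - a}"
        unfolding cdf_def by (simp only:) (subst M.finite_measure_Union, auto)
    qed
    have c: "cdf M \<in> borel_measurable borel"
      by (intro borel_measurable_mono monoI M.cdf_nondecreasing)
    have "(\<lambda>y. measure M {..<y}) \<in> borel_measurable borel"
      by (intro borel_measurable_mono monoI M.finite_measure_mono) auto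
    from measurable_compose[OF _ this, of "\<lambda>a. x - a" borel]
    have d: "(\<lambda>a. measure M {..<x - a}) \<in> borel_measurable borel" by simp
    show ?thesis unfolding eq using c d by measurable
  qed
  have "emeasure (M \<star> delta A) {x} = emeasure (delta A \<star> M) {x}"
    by (subst convolution_commutative) (auto intro: M.finite_measure_axioms N.finite_measure_axioms)
  also have "\<dots> = (\<integral>\<^sup>+a. emeasure M {y. y + a \<in> {x}} \<partial>delta A)"
    by (rule convolution_emeasure) (auto intro: M.finite_measure_axioms N.finite_measure_axioms)
  also have "\<dots> = (\<integral>\<^sup>+a. emeasure M {x - a} \<partial>delta A)"
    by (intro nn_integral_cong arg_cong[of _ _ "emeasure M"]) auto
  also have "\<dots> = (\<integral>\<^sup>+a. ennreal (measure M {x - a}) \<partial>delta A)"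
    by (simp add: M.emeasure_eq_measure)
  also have "\<dots> = (\<integral>\<^sup>+a. ennreal (measure M {x - a}) \<partial>uniform_count_measure A)"
    unfolding delta_def using meas
    by (subst nn_integral_distr) (simp_all add: uniform_count_measure_def point_measure_def)
  also have "\<dots> = (\<Sum>a\<in>A. ennreal (1 / card A) * ennreal (measure M {x - a}))"
    unfolding uniform_count_measure_def using A by (subst nn_integral_point_measure_finite) (auto simp: mult.commute)
  also have "\<dots> = ennreal (\<Sum>a\<in>A. 1 / card A * measure M {x - a})"
    by (simp only: ennreal_mult'[symmetric] zero_le_divide_1_iff of_nat_0_le_iff)
      (rule sum_ennreal, auto)
  finally have "measure (M \<star> delta A) {x} = (\<Sum>a\<in>A. 1 / card A * measure M {x - a})"
    by (simp add: measure_def sum_nonneg)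
  then show ?thesis by (simp add: sum_divide_distrib)
qed

text \<open>An interval meets at most \<open>(b - a) c + 1\<close> points of the lattice of mesh \<open>1 / c\<close>.\<close>

lemma measure_lattice_interval_le:
  assumes "real_distribution M" and c: "0 < c" and ab: "a \<le> b"
    and lattice: "AE x in M. x * c \<in> \<int>" and atoms: "\<And>x. measure M {x} \<le> 1 / c"
  shows "measure M {a<..b} \<le> (b - a) + 1 / c"
proof -
  interpret real_distribution M by fact
  let ?S = "{\<lfloor>a * c\<rfloor> + 1..\<lfloor>b * c\<rfloor>}"
  have "AE x in M. x \<in> {a<..b} \<longrightarrow> x \<in> (\<Union>j\<in>?S. {of_int j / c})"
    using lattice
  proof eventually_elim
    case (elim x)
    then obtain j where j: "x * c = of_int j" by (auto elim: Ints_cases)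
    show ?case
    proof
      assume x: "x \<in> {a<..b}"
      have "a * c < of_int j" "of_int j \<le> b * c" using x c unfolding j[symmetric] by auto
      then have "\<lfloor>a * c\<rfloor> < j" "j \<le> \<lfloor>b * c\<rfloor>" by (simp_all only: floor_less_iff le_floor_iff)
      then have "j \<in> ?S" by simp
      moreover have "x = of_int j / c" using j c by (simp add: field_simps)
      ultimately show "x \<in> (\<Union>j\<in>?S. {of_int j / c})" by blast
    qed
  qed
  then have "measure M {a<..b} \<le> measure M (\<Union>j\<in>?S. {of_int j / c})"
    by (rule finite_measure_mono_AE) auto
  also have "\<dots> \<le> (\<Sum>j\<in>?S. measure M {of_int j / c})"
    by (rule finite_measure_subadditive_finite) auto
  also have "\<dots> \<le> (\<Sum>j\<in>?S. 1 / c)" by (intro sum_mono atoms)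
  also have "\<dots> = card ?S * (1 / c)" by simp
  also have "\<dots> \<le> ((b - a) * c + 1) * (1 / c)"
  proof (rule mult_right_mono)
    have "a * c \<le> b * c" using ab c by simp
    then have "\<lfloor>a * c\<rfloor> \<le> \<lfloor>b * c\<rfloor>" by (rule floor_mono)
    then have "real (card ?S) = of_int \<lfloor>b * c\<rfloor> - of_int \<lfloor>a * c\<rfloor>" by simp
    also have "\<dots> \<le> (b - a) * c + 1" unfolding left_diff_distrib by linarith
    finally show "real (card ?S) \<le> (b - a) * c + 1" .
  qed (use c in simp)
  also have "\<dots> = (b - a) + 1 / c" using c by (simp add: field_simps)
  finally show ?thesis .
qed

lemma lattice_set_borel: "{x :: real. x * c \<in> \<int>} \<in> sets borel"
proof -
  have "(\<lambda>x. x * c) -` \<int> \<inter> space borel \<in> sets borel"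
    by (rule measurable_sets[of _ _ borel]) (auto intro: borel_closed closed_Ints)
  then show ?thesis by (simp add: vimage_def)
qed

locale full_digit_system = digit_system +
  assumes card_D: "card (D i) = Q i"
    and distinct_D: "b \<in> D i \<Longrightarrow> b' \<in> D i \<Longrightarrow> b \<noteq> b' \<Longrightarrow> \<not> int (Q i) dvd b - b'"
begin

lemma AE_lattice: "AE x in partial_conv k. x * real (level Q (Suc k)) \<in> \<int>"
proof (induction k)
  case 0
  have "AE x in moran_factor Q D 0. x * real (level Q (Suc 0)) \<in> \<int>"
    unfolding moran_factor_def using level_pos[of "Suc 0"] finite_D D_ne lattice_set_borel
    by (intro AE_delta) auto
  then show ?case unfolding finite_convolution.simps .
next
  case (Suc k)
  have factor: "AE x in moran_factor Q D (Suc k). x * real (level Q (Suc (Suc k))) \<in> \<int>"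
    unfolding moran_factor_def using level_pos[of "Suc (Suc k)"] finite_D D_ne lattice_set_borel
    by (intro AE_delta) auto
  show ?case unfolding finite_convolution.simps
  proof (rule AE_convolution[OF real_distribution_finite real_distribution_factor Suc factor _ lattice_set_borel])
    fix x y assume xy: "x * real (level Q (Suc k)) \<in> \<int>" "y * real (level Q (Suc (Suc k))) \<in> \<int>"
    have "(x + y) * real (level Q (Suc (Suc k))) =
        (x * real (level Q (Suc k))) * of_nat (Q (Suc k)) + y * real (level Q (Suc (Suc k)))"
      by (simp add: level_Suc[of Q "Suc k"] algebra_simps)
    then show "(x + y) * real (level Q (Suc (Suc k))) \<in> \<int>" using xy by (metis Ints_add Ints_mult Ints_of_nat)
  qed
qed

text \<open>If two digits contributed to the mass at \<open>x\<close>, they would differ by a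
  multiple of \<open>Q (Suc k)\<close>, because the previous partial convolution lives on the
  coarser lattice. So at most one summand is nonzero, and averaging divides the bound by
  \<open>Q (Suc k)\<close>.\<close>

lemma atom_le: "measure (partial_conv k) {x} \<le> 1 / real (level Q (Suc k))"
proof (induction k arbitrary: x)
  case 0
  let ?c = "real (level Q (Suc 0))"
  let ?A = "(\<lambda>b. of_int b / ?c) ` D 0"
  have c: "0 < ?c" using level_pos by simp
  have inj: "inj_on (\<lambda>b. of_int b / ?c) (D 0)" using c by (auto intro!: inj_onI)
  have "emeasure (delta ?A) {x} = ennreal (1 / card ?A * (\<Sum>a\<in>?A. indicator {x} a))"
    using finite_D D_ne by (intro emeasure_delta) auto
  also have "(\<Sum>a\<in>?A. indicator {x} a :: real) = of_bool (x \<in> ?A)"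
    using finite_D by (simp add: indicator_def)
  finally have "measure (delta ?A) {x} = 1 / card ?A * of_bool (x \<in> ?A)" by (simp add: measure_def)
  also have "\<dots> \<le> 1 / card ?A" by simp
  also have "card ?A = level Q (Suc 0)" by (simp only: card_image[OF inj] card_D) (simp add: level_Suc)
  finally show ?case by (simp add: moran_factor_def)
next
  case (Suc k)
  let ?F = "partial_conv k"
  interpret real_distribution ?F by (rule real_distribution_finite)
  let ?c = "real (level Q (Suc k))" and ?c' = "real (level Q (Suc (Suc k)))"
  let ?A = "(\<lambda>b. of_int b / ?c') ` D (Suc k)"
  have c: "0 < ?c" "0 < ?c'" using level_pos by simp_all
  have inj: "inj_on (\<lambda>b. of_int b / ?c') (D (Suc k))" using c by (auto intro!: inj_onI)
  have zero: "measure ?F {y} = 0" if "y * ?c \<notin> \<int>" for y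
  proof -
    have "AE x in ?F. x \<notin> {y}" using AE_lattice by eventually_elim (use that in auto)
    then show ?thesis by (subst prob_eq_0) auto
  qed
  have "measure (partial_conv (Suc k)) {x} = (\<Sum>a\<in>?A. measure ?F {x - a}) / card ?A"
    using finite_D D_ne real_distribution_finite unfolding finite_convolution.simps moran_factor_def[of Q D "Suc k"]
    by (intro measure_convolution_delta) auto
  also have "(\<Sum>a\<in>?A. measure ?F {x - a}) = (\<Sum>b\<in>D (Suc k). measure ?F {x - of_int b / ?c'})"
    by (simp add: sum.reindex[OF inj])
  also have "\<dots> \<le> 1 / ?c"
  proof (cases "\<exists>b\<in>D (Suc k). (x - of_int b / ?c') * ?c \<in> \<int>")
    case True
    then obtain b where b: "b \<in> D (Suc k)" "(x - of_int b / ?c') * ?c \<in> \<int>" by blast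
    have "measure ?F {x - of_int b' / ?c'} = 0" if b': "b' \<in> D (Suc k) - {b}" for b'
    proof (rule zero, rule notI)
      assume "(x - of_int b' / ?c') * ?c \<in> \<int>"
      then have "(x - of_int b' / ?c') * ?c - (x - of_int b / ?c') * ?c \<in> \<int>" using b(2) by (rule Ints_diff)
      moreover have "(x - of_int b' / ?c') * ?c - (x - of_int b / ?c') * ?c = of_int (b - b') / of_nat (Q (Suc k))"
      proof -
        have "?c / ?c' = 1 / of_nat (Q (Suc k))" using c by (simp add: level_Suc[of Q "Suc k"])
        moreover have "(x - of_int b' / ?c') * ?c - (x - of_int b / ?c') * ?c = of_int (b - b') * (?c / ?c')"
          by (simp add: algebra_simps diff_divide_distrib)
        ultimately show ?thesis by simp
      qed
      ultimately obtain j where "of_int (b - b') / real (Q (Suc k)) = of_int j" by (auto elim: Ints_cases)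
      then have "real_of_int (b - b') = of_int (int (Q (Suc k)) * j)"
        using Q_ge_2[of "Suc k"] by (simp add: field_simps)
      then have "b - b' = int (Q (Suc k)) * j" by (simp only: of_int_eq_iff)
      then show False using distinct_D[of b "Suc k" b'] b(1) b' by simp
    qed
    then have "(\<Sum>b\<in>D (Suc k). measure ?F {x - of_int b / ?c'}) = measure ?F {x - of_int b / ?c'}"
      using b(1) finite_D by (subst sum.remove[of _ b]) auto
    then show ?thesis using Suc by simp
  next
    case False
    then have "(\<Sum>b\<in>D (Suc k). measure ?F {x - of_int b / ?c'}) = 0"
      using zero by (intro sum.neutral) auto
    then show ?thesis by simp
  qed
  finally have "measure (partial_conv (Suc k)) {x} \<le> 1 / ?c / card ?A"
    by (simp add: divide_right_mono)
  also have "card ?A = Q (Suc k)" by (simp only: card_image[OF inj] card_D)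
  also have "1 / ?c / Q (Suc k) = 1 / ?c'" by (simp add: level_Suc[of Q "Suc k"])
  finally show ?case .
qed

lemma measure_interval_le:
  assumes cd: "c \<le> d"
  shows "measure (moran Q D) {c..d} \<le> d - c"
proof (rule field_le_epsilon)
  fix e :: real assume e: "0 < e"
  define e2 where "e2 = e / 2"
  have e2: "0 < e2" "d - c + 2 * e2 = d - c + e" using e by (auto simp: e2_def)
  interpret real_distribution "moran Q D" by (rule real_distribution_moran)
  \<comment> \<open>A trapezoid that is 1 on \<open>{c..d}\<close> and 0 outside
    \<open>{c - e2<..d + e2}\<close>, an interval of length \<open>d - c + e\<close>.\<close>
  let ?f = "\<lambda>x. cts_step d (d + e2) x - cts_step (c - e2) c x"
  let ?F = "partial_conv"
  have "measure (moran Q D) {c..d} = (\<integral>x. indicator {c..d} x \<partial>moran Q D)" by simp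
  also have "\<dots> \<le> (\<integral>x. ?f x \<partial>moran Q D)"
  proof (rule integral_mono)
    show "indicator {c..d} x \<le> ?f x" for x
      using e2 cd by (auto simp: cts_step_def indicator_def divide_le_eq_1)
  qed (use e2 in \<open>auto intro!: Bochner_Integration.integrable_diff integrable_cts_step integrable_real_indicator
      simp: less_top[symmetric]\<close>)
  also have "\<dots> = integral\<^sup>L (moran Q D) (cts_step d (d + e2)) - integral\<^sup>L (moran Q D) (cts_step (c - e2) c)"
    using e2 by (intro Bochner_Integration.integral_diff integrable_cts_step) auto
  also have "\<dots> \<le> d - c + e"
  proof (rule LIMSEQ_le)
    show "(\<lambda>k. integral\<^sup>L (?F k) (cts_step d (d + e2)) - integral\<^sup>L (?F k) (cts_step (c - e2) c)) \<longlonglongrightarrow>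
        integral\<^sup>L (moran Q D) (cts_step d (d + e2)) - integral\<^sup>L (moran Q D) (cts_step (c - e2) c)"
      using e2 by (intro tendsto_diff cts_step_tendsto) auto
    have "(\<lambda>k. (d - c + 2 * e2) + (1 / 2) ^ Suc k) \<longlonglongrightarrow> (d - c + 2 * e2) + 0"
      by (intro tendsto_add tendsto_const LIMSEQ_Suc LIMSEQ_realpow_zero) auto
    then show "(\<lambda>k. (d - c + 2 * e2) + (1 / 2) ^ Suc k) \<longlonglongrightarrow> d - c + e" using e2(2) by simp
    have "integral\<^sup>L (?F k) (cts_step d (d + e2)) - integral\<^sup>L (?F k) (cts_step (c - e2) c) \<le>
        (d - c + 2 * e2) + (1 / 2) ^ Suc k" for k
    proof -
      interpret F: real_distribution "?F k" by (rule real_distribution_finite)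
      have "integral\<^sup>L (?F k) (cts_step d (d + e2)) - integral\<^sup>L (?F k) (cts_step (c - e2) c) = (\<integral>x. ?f x \<partial>?F k)"
        using e2 by (intro Bochner_Integration.integral_diff[symmetric] F.integrable_cts_step) auto
      also have "\<dots> \<le> (\<integral>x. indicator {c - e2<..d + e2} x \<partial>?F k)"
      proof (rule integral_mono)
        show "?f x \<le> indicator {c - e2<..d + e2} x" for x
          using e2 cd by (auto simp: cts_step_def indicator_def divide_le_eq_1)
      qed (use e2 in \<open>auto intro!: Bochner_Integration.integrable_diff F.integrable_cts_step integrable_real_indicator
        simp: less_top[symmetric]\<close>)
      also have "\<dots> = measure (?F k) {c - e2<..d + e2}" by simp
      also have "\<dots> \<le> (d + e2 - (c - e2)) + 1 / real (level Q (Suc k))"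
        using cd e2 level_pos AE_lattice atom_le real_distribution_finite
        by (intro measure_lattice_interval_le) auto
      also have "1 / real (level Q (Suc k)) \<le> (1 / 2) ^ Suc k"
        unfolding power_one_over by (rule frac_le[OF _ _ _ real_level_ge]) simp_all
      finally show ?thesis by simp
    qed
    then show "\<exists>K. \<forall>k\<ge>K. integral\<^sup>L (?F k) (cts_step d (d + e2)) - integral\<^sup>L (?F k) (cts_step (c - e2) c) \<le>
        (d - c + 2 * e2) + (1 / 2) ^ Suc k" by blast
  qed
  finally show "measure (moran Q D) {c..d} \<le> d - c + e" .
qed

end

text \<open>A Lebesgue null set inside an interval is covered by countably many closed intervals
  with disjoint interiors and total length at most \<open>e\<close>; the hypothesis bounds the mass
  of each by its length.\<close>

lemma measure_null_set_le:
  fixes M :: "real measure"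
  assumes "real_distribution M" and interval: "\<And>c d. c \<le> d \<Longrightarrow> measure M {c..d} \<le> d - c"
    and S: "S \<in> sets borel" "emeasure lborel S = 0" "S \<subseteq> {a..b}" and e: "0 < e"
  shows "measure M S \<le> e"
proof -
  interpret real_distribution M by fact
  have S0: "S \<in> lmeasurable" "measure lebesgue S = 0"
  proof -
    have "emeasure lebesgue S = 0" using S by simp
    then show "S \<in> lmeasurable" "measure lebesgue S = 0"
      using S(1) by (auto simp: fmeasurable_def measure_def)
  qed
  obtain \<D> where D: "countable \<D>" "\<And>K. K \<in> \<D> \<Longrightarrow> K \<subseteq> cbox a b \<and> K \<noteq> {} \<and> (\<exists>c d. K = cbox c d)"
    "pairwise (\<lambda>A B. interior A \<inter> interior B = {}) \<D>"
    "S \<subseteq> \<Union>\<D>" "\<Union>\<D> \<in> lmeasurable" "measure lebesgue (\<Union>\<D>) \<le> measure lebesgue S + e"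
    using measurable_outer_intervals_bounded[OF S0(1) _ e, of a b] S(3) by (metis interval_cbox)
  have Kb: "K \<in> sets borel" if "K \<in> \<D>" for K using D(2)[OF that] by auto
  have fin: "measure M (\<Union>\<F>) \<le> e" if F: "finite \<F>" "\<F> \<subseteq> \<D>" for \<F>
  proof -
    have "measure M (\<Union>\<F>) \<le> (\<Sum>K\<in>\<F>. measure M K)"
      using finite_measure_subadditive_finite[of \<F> "\<lambda>K. K"] F Kb by auto
    also have "\<dots> \<le> (\<Sum>K\<in>\<F>. measure lebesgue K)"
    proof (rule sum_mono)
      fix K assume "K \<in> \<F>"
      then have "K \<in> \<D>" using F(2) by blast
      from D(2)[OF this] obtain c d where "K = cbox c d" "K \<noteq> {}" by auto
      then have K: "K = {c..d}" "K \<noteq> {}" by (simp_all add: box_real)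
      then show "measure M K \<le> measure lebesgue K" using interval[of c d] by simp
    qed
    \<comment> \<open>Only the interiors are disjoint, but the overlaps of the intervals are
      negligible, so the lengths still add up.\<close>
    also have "\<dots> = measure lebesgue (\<Union>K\<in>\<F>. K)"
    proof (rule measure_negligible_finite_Union_image[symmetric])
      show "pairwise (\<lambda>x y. negligible (x \<inter> y)) \<F>"
      proof (rule pairwiseI)
        fix K K' assume K: "K \<in> \<F>" "K' \<in> \<F>" "K \<noteq> K'"
        then have KD: "K \<in> \<D>" "K' \<in> \<D>" using F(2) by auto
        from D(2)[OF KD(1)] D(2)[OF KD(2)] have "convex K" "convex K'" by auto
        moreover have "interior (K \<inter> K') = {}" using KD K(3) D(3) by (auto simp: pairwise_def interior_Int)
        ultimately show "negligible (K \<inter> K')" by (simp add: negligible_convex_interior convex_Int)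
      qed
      fix K assume "K \<in> \<F>"
      then have "K \<in> \<D>" using F(2) by blast
      from D(2)[OF this] show "K \<in> lmeasurable" by auto
    qed (fact F)
    also have "\<dots> \<le> measure lebesgue (\<Union>\<D>)"
      using F D by (intro measure_mono_fmeasurable) (auto intro: fmeasurableD)
    finally show ?thesis using D(6) S0(2) by simp
  qed
  show ?thesis
  proof (cases "\<D> = {}")
    case True
    then show ?thesis using D(4) e by auto
  next
    case False
    let ?g = "\<lambda>n. \<Union>(from_nat_into \<D> ` {..n})"
    have rg: "range (from_nat_into \<D>) = \<D>" using False D(1) by (rule range_from_nat_into)
    have "(\<lambda>n. measure M (?g n)) \<longlonglongrightarrow> measure M (\<Union>n. ?g n)"
    proof (rule finite_Lim_measure_incseq)
      show "range ?g \<subseteq> events" using Kb rg by (auto intro!: sets.finite_Union)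
      show "incseq ?g" by (intro incseq_SucI Union_mono image_mono) auto
    qed
    moreover have "(\<Union>n. ?g n) = \<Union>(range (from_nat_into \<D>))" by force
    ultimately have lim: "(\<lambda>n. measure M (?g n)) \<longlonglongrightarrow> measure M (\<Union>\<D>)" using rg by simp
    have "measure M (\<Union>\<D>) \<le> e"
      by (rule LIMSEQ_le_const2[OF lim]) (use fin rg in \<open>auto intro!: exI[of _ 0]\<close>)
    moreover have "measure M S \<le> measure M (\<Union>\<D>)"
      using D(1,4) Kb by (intro finite_measure_mono) (auto intro: sets.countable_Union)
    ultimately show ?thesis by linarith
  qed
qed

text \<open>A Lebesgue null set of mass 1 would be exhausted by bounded parts, whose masses tend to
  1 although each of them is at most 1/2.\<close>

lemma (in full_digit_system) moran_not_singular: "\<not> singular_to_lebesgue (moran Q D)"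
proof
  assume "singular_to_lebesgue (moran Q D)"
  then obtain A where A: "A \<in> sets borel" "emeasure (moran Q D) A = 0" "emeasure lborel (UNIV - A) = 0"
    by (auto simp: singular_to_lebesgue_def)
  interpret real_distribution "moran Q D" by (rule real_distribution_moran)
  let ?S = "\<lambda>n::nat. (UNIV - A) \<inter> {- real n..real n}"
  have "measure (moran Q D) A = 0" using A(2) by (simp add: measure_def)
  then have M1: "measure (moran Q D) (UNIV - A) = 1"
    using prob_compl[of A] A(1) by simp
  have small: "measure (moran Q D) (?S n) \<le> 1 / 2" for n
  proof (rule measure_null_set_le[OF real_distribution_moran measure_interval_le])
    have "emeasure lborel (?S n) \<le> emeasure lborel (UNIV - A)" using A(1) by (intro emeasure_mono) auto
    then show "emeasure lborel (?S n) = 0" using A(3) by simp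
  qed (use A(1) in auto)
  have "(\<lambda>n. measure (moran Q D) (?S n)) \<longlonglongrightarrow> measure (moran Q D) (\<Union>n. ?S n)"
    by (rule finite_Lim_measure_incseq) (use A(1) in \<open>auto simp: incseq_def\<close>)
  moreover have "(\<Union>n. ?S n) = UNIV - A"
  proof -
    have "\<exists>n. x \<in> {- real n..real n}" for x :: real
      using real_arch_simple[of "\<bar>x\<bar>"] by (auto simp: abs_le_iff) (metis minus_le_iff)
    then show ?thesis by blast
  qed
  ultimately have "(\<lambda>n. measure (moran Q D) (?S n)) \<longlonglongrightarrow> 1" using M1 by simp
  then have "1 \<le> (1 / 2 :: real)" by (rule LIMSEQ_le_const2) (use small in blast)
  then show False by simp
qed

section \<open>Random convolutions\<close>

lemma measurable_bernoulli_component: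
  "(\<lambda>\<omega>. \<omega> i) \<in> bernoulli_measure m p \<rightarrow>\<^sub>M count_space UNIV"
proof -
  have "(\<lambda>\<omega>. \<omega> i) \<in> bernoulli_measure m p \<rightarrow>\<^sub>M point_measure {1..m} (\<lambda>j. ennreal (p j))"
    unfolding bernoulli_measure_def by (rule measurable_component_singleton) simp
  moreover have "(\<lambda>x. x) \<in> point_measure {1..m} (\<lambda>j. ennreal (p j)) \<rightarrow>\<^sub>M count_space UNIV"
    by (simp add: point_measure_def)
  ultimately show ?thesis by (rule measurable_compose)
qed

text \<open>\<open>f\<close> factors through the list of the first \<open>k + 1\<close> letters, and
  on the countable type of such lists every function is measurable.\<close>

lemma measurable_bernoulli_prefix:
  assumes "\<And>\<omega> \<omega>'. (\<And>i. i \<le> k \<Longrightarrow> \<omega> i = \<omega>' i) \<Longrightarrow> f \<omega> = f \<omega>'"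
  shows "f \<in> bernoulli_measure m p \<rightarrow>\<^sub>M (borel :: real measure)"
proof -
  note measurable_bernoulli_component [measurable]
  let ?pre = "\<lambda>\<omega>. map \<omega> [0..<Suc k]"
  have "?pre \<in> bernoulli_measure m p \<rightarrow>\<^sub>M count_space UNIV"
  proof (subst measurable_count_space_eq_countable)
    have "?pre -` {l} \<inter> space (bernoulli_measure m p) \<in> sets (bernoulli_measure m p)" for l
    proof -
      have eq: "?pre -` {l} \<inter> space (bernoulli_measure m p) =
          (if length l = Suc k then {\<omega> \<in> space (bernoulli_measure m p). \<forall>i\<in>{..k}. \<omega> i = l ! i} else {})"
      proof -
        have "?pre \<omega> = l \<longleftrightarrow> length l = Suc k \<and> (\<forall>i\<in>{..k}. \<omega> i = l ! i)" for \<omega>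
        proof
          assume "?pre \<omega> = l"
          then show "length l = Suc k \<and> (\<forall>i\<in>{..k}. \<omega> i = l ! i)" by (auto simp del: upt_Suc)
        next
          assume "length l = Suc k \<and> (\<forall>i\<in>{..k}. \<omega> i = l ! i)"
          then show "?pre \<omega> = l" by (intro nth_equalityI) (auto simp del: upt_Suc)
        qed
        then show ?thesis by (simp add: set_eq_iff vimage_def conj_commute del: upt_Suc)
      qed
      have "{\<omega> \<in> space (bernoulli_measure m p). \<forall>i\<in>{..k}. \<omega> i = l ! i} \<in> sets (bernoulli_measure m p)"
        by measurable
      then show ?thesis unfolding eq by simp
    qed
    then show "?pre \<in> space (bernoulli_measure m p) \<rightarrow> UNIV \<and>
        (\<forall>l\<in>UNIV. ?pre -` {l} \<inter> space (bernoulli_measure m p) \<in> sets (bernoulli_measure m p))" by simp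
  qed simp
  then have "(\<lambda>\<omega>. (\<lambda>l. f (\<lambda>i. l ! i)) (?pre \<omega>)) \<in> bernoulli_measure m p \<rightarrow>\<^sub>M borel"
    by (rule measurable_compose) simp
  moreover have "(\<lambda>l. f (\<lambda>i. l ! i)) (?pre \<omega>) = f \<omega>" for \<omega>
    by (rule assms) (simp add: nth_append less_Suc_eq_le del: upt_Suc)
  ultimately show ?thesis by simp
qed

lemma finite_convolution_cong:
  "(\<And>i. i \<le> k \<Longrightarrow> \<nu> i = \<nu>' i) \<Longrightarrow> finite_convolution \<nu> k = finite_convolution \<nu>' k"
  by (induction k) auto

lemma moran_factor_cong:
  assumes "\<And>i. i \<le> k \<Longrightarrow> Q i = Q' i" "D k = D' k"
  shows "moran_factor Q D k = moran_factor Q' D' k"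
proof -
  have "level Q (Suc k) = level Q' (Suc k)" unfolding level_def using assms(1) by (intro prod.cong) auto
  then show ?thesis using assms(2) by (simp add: moran_factor_def)
qed

lemma random_convolution_eq_moran:
  "random_convolution N B n \<omega> = moran (\<lambda>i. N (\<omega> i) ^ n i) (\<lambda>i. B (\<omega> i))"
proof -
  have "(\<Prod>i\<le>k. inverse (real (N (\<omega> i)) ^ n i)) * of_int b = of_int b / real (level (\<lambda>i. N (\<omega> i) ^ n i) (Suc k))" for k b
    by (simp add: level_def lessThan_Suc_atMost prod_inversef[symmetric] divide_inverse mult.commute)
  then show ?thesis unfolding random_convolution_def moran_def moran_factor_def[abs_def] by simp
qed

text \<open>Integrals of \<open>cts_step\<close> are limits of functions of finitely many letters.
  By right continuity the distribution function is a limit of such integrals, and half-lines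
  generate the Borel sets.\<close>

lemma random_measure_moran:
  assumes ds: "\<And>\<omega>. \<omega> \<in> space (bernoulli_measure m p) \<Longrightarrow> digit_system (\<lambda>i. N (\<omega> i) ^ n i) (\<lambda>i. B (\<omega> i)) R"
  shows "random_measure (bernoulli_measure m p) (random_convolution N B n)"
proof -
  let ?P = "bernoulli_measure m p" and ?Q = "\<lambda>\<omega> i. N (\<omega> i) ^ n i" and ?D = "\<lambda>\<omega> i. B (\<omega> i)"
  let ?M = "\<lambda>\<omega>. moran (?Q \<omega>) (?D \<omega>)"
  have rd: "real_distribution (?M \<omega>)" if "\<omega> \<in> space ?P" for \<omega>
    by (rule digit_system.real_distribution_moran[OF ds[OF that]])
  have sets: "sets (?M \<omega>) = sets borel" if "\<omega> \<in> space ?P" for \<omega>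
    using rd[OF that] by (simp add: real_distribution_def real_distribution_axioms_def)
  have step: "(\<lambda>\<omega>. integral\<^sup>L (?M \<omega>) (cts_step x y)) \<in> borel_measurable ?P" if xy: "x < y" for x y
  proof (rule borel_measurable_LIMSEQ_real)
    show "(\<lambda>k. integral\<^sup>L (finite_convolution (moran_factor (?Q \<omega>) (?D \<omega>)) k) (cts_step x y)) \<longlonglongrightarrow>
        integral\<^sup>L (?M \<omega>) (cts_step x y)" if "\<omega> \<in> space ?P" for \<omega>
      by (rule digit_system.cts_step_tendsto[OF ds[OF that] xy])
    show "(\<lambda>\<omega>. integral\<^sup>L (finite_convolution (moran_factor (?Q \<omega>) (?D \<omega>)) k) (cts_step x y)) \<in> borel_measurable ?P" for k
    proof (rule measurable_bernoulli_prefix)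
      fix \<omega> \<omega>' :: "nat \<Rightarrow> nat" assume eq: "\<And>i. i \<le> k \<Longrightarrow> \<omega> i = \<omega>' i"
      have "finite_convolution (moran_factor (?Q \<omega>) (?D \<omega>)) k = finite_convolution (moran_factor (?Q \<omega>') (?D \<omega>')) k"
        using eq by (intro finite_convolution_cong moran_factor_cong) auto
      then show "integral\<^sup>L (finite_convolution (moran_factor (?Q \<omega>) (?D \<omega>)) k) (cts_step x y) =
          integral\<^sup>L (finite_convolution (moran_factor (?Q \<omega>') (?D \<omega>')) k) (cts_step x y)" by simp
    qed
  qed
  have cdf: "(\<lambda>\<omega>. cdf (?M \<omega>) a) \<in> borel_measurable ?P" for a
  proof (rule borel_measurable_LIMSEQ_real)
    fix \<omega> assume "\<omega> \<in> space ?P"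
    then interpret real_distribution "?M \<omega>" by (rule rd)
    have "((\<lambda>y. cdf (?M \<omega>) y) \<longlongrightarrow> cdf (?M \<omega>) a) (at_right a)"
      using cdf_is_right_cont by (simp add: continuous_within)
    moreover have "filterlim (\<lambda>j. a + 1 / real (Suc j)) (at_right a) sequentially"
    proof (rule filterlim_at_withinI)
      have "(\<lambda>j. a + 1 / real (Suc j)) \<longlonglongrightarrow> a + 0"
        by (intro tendsto_add tendsto_const LIMSEQ_Suc lim_1_over_n)
      then show "(\<lambda>j. a + 1 / real (Suc j)) \<longlonglongrightarrow> a" by simp
    qed simp
    ultimately have upper: "(\<lambda>j. cdf (?M \<omega>) (a + 1 / real (Suc j))) \<longlonglongrightarrow> cdf (?M \<omega>) a"
      by (rule filterlim_compose)
    show "(\<lambda>j. integral\<^sup>L (?M \<omega>) (cts_step a (a + 1 / real (Suc j)))) \<longlonglongrightarrow> cdf (?M \<omega>) a"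
    proof (rule tendsto_sandwich[OF _ _ tendsto_const upper])
      show "\<forall>\<^sub>F j in sequentially. cdf (?M \<omega>) a \<le> integral\<^sup>L (?M \<omega>) (cts_step a (a + 1 / real (Suc j)))"
        by (intro always_eventually allI cdf_cts_step(1)) simp
      show "\<forall>\<^sub>F j in sequentially. integral\<^sup>L (?M \<omega>) (cts_step a (a + 1 / real (Suc j))) \<le> cdf (?M \<omega>) (a + 1 / real (Suc j))"
        by (intro always_eventually allI cdf_cts_step(2)) simp
    qed
  qed (intro step, simp)
  have "?M \<in> ?P \<rightarrow>\<^sub>M prob_algebra borel"
  proof (rule measurable_prob_algebra_generated[where G = "range (\<lambda>a::real. {..a})" and \<Omega> = UNIV])
    show "sets borel = sigma_sets UNIV (range (\<lambda>a::real. {..a}))" by (simp add: borel_eq_atMost)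
    show "Int_stable (range (\<lambda>a::real. {..a}))"
    proof (rule Int_stableI)
      fix X Y assume "X \<in> range (\<lambda>a::real. {..a})" "Y \<in> range (\<lambda>a::real. {..a})"
      then obtain a b where "X = {..a}" "Y = {..b}" by auto
      then have "X \<inter> Y = {..min a b}" by auto
      then show "X \<inter> Y \<in> range (\<lambda>a. {..a})" by auto
    qed
    show "prob_space (?M \<omega>)" if "\<omega> \<in> space ?P" for \<omega> using rd[OF that] by (simp add: real_distribution_def)
    show "sets (?M \<omega>) = sets borel" if "\<omega> \<in> space ?P" for \<omega> by (rule sets[OF that])
    fix A assume "A \<in> range (\<lambda>a::real. {..a})"
    then obtain a where A: "A = {..a}" by auto
    have "(\<lambda>\<omega>. ennreal (cdf (?M \<omega>) a)) \<in> borel_measurable ?P" using cdf[of a] by measurable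
    moreover have "emeasure (?M \<omega>) A = ennreal (cdf (?M \<omega>) a)" if "\<omega> \<in> space ?P" for \<omega>
    proof -
      interpret real_distribution "?M \<omega>" by (rule rd[OF that])
      show ?thesis unfolding A cdf_def by (rule emeasure_eq_measure)
    qed
    ultimately show "(\<lambda>\<omega>. emeasure (?M \<omega>) A) \<in> borel_measurable ?P" by (simp cong: measurable_cong)
  qed simp
  then have kernel: "?M \<in> ?P \<rightarrow>\<^sub>M subprob_algebra borel" by (rule measurable_prob_algebraD)
  show ?thesis
    unfolding random_measure_def random_convolution_eq_moran
    using sets measurable_emeasure_subprob_algebra[THEN measurable_compose[OF kernel]] by blast
qed

section \<open>Almost sure recurrence of blocks in Bernoulli sequences\<close>

lemma prob_space_letters:
  fixes m :: nat
  assumes p: "\<And>j. j \<in> {1..m} \<Longrightarrow> 0 \<le> p j" "(\<Sum>j=1..m. p j) = 1"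
  shows "prob_space (point_measure {1..m} (\<lambda>j. ennreal (p j)))" (is "prob_space ?Q")
proof (rule prob_spaceI)
  show "emeasure ?Q (space ?Q) = 1"
    using p(2) sum_ennreal[of "{1..m}" p, OF p(1)]
    by (simp add: space_point_measure emeasure_point_measure_finite)
qed

text \<open>If \<open>U\<close> is the event that a block of \<open>J\<close> equal letters never occurs, then removing the first \<open>J\<close>
  letters shows \<open>P U \<le> (1 - c) P U\<close>, where \<open>c > 0\<close> is the probability of the block.\<close>

lemma AE_bernoulli_blocks:
  assumes p: "\<And>j. j \<in> {1..m} \<Longrightarrow> 0 \<le> p j" "(\<Sum>j=1..m. p j) = 1" and a: "a \<in> {1..m}" "0 < p a"
  shows "AE \<omega> in bernoulli_measure m p. \<forall>J K. \<exists>k\<ge>K. \<forall>i<J. \<omega> (k + i) = a"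
proof -
  let ?S = "bernoulli_measure m p" and ?Q = "point_measure {1..m} (\<lambda>j. ennreal (p j))"
  note measurable_bernoulli_component [measurable]
  have Q: "prob_space ?Q" by (rule prob_space_letters) (use p in auto)
  interpret SS: sequence_space ?Q
    unfolding sequence_space_def by (rule product_prob_spaceI[OF Q])
  interpret S: prob_space ?S by (rule emeasure_bernoulli_cylinder(1)[OF p, where k = 0]) auto
  interpret SS2: pair_prob_space ?S ?S ..
  have comb: "(\<lambda>(\<omega>, \<omega>'). comb_seq i \<omega> \<omega>') \<in> ?S \<Otimes>\<^sub>M ?S \<rightarrow>\<^sub>M ?S" for i
    unfolding bernoulli_measure_def by (rule measurable_comb_seq)
  \<comment> \<open>Putting the first \<open>i\<close> letters of one Bernoulli sequence in front of
    an independent second one gives a Bernoulli sequence again; so an event that constrains both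
    parts obeys a product bound.\<close>
  have split: "measure ?S A \<le> measure ?S X * measure ?S Y"
    if A: "A \<in> sets ?S" and XY: "X \<in> sets ?S" "Y \<in> sets ?S"
      and sub: "\<And>\<omega> \<omega>'. \<omega> \<in> space ?S \<Longrightarrow> \<omega>' \<in> space ?S \<Longrightarrow> comb_seq i \<omega> \<omega>' \<in> A \<Longrightarrow> \<omega> \<in> X \<and> \<omega>' \<in> Y"
    for A X Y i
  proof -
    have "measure ?S A = measure (distr (?S \<Otimes>\<^sub>M ?S) ?S (\<lambda>(\<omega>, \<omega>'). comb_seq i \<omega> \<omega>')) A"
      using SS.PiM_comb_seq[of i] unfolding bernoulli_measure_def by simp
    also have "\<dots> = measure (?S \<Otimes>\<^sub>M ?S) ((\<lambda>(\<omega>, \<omega>'). comb_seq i \<omega> \<omega>') -` A \<inter> space (?S \<Otimes>\<^sub>M ?S))"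
      by (rule measure_distr[OF comb A])
    also have "\<dots> \<le> measure (?S \<Otimes>\<^sub>M ?S) (X \<times> Y)"
      using XY sub by (intro SS2.finite_measure_mono) (auto simp: space_pair_measure)
    also have "\<dots> = measure ?S X * measure ?S Y"
      using XY by (simp add: measure_def S.emeasure_pair_measure_Times enn2real_mult)
    finally show ?thesis .
  qed
  have "AE \<omega> in ?S. \<exists>k\<ge>K. \<forall>i<J. \<omega> (k + i) = a" for J K
  proof -
    define U where "U = {\<omega> \<in> space ?S. \<forall>k. \<exists>i\<in>{..<J}. \<omega> (k + i) \<noteq> a}"
    define UK where "UK = {\<omega> \<in> space ?S. \<forall>k\<in>{K..}. \<exists>i\<in>{..<J}. \<omega> (k + i) \<noteq> a}"
    define C where "C = {\<omega> \<in> space ?S. \<forall>i\<in>{..<J}. \<omega> i = a}"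
    have sets: "U \<in> sets ?S" "UK \<in> sets ?S" "C \<in> sets ?S"
      unfolding U_def UK_def C_def by measurable
    have shiftU: "comb_seq i \<omega> \<omega>' (i + j) = \<omega>' j" for i j \<omega> \<omega>' by (simp add: comb_seq_def)
    have "emeasure ?S C = ennreal (\<Prod>i<J. p a)"
      using emeasure_bernoulli_cylinder(2)[OF p, where k = J and \<alpha> = "\<lambda>_. a"] a by (simp add: C_def Ball_def)
    then have "measure ?S C = p a ^ J" using a by (simp add: measure_def)
    then have Cpos: "0 < measure ?S C" using a by simp
    \<comment> \<open>A sequence without the block does not begin with it, and its shift by
      \<open>J\<close> letters has no block either.\<close>
    have "measure ?S U \<le> measure ?S (space ?S - C) * measure ?S U"
    proof (rule split[of U "space ?S - C" U J])
      fix \<omega> \<omega>' assume w: "\<omega> \<in> space ?S" "\<omega>' \<in> space ?S" "comb_seq J \<omega> \<omega>' \<in> U"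
      then have *: "\<exists>i\<in>{..<J}. comb_seq J \<omega> \<omega>' (k + i) \<noteq> a" for k by (simp add: U_def)
      obtain i where "i < J" "comb_seq J \<omega> \<omega>' i \<noteq> a" using *[of 0] by auto
      then have "\<omega> \<notin> C" by (auto simp: C_def comb_seq_def)
      moreover have "\<exists>i\<in>{..<J}. \<omega>' (k + i) \<noteq> a" for k
        using *[of "J + k"] by (simp only: add.assoc shiftU)
      ultimately show "\<omega> \<in> space ?S - C \<and> \<omega>' \<in> U" using w by (simp add: U_def)
    qed (use sets in auto)
    also have "measure ?S (space ?S - C) = 1 - measure ?S C" using S.prob_compl[OF sets(3)] .
    finally have "measure ?S C * measure ?S U \<le> 0" by (simp add: algebra_simps)
    then have U0: "measure ?S U = 0" using Cpos by (simp add: mult_le_0_iff order_antisym)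
    \<comment> \<open>Dropping the first \<open>K\<close> letters turns absence of the block from
      \<open>K\<close> on into absence altogether.\<close>
    have "measure ?S UK \<le> measure ?S (space ?S) * measure ?S U"
    proof (rule split[of UK "space ?S" U K])
      fix \<omega> \<omega>' assume w: "\<omega> \<in> space ?S" "\<omega>' \<in> space ?S" "comb_seq K \<omega> \<omega>' \<in> UK"
      have "\<exists>i\<in>{..<J}. \<omega>' (k + i) \<noteq> a" for k
      proof -
        have "\<exists>i\<in>{..<J}. comb_seq K \<omega> \<omega>' (K + k + i) \<noteq> a" using w by (simp add: UK_def)
        then show ?thesis by (simp only: add.assoc shiftU)
      qed
      then show "\<omega> \<in> space ?S \<and> \<omega>' \<in> U" using w by (simp add: U_def)
    qed (use sets in auto)
    then have "measure ?S UK = 0" using U0 by (simp add: order_antisym)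
    then have "AE \<omega> in ?S. \<omega> \<notin> UK" using S.prob_eq_0[OF sets(2)] by simp
    then show ?thesis
    proof (rule AE_mp, intro AE_I2 impI)
      fix \<omega> assume "\<omega> \<in> space ?S" "\<omega> \<notin> UK"
      then show "\<exists>k\<ge>K. \<forall>i<J. \<omega> (k + i) = a" by (auto simp: UK_def)
    qed
  qed
  then show ?thesis unfolding AE_all_countable by blast
qed

lemma AE_bernoulli_positive:
  assumes p: "\<And>j. j \<in> {1..m} \<Longrightarrow> 0 \<le> p j" "(\<Sum>j=1..m. p j) = 1"
  shows "AE \<omega> in bernoulli_measure m p. \<forall>i. \<omega> i \<in> {1..m} \<and> 0 < p (\<omega> i)"
proof -
  let ?Q = "point_measure {1..m} (\<lambda>j. ennreal (p j))"
  have Q: "prob_space ?Q" by (rule prob_space_letters) (use p in auto)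
  have "AE j in ?Q. j \<in> {1..m} \<and> 0 < p j" by (auto simp: AE_point_measure)
  then have "AE \<omega> in bernoulli_measure m p. \<omega> i \<in> {1..m} \<and> 0 < p (\<omega> i)" for i
    unfolding bernoulli_measure_def by (intro AE_PiM_component Q) auto
  then show ?thesis unfolding AE_all_countable by blast
qed

section \<open>Translates of spectra and the conclusion\<close>

lemma (in digit_system) is_spectrum_translate:
  fixes \<Lambda> :: "int set"
  assumes t: "0 < t" and \<Lambda>: "parseval_set t \<Lambda>"
  shows "is_spectrum (moran Q D) ((\<lambda>x. real t * x) ` (\<lambda>v. of_int v + a) ` \<Lambda>)"
proof -
  interpret real_distribution "moran Q D" by (rule real_distribution_moran)
  let ?g = "\<lambda>v. real t * (real_of_int v + a)"
  have "is_spectrum (moran Q D) (?g ` \<Lambda>)"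
  proof (rule is_spectrumI)
    show "countable (?g ` \<Lambda>)" by simp
    fix l l' assume "l \<in> ?g ` \<Lambda>" "l' \<in> ?g ` \<Lambda>" "l \<noteq> l'"
    then obtain v v' where v: "v \<in> \<Lambda>" "v' \<in> \<Lambda>" "v \<noteq> v'" "l = ?g v" "l' = ?g v'" by auto
    have "l - l' = of_int (int t * (v - v'))" by (simp add: v algebra_simps)
    then show "fourier (moran Q D) (l - l') = 0" using \<Lambda> v by simp
  next
    fix \<xi> \<eta> :: real assume "0 < \<eta>"
    then obtain F where F: "finite F" "F \<subseteq> \<Lambda>"
      "1 - \<eta> < (\<Sum>v\<in>F. (norm (fourier (moran Q D) ((\<xi> - t * a) - of_int (int t * v))))\<^sup>2)"
      using \<Lambda> by blast
    have inj: "inj_on ?g F" using t by (auto intro: inj_onI)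
    \<comment> \<open>The translation is absorbed into \<open>\<xi>\<close>, as Parseval holds at
      every frequency.\<close>
    have "\<xi> - ?g v = (\<xi> - t * a) - of_int (int t * v)" for v by (simp add: algebra_simps)
    then have "(\<Sum>l\<in>?g ` F. (norm (fourier (moran Q D) (\<xi> - l)))\<^sup>2) =
        (\<Sum>v\<in>F. (norm (fourier (moran Q D) ((\<xi> - t * a) - of_int (int t * v))))\<^sup>2)"
      unfolding sum.reindex[OF inj] o_def by (simp only:)
    then show "\<exists>F. finite F \<and> F \<subseteq> ?g ` \<Lambda> \<and> 1 - \<eta> < (\<Sum>l\<in>F. (norm (fourier (moran Q D) (\<xi> - l)))\<^sup>2)"
      using F by (intro exI[of _ "?g ` F"]) auto
  qed
  then show ?thesis by (simp add: image_image)
qed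

text \<open>Different \<open>a\<close> may give the same translate. But countably many translates
  would contain only countably many points altogether, while every real \<open>a\<close> equals such
  a point minus \<open>f v0\<close>.\<close>

lemma uncountable_translates:
  assumes "countable S" "S \<noteq> {}"
  shows "uncountable (range (\<lambda>a::real. (\<lambda>v. f v + a) ` S))"
proof
  let ?T = "\<lambda>a::real. (\<lambda>v. f v + a) ` S"
  assume c: "countable (range ?T)"
  obtain v0 where v0: "v0 \<in> S" using assms(2) by blast
  have "UNIV \<subseteq> (\<Union>X\<in>range ?T. (\<lambda>x. x - f v0) ` X)"
  proof
    fix a :: real
    have "a = (f v0 + a) - f v0" by simp
    moreover have "f v0 + a \<in> ?T a" using v0 by blast
    ultimately show "a \<in> (\<Union>X\<in>range ?T. (\<lambda>x. x - f v0) ` X)" by blast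
  qed
  moreover have "countable (\<Union>X\<in>range ?T. (\<lambda>x. x - f v0) ` X)"
    using c assms(1) by (intro countable_UN) auto
  ultimately have "countable (UNIV :: real set)" by (rule countable_subset)
  then show False using uncountable_UNIV_real by blast
qed

lemma (in spectral_digit_system) spectra_of_moran:
  assumes one: "1 \<in> T" and equi: "\<And>t. t \<in> T \<Longrightarrow> \<exists>\<epsilon>>0. \<forall>K. \<exists>k\<ge>K. equi_positive (tail k) t \<epsilon>"
  shows "spectral_measure (moran Q D)"
    and "uncountable {\<Lambda> :: real set. \<forall>t\<in>real ` T. is_spectrum (moran Q D) ((\<lambda>x. t * x) ` \<Lambda>)}"
proof -
  have "\<exists>\<Lambda>. \<forall>t\<in>T. parseval_set t \<Lambda>" by (rule ex_spectrum) (rule equi)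
  then obtain \<Lambda> where \<Lambda>: "\<forall>t\<in>T. parseval_set t \<Lambda>" by (elim exE) (rule that)
  have spec: "is_spectrum (moran Q D) ((\<lambda>x. real t * x) ` (\<lambda>v. of_int v + a) ` \<Lambda>)" if "t \<in> T" for t a
    using \<Lambda> that T_pos[OF that] by (intro is_spectrum_translate) auto
  show "spectral_measure (moran Q D)"
    using spec[OF one, of 0] real_distribution_moran by (auto simp: spectral_measure_def)
  \<comment> \<open>Parseval with defect 1/2 at frequency 0 forces a nonempty
    \<open>F\<close>.\<close>
  have "\<exists>F. finite F \<and> F \<subseteq> \<Lambda> \<and> 1 - 1 / 2 < (\<Sum>v\<in>F. (norm (fourier (moran Q D) (0 - of_int (int 1 * v))))\<^sup>2)"
    using \<Lambda> one by (metis zero_less_divide_1_iff zero_less_numeral)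
  then have "\<Lambda> \<noteq> {}" by auto
  then have "uncountable (range (\<lambda>a::real. (\<lambda>v. of_int v + a) ` \<Lambda>))"
    by (intro uncountable_translates) auto
  moreover have "range (\<lambda>a::real. (\<lambda>v. of_int v + a) ` \<Lambda>) \<subseteq>
      {\<Lambda>. \<forall>t\<in>real ` T. is_spectrum (moran Q D) ((\<lambda>x. t * x) ` \<Lambda>)}"
    using spec by auto
  ultimately show "uncountable {\<Lambda> :: real set. \<forall>t\<in>real ` T. is_spectrum (moran Q D) ((\<lambda>x. t * x) ` \<Lambda>)}"
    using countable_subset by blast
qed

theorem theorem1p8:
  fixes m :: nat and N :: "nat \<Rightarrow> nat" and B :: "nat \<Rightarrow> int set"
    and n :: "nat \<Rightarrow> nat" and p :: "nat \<Rightarrow> real"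
  assumes "\<forall>k\<in>{1..m}. admissible_pair (N k) (B k)"
    and "\<forall>i. 0 < n i"
    and "\<forall>j\<in>{1..m}. 0 \<le> p j"
    and "(\<Sum>j=1..m. p j) = 1"
    and "AE \<omega> in bernoulli_measure m p. singular_to_lebesgue (random_convolution N B (\<lambda>_. 1) \<omega>)"
  shows "spectral_random_measure (bernoulli_measure m p) (random_convolution N B n) \<and>
    aleph1_spectral_eigen_set (bernoulli_measure m p) (random_convolution N B n)
      (real ` coprime_naturals m N)"
proof -
  let ?P = "bernoulli_measure m p" and ?T = "coprime_naturals m N"
  have p: "\<And>j. j \<in> {1..m} \<Longrightarrow> 0 \<le> p j" "(\<Sum>j=1..m. p j) = 1" using assms(3,4) by auto
  interpret P: prob_space ?P by (rule emeasure_bernoulli_cylinder(1)[OF p, where k = 0]) auto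
  have "\<forall>k\<in>{1..m}. \<exists>L. hadamard (N k) (B k) L \<and> 0 \<in> L"
    using assms(1) admissible_pair_hadamard by metis
  then obtain L where L: "\<And>k. k \<in> {1..m} \<Longrightarrow> hadamard (N k) (B k) (L k) \<and> 0 \<in> L k" by metis
  have N2: "2 \<le> N k" if "k \<in> {1..m}" for k using assms(1) that by (simp add: admissible_pair_def)
  have B: "finite (B k)" "B k \<noteq> {}" if "k \<in> {1..m}" for k
    using L[OF that] by (auto simp: hadamard_def)
  have distinct: "\<not> int (N k) dvd b - b'" if "k \<in> {1..m}" "b \<in> B k" "b' \<in> B k" "b \<noteq> b'" for k b b'
    using hadamard_digits_distinct L[OF that(1)] that by blast
  \<comment> \<open>A crude bound for the digits of all letters; its uniformity in
    \<open>\<omega>\<close> is what matters.\<close>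
  define R where "R = (\<Sum>k=1..m. \<Sum>b\<in>B k. \<bar>real_of_int b\<bar>)"
  have R: "\<bar>real_of_int b\<bar> \<le> R" if "k \<in> {1..m}" "b \<in> B k" for k b
  proof -
    have "\<bar>real_of_int b\<bar> \<le> (\<Sum>b\<in>B k. \<bar>real_of_int b\<bar>)"
      by (rule member_le_sum[OF that(2)]) (use B that in auto)
    also have "\<dots> \<le> R" unfolding R_def
      by (rule member_le_sum[OF that(1)]) (auto intro: sum_nonneg)
    finally show ?thesis .
  qed
  have R0: "0 \<le> R" unfolding R_def by (intro sum_nonneg) auto
  have ds: "digit_system (\<lambda>i. N (\<omega> i) ^ e i) (\<lambda>i. B (\<omega> i)) R"
    if \<omega>: "\<And>i. \<omega> i \<in> {1..m}" and e: "\<And>i. 0 < e i" for \<omega> e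
  proof
    fix i
    have "2 \<le> N (\<omega> i)" by (rule N2[OF \<omega>])
    also have "\<dots> \<le> N (\<omega> i) ^ e i" using calculation e by (intro self_le_power) auto
    finally show "2 \<le> N (\<omega> i) ^ e i" .
    show "finite (B (\<omega> i))" "B (\<omega> i) \<noteq> {}" by (rule B[OF \<omega>])+
    show "\<bar>real_of_int b\<bar> \<le> R" if "b \<in> B (\<omega> i)" for b by (rule R[OF \<omega> that])
  qed
  have space: "\<omega> i \<in> {1..m}" if "\<omega> \<in> space ?P" for \<omega> i using that by (simp add: space_bernoulli_measure)
  \<comment> \<open>Singularity is known for exponents 1, where \<open>card (B a) = N a\<close> for
    all letters that occur would give a full digit system. The letter found serves for all
    exponents, as \<open>N a\<close> is only the base of the scales.\<close>
  have "\<exists>a\<in>{1..m}. 0 < p a \<and> card (B a) < N a"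
  proof (rule ccontr)
    assume "\<not> ?thesis"
    then have full: "card (B a) = N a" if "a \<in> {1..m}" "0 < p a" for a
      using that card_digits_le[of "N a" "B a"] N2[of a] B[of a] distinct[of a]
      by (metis le_antisym not_le pos2 order_less_le_trans)
    have pos: "AE \<omega> in ?P. \<forall>i. \<omega> i \<in> {1..m} \<and> 0 < p (\<omega> i)"
      by (rule AE_bernoulli_positive) (use p in auto)
    have "AE \<omega> in ?P. False"
      using assms(5) pos
    proof eventually_elim
      case (elim \<omega>)
      then have \<omega>: "\<And>i. \<omega> i \<in> {1..m}" "\<And>i. 0 < p (\<omega> i)" by auto
      have "full_digit_system (\<lambda>i. N (\<omega> i) ^ 1) (\<lambda>i. B (\<omega> i)) R"
        using ds[of \<omega> "\<lambda>_. 1"] \<omega> full distinct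
        by (auto simp: full_digit_system_def full_digit_system_axioms_def)
      from full_digit_system.moran_not_singular[OF this] elim(1)
      show False by (simp add: random_convolution_eq_moran)
    qed
    then show False by simp
  qed
  then obtain a where a: "a \<in> {1..m}" "0 < p a" "card (B a) < N a" by blast
  have one: "1 \<in> ?T" by (simp add: coprime_naturals_def)
  have blocks: "AE \<omega> in ?P. \<forall>J K. \<exists>k\<ge>K. \<forall>i<J. \<omega> (k + i) = a"
    by (rule AE_bernoulli_blocks) (use p a in auto)
  have good: "AE \<omega> in ?P. spectral_measure (random_convolution N B n \<omega>) \<and>
      uncountable {\<Lambda> :: real set. \<forall>t\<in>real ` ?T. is_spectrum (random_convolution N B n \<omega>) ((\<lambda>x. t * x) ` \<Lambda>)}"
    using blocks AE_space
  proof eventually_elim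
    case (elim \<omega>)
    let ?Q = "\<lambda>i. N (\<omega> i) ^ n i" and ?D = "\<lambda>i. B (\<omega> i)"
    have \<omega>: "\<omega> i \<in> {1..m}" for i by (rule space[OF elim(2)])
    interpret digit_system ?Q ?D R using \<omega> assms(2) by (intro ds) auto
    interpret spectral_digit_system ?Q ?D R "\<lambda>i. (\<lambda>l. int (N (\<omega> i)) ^ (n i - 1) * l) ` L (\<omega> i)" ?T
    proof
      show "hadamard (?Q i) (?D i) ((\<lambda>l. int (N (\<omega> i)) ^ (n i - 1) * l) ` L (\<omega> i))" for i
        using L[OF \<omega>] assms(2) by (intro hadamard_power) auto
      show "0 \<in> (\<lambda>l. int (N (\<omega> i)) ^ (n i - 1) * l) ` L (\<omega> i)" for i
        using L[OF \<omega>] by (intro image_eqI[of _ _ 0]) auto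
      show "coprime t (?Q i)" if "t \<in> ?T" for t i
      proof -
        have "coprime t (N (\<omega> i))" using that \<omega>[of i] by (simp add: coprime_naturals_def coprime_iff_gcd_eq_1)
        then show ?thesis by simp
      qed
    qed (use one in \<open>auto simp: coprime_naturals_def\<close>)
    have equi: "\<exists>\<epsilon>>0. \<forall>K. \<exists>k\<ge>K. equi_positive (tail k) t \<epsilon>"
      if t: "t \<in> ?T" for t
    proof -
      have t0: "0 < t" and tc: "coprime t (N a)" using t a(1) by (auto simp: coprime_naturals_def coprime_iff_gcd_eq_1)
      \<comment> \<open>\<open>J\<close> and \<open>\<epsilon>\<close> depend on \<open>t\<close>,
        on the letter \<open>a\<close> and on \<open>R\<close>, but neither on the position of the
        block nor on the exponents inside it, so every occurrence of the block can be used.\<close>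
      have "\<exists>J \<epsilon>. 0 < \<epsilon> \<and> (\<forall>Q D. digit_system Q D R \<longrightarrow>
        (\<forall>i<J. \<exists>e>0. Q i = N a ^ e \<and> D i = B a) \<longrightarrow>
        (equi_positive (moran Q D) t \<epsilon>))"
        by (rule block_lower_bound[OF N2[OF a(1)] B[OF a(1)] a(3) t0 tc R0])
          (rule distinct[OF a(1)]; assumption)
      then obtain J \<epsilon> where \<epsilon>: "0 < \<epsilon>" and bound: "\<forall>Q D. digit_system Q D R \<longrightarrow>
        (\<forall>i<J. \<exists>e>0. Q i = N a ^ e \<and> D i = B a) \<longrightarrow>
        (equi_positive (moran Q D) t \<epsilon>)"
        by (elim exE conjE) (rule that)
      have "\<exists>k\<ge>K. equi_positive (tail k) t \<epsilon>" for K
      proof -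
        obtain k where k: "K \<le> k" "\<forall>i<J. \<omega> (k + i) = a" using elim(1) by blast
        then have "\<forall>i<J. \<exists>e>0. N (\<omega> (k + i)) ^ n (k + i) = N a ^ e \<and> B (\<omega> (k + i)) = B a"
          using assms(2) by auto
        with bound shift[of k] have "equi_positive (tail k) t \<epsilon>"
          by (metis (mono_tags, lifting))
        then show ?thesis using k(1) by blast
      qed
      then show ?thesis using \<epsilon> by blast
    qed
    show ?case unfolding random_convolution_eq_moran
      by (intro conjI spectra_of_moran one equi)
  qed
  have "random_measure ?P (random_convolution N B n)"
    using ds space assms(2) by (intro random_measure_moran[of m p N n B R]) auto
  moreover have "1 \<in> real ` ?T" using one by force
  ultimately show ?thesis
    using good by (auto simp: spectral_random_measure_def aleph1_spectral_eigen_set_def)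
qed

end
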